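(* Let $G$ be a connected simply connected Lie group and $\Gamma\subset G$ a totally disconnected dense subgroup. Then the diffeomorphism group $\mathrm{Diff}(G/\Gamma)$ of the diffeological space $G/\Gamma$ is isomorphic, as a diffeological group, to the quotient group $(\mathrm{Aut}_\Gamma(G)\ltimes G)/\Gamma$, where $\Gamma$ is regarded as a normal subgroup of $\mathrm{Aut}_\Gamma(G)\ltimes G$ through $\gamma\mapsto (i_\gamma,\gamma^{-1})$, with $i_\gamma(g)=\gamma g\gamma^{-1}$.
   Context: Diffeologies: a diffeology on a set $M$ is a collection of maps (plots) $\alpha:U\to M$, $U$ open in some $\mathbb{R}^n$, $n\ge 0$, containing all constant maps, closed under precomposition with $\mathcal{C}^\infty$ maps, and such that a map that is locally a plot is a plot. Any set of plots generates a least diffeology containing it. A map between diffeological spaces is differentiable if it sends plots to plots by composition; a diffeomorphism is a differentiable bijection with differentiable inverse. A manifold carries the diffeology of all $\mathcal{C}^\infty$ maps into it. A quotient carries the quotient diffeology: plots are the maps which locally lift to plots upstairs. A subset carries the induced diffeology (plots of the ambient space with values in the subset). A product carries the product diffeology. The space $\mathcal{D}(M,N)$ of differentiable maps carries the functional diffeology, generated by the maps $\alpha:U\to\mathcal{D}(M,N)$ such that $(t,x)\mapsto\alpha(t)(x)$, $U\times M\to N$, is differentiable. A diffeological group is a group with a diffeology for which $(x,y)\mapsto xy^{-1}$ is differentiable; an isomorphism of diffeological groups is a group isomorphism which is a diffeomorphism. $G/\Gamma$ is the set of cosets $g\Gamma$ with the quotient diffeology; it is the quotient map's target $\pi:G\to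 G/\Gamma$. "Totally disconnected" refers to the subspace topology of $\Gamma\subset G$. $\mathrm{Diff}(G/\Gamma)$ has the diffeology induced by $\mathcal{D}(G/\Gamma,G/\Gamma)$. $\mathrm{Aut}_\Gamma(G)$ is the group of Lie group automorphisms $\theta$ of $G$ with $\theta(\Gamma)=\Gamma$, with the diffeology induced from $\mathrm{Diff}(G)\subset\mathcal{D}(G,G)$. The semidirect product $\mathrm{Aut}_\Gamma(G)\ltimes G$ has the product $(\theta_1,g_1)(\theta_2,g_2)=(\theta_1\theta_2,g_1\theta_1(g_2))$ and the product diffeology; its quotient by $\Gamma$ has the quotient diffeology. *)

theory Defs
  imports "HOL-Analysis.Analysis" "HOL-Algebra.Coset" "HOL-Algebra.Bij"
begin

section \<open>Smooth maps between open subsets of Cartesian spaces\<close>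

text \<open>
  A diffeology quantifies over plots of all dimensions, so \<open>\<real>\<^sup>n\<close> is the library's
  \<^const>\<open>Euclidean_space\<close> \<open>n\<close>: the real sequences vanishing from index \<open>n\<close> on.
  The predicates below are meant for open \<open>U\<close>; they only depend on the values of the function on \<open>U\<close>.
\<close>

fun Ck_on :: "nat \<Rightarrow> nat \<Rightarrow> (nat \<Rightarrow> real) set \<Rightarrow> ((nat \<Rightarrow> real) \<Rightarrow> real) \<Rightarrow> bool" where
  "Ck_on n 0 U f \<longleftrightarrow> continuous_map (subtopology (Euclidean_space n) U) euclideanreal f"
| "Ck_on n (Suc k) U f \<longleftrightarrow>
     continuous_map (subtopology (Euclidean_space n) U) euclideanreal f \<and>
     (\<forall>i<n. \<exists>g. (\<forall>x\<in>U. ((\<lambda>t. f (x(i := t))) has_real_derivative g x) (at (x i))) \<and> Ck_on n k U g)"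

definition smooth_on :: "nat \<Rightarrow> (nat \<Rightarrow> real) set \<Rightarrow> nat \<Rightarrow> ((nat \<Rightarrow> real) \<Rightarrow> (nat \<Rightarrow> real)) \<Rightarrow> bool" where
  "smooth_on m U n h \<longleftrightarrow> (\<forall>k. \<forall>i<n. Ck_on m k U (\<lambda>x. h x i))"


section \<open>Manifolds and Lie groups\<close>

record 'a manifold =
  mtop :: "'a topology"
  mdim :: nat
  atlas :: "('a set \<times> ('a \<Rightarrow> (nat \<Rightarrow> real))) set"

definition smooth_manifold :: "'a manifold \<Rightarrow> bool" where
  "smooth_manifold M \<longleftrightarrow>
     Hausdorff_space (mtop M) \<and> second_countable (mtop M) \<and>
     \<Union>(fst ` atlas M) = topspace (mtop M) \<and>
     (\<forall>(V, \<phi>) \<in> atlas M.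
        openin (mtop M) V \<and> openin (Euclidean_space (mdim M)) (\<phi> ` V) \<and>
        homeomorphic_map (subtopology (mtop M) V) (subtopology (Euclidean_space (mdim M)) (\<phi> ` V)) \<phi>) \<and>
     (\<forall>(V, \<phi>) \<in> atlas M. \<forall>(W, \<psi>) \<in> atlas M.
        smooth_on (mdim M) (\<phi> ` (V \<inter> W)) (mdim M) (\<psi> \<circ> inv_into V \<phi>))"

definition smooth_map :: "'a manifold \<Rightarrow> 'b manifold \<Rightarrow> ('a \<Rightarrow> 'b) \<Rightarrow> bool" where
  "smooth_map M N f \<longleftrightarrow>
     continuous_map (mtop M) (mtop N) f \<and>
     (\<forall>(V, \<phi>) \<in> atlas M. \<forall>(W, \<psi>) \<in> atlas N.
        smooth_on (mdim M) (\<phi> ` (V \<inter> f -` W)) (mdim N) (\<psi> \<circ> f \<circ> inv_into V \<phi>))"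

definition open_manifold :: "nat \<Rightarrow> (nat \<Rightarrow> real) set \<Rightarrow> (nat \<Rightarrow> real) manifold" where
  "open_manifold n U = \<lparr>mtop = subtopology (Euclidean_space n) U, mdim = n, atlas = {(U, id)}\<rparr>"

definition prod_manifold :: "'a manifold \<Rightarrow> 'b manifold \<Rightarrow> ('a \<times> 'b) manifold" where
  "prod_manifold M N =
     \<lparr>mtop = prod_topology (mtop M) (mtop N),
      mdim = mdim M + mdim N,
      atlas = {(V \<times> W, \<lambda>(p, q) i. if i < mdim M then \<phi> p i else \<psi> q (i - mdim M)) | V \<phi> W \<psi>.
                 (V, \<phi>) \<in> atlas M \<and> (W, \<psi>) \<in> atlas N}\<rparr>"

definition lie_group :: "('a, 'b) monoid_scheme \<Rightarrow> 'a manifold \<Rightarrow> bool" where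
  "lie_group G M \<longleftrightarrow>
     group G \<and> smooth_manifold M \<and> topspace (mtop M) = carrier G \<and>
     smooth_map (prod_manifold M M) M (\<lambda>(x, y). x \<otimes>\<^bsub>G\<^esub> y) \<and>
     smooth_map M M (\<lambda>x. inv\<^bsub>G\<^esub> x)"

definition simply_connected_space :: "'a topology \<Rightarrow> bool" where
  "simply_connected_space X \<longleftrightarrow>
     path_connected_space X \<and>
     (\<forall>p. pathin X p \<and> p 0 = p 1 \<longrightarrow>
        homotopic_with (\<lambda>q. q 0 = p 0 \<and> q 1 = p 0) (top_of_set {0..1}) X p (\<lambda>_. p 0))"

definition totally_disconnected_space :: "'a topology \<Rightarrow> bool" where
  "totally_disconnected_space X \<longleftrightarrow> (\<forall>C. connectedin X C \<longrightarrow> (\<exists>a. C \<subseteq> {a}))"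


section \<open>Diffeological spaces\<close>

text \<open>
  \<open>plot X n U \<alpha>\<close> says that the restriction of \<open>\<alpha>\<close> to the open set \<open>U\<close> of \<open>\<real>\<^sup>n\<close>
  is a plot of \<open>X\<close>. The values of \<open>\<alpha>\<close> outside \<open>U\<close> are irrelevant: this is part of the last
  clause of \<open>diffeological_space\<close> below (take \<open>V = U\<close>).
\<close>

record 'a dspace =
  points :: "'a set"
  plot :: "nat \<Rightarrow> (nat \<Rightarrow> real) set \<Rightarrow> ((nat \<Rightarrow> real) \<Rightarrow> 'a) \<Rightarrow> bool"

definition diffeological_space :: "'a dspace \<Rightarrow> bool" where
  "diffeological_space X \<longleftrightarrow>
     (\<forall>n U \<alpha>. plot X n U \<alpha> \<longrightarrow> openin (Euclidean_space n) U \<and> \<alpha> \<in> U \<rightarrow> points X) \<and>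
     (\<forall>n U c. openin (Euclidean_space n) U \<and> c \<in> points X \<longrightarrow> plot X n U (\<lambda>_. c)) \<and>
     (\<forall>n U \<alpha> m V h. plot X n U \<alpha> \<and> openin (Euclidean_space m) V \<and> h \<in> V \<rightarrow> U \<and> smooth_on m V n h
        \<longrightarrow> plot X m V (\<alpha> \<circ> h)) \<and>
     (\<forall>n U \<alpha>. openin (Euclidean_space n) U \<and> \<alpha> \<in> U \<rightarrow> points X \<and>
        (\<forall>x\<in>U. \<exists>V \<beta>. x \<in> V \<and> V \<subseteq> U \<and> plot X n V \<beta> \<and> (\<forall>y\<in>V. \<alpha> y = \<beta> y))
        \<longrightarrow> plot X n U \<alpha>)"

definition generated_ds ::
    "'a set \<Rightarrow> (nat \<Rightarrow> (nat \<Rightarrow> real) set \<Rightarrow> ((nat \<Rightarrow> real) \<Rightarrow> 'a) \<Rightarrow> bool) \<Rightarrow> 'a dspace" where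
  "generated_ds S P =
     \<lparr>points = S,
      plot = \<lambda>n U \<alpha>. \<forall>X. diffeological_space X \<and> points X = S \<and>
               (\<forall>m V \<beta>. P m V \<beta> \<longrightarrow> plot X m V \<beta>) \<longrightarrow> plot X n U \<alpha>\<rparr>"

definition ds_differentiable :: "'a dspace \<Rightarrow> 'b dspace \<Rightarrow> ('a \<Rightarrow> 'b) \<Rightarrow> bool" where
  "ds_differentiable X Y f \<longleftrightarrow>
     f \<in> points X \<rightarrow> points Y \<and> (\<forall>n U \<alpha>. plot X n U \<alpha> \<longrightarrow> plot Y n U (f \<circ> \<alpha>))"

definition diffeomorphism :: "'a dspace \<Rightarrow> 'b dspace \<Rightarrow> ('a \<Rightarrow> 'b) \<Rightarrow> bool" where
  "diffeomorphism X Y f \<longleftrightarrow>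
     bij_betw f (points X) (points Y) \<and> ds_differentiable X Y f \<and>
     ds_differentiable Y X (inv_into (points X) f)"

definition manifold_ds :: "'a manifold \<Rightarrow> 'a dspace" where
  "manifold_ds M =
     \<lparr>points = topspace (mtop M),
      plot = \<lambda>n U \<alpha>. openin (Euclidean_space n) U \<and> smooth_map (open_manifold n U) M \<alpha>\<rparr>"

text \<open>The quotient is presented by its quotient map \<open>\<pi>\<close>, which is onto by construction.\<close>

definition quotient_ds :: "'a dspace \<Rightarrow> ('a \<Rightarrow> 'b) \<Rightarrow> 'b dspace" where
  "quotient_ds X \<pi> =
     \<lparr>points = \<pi> ` points X,
      plot = \<lambda>n U \<alpha>. openin (Euclidean_space n) U \<and>
               (\<forall>x\<in>U. \<exists>V \<beta>. x \<in> V \<and> V \<subseteq> U \<and> plot X n V \<beta> \<and> (\<forall>y\<in>V. \<alpha> y = \<pi> (\<beta> y)))\<rparr>"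

definition subset_ds :: "'a dspace \<Rightarrow> 'a set \<Rightarrow> 'a dspace" where
  "subset_ds X A = \<lparr>points = A, plot = \<lambda>n U \<alpha>. plot X n U \<alpha> \<and> \<alpha> \<in> U \<rightarrow> A\<rparr>"

definition prod_ds :: "'a dspace \<Rightarrow> 'b dspace \<Rightarrow> ('a \<times> 'b) dspace" where
  "prod_ds X Y =
     \<lparr>points = points X \<times> points Y,
      plot = \<lambda>n U \<alpha>. plot X n U (fst \<circ> \<alpha>) \<and> plot Y n U (snd \<circ> \<alpha>)\<rparr>"

text \<open>Maps between carrier sets are represented by extensional functions, as in \<^const>\<open>Bij\<close>.\<close>

definition diff_maps :: "'a dspace \<Rightarrow> 'b dspace \<Rightarrow> ('a \<Rightarrow> 'b) set" where
  "diff_maps X Y = {f \<in> points X \<rightarrow>\<^sub>E points Y. ds_differentiable X Y f}"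

definition functional_ds :: "'a dspace \<Rightarrow> 'b dspace \<Rightarrow> ('a \<Rightarrow> 'b) dspace" where
  "functional_ds X Y =
     generated_ds (diff_maps X Y)
       (\<lambda>n U \<alpha>. openin (Euclidean_space n) U \<and> \<alpha> \<in> U \<rightarrow> diff_maps X Y \<and>
          ds_differentiable (prod_ds (manifold_ds (open_manifold n U)) X) Y (\<lambda>(t, x). \<alpha> t x))"

definition Diff :: "'a dspace \<Rightarrow> ('a \<Rightarrow> 'a) set" where
  "Diff X = {f \<in> Bij (points X). diffeomorphism X X f}"

definition Diff_group :: "'a dspace \<Rightarrow> ('a \<Rightarrow> 'a) monoid" where
  "Diff_group X = (BijGroup (points X)) \<lparr>carrier := Diff X\<rparr>"

definition Diff_ds :: "'a dspace \<Rightarrow> ('a \<Rightarrow> 'a) dspace" where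
  "Diff_ds X = subset_ds (functional_ds X X) (Diff X)"


section \<open>Diffeological groups\<close>

definition diffeological_group :: "('a, 'b) monoid_scheme \<Rightarrow> 'a dspace \<Rightarrow> bool" where
  "diffeological_group G X \<longleftrightarrow>
     group G \<and> diffeological_space X \<and> points X = carrier G \<and>
     ds_differentiable (prod_ds X X) X (\<lambda>(x, y). x \<otimes>\<^bsub>G\<^esub> inv\<^bsub>G\<^esub> y)"

definition dgroup_iso ::
    "('a, 'c) monoid_scheme \<Rightarrow> 'a dspace \<Rightarrow> ('b, 'd) monoid_scheme \<Rightarrow> 'b dspace \<Rightarrow> ('a \<Rightarrow> 'b) set" where
  "dgroup_iso G X H Y =
     {\<Phi> \<in> iso G H. diffeological_group G X \<and> diffeological_group H Y \<and> diffeomorphism X Y \<Phi>}"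


section \<open>The quotient \<open>G/\<Gamma>\<close> and the semidirect product\<close>

definition coset_ds :: "('a, 'b) monoid_scheme \<Rightarrow> 'a manifold \<Rightarrow> 'a set \<Rightarrow> 'a set dspace" where
  "coset_ds G M \<Gamma> = quotient_ds (manifold_ds M) (\<lambda>g. g <#\<^bsub>G\<^esub> \<Gamma>)"

definition Aut_pair :: "('a, 'b) monoid_scheme \<Rightarrow> 'a manifold \<Rightarrow> 'a set \<Rightarrow> ('a \<Rightarrow> 'a) set" where
  "Aut_pair G M \<Gamma> =
     {\<theta> \<in> auto G. smooth_map M M \<theta> \<and> smooth_map M M (inv_into (carrier G) \<theta>) \<and> \<theta> ` \<Gamma> = \<Gamma>}"

definition semidirect :: "('a, 'b) monoid_scheme \<Rightarrow> 'a manifold \<Rightarrow> 'a set \<Rightarrow> (('a \<Rightarrow> 'a) \<times> 'a) monoid" where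
  "semidirect G M \<Gamma> =
     \<lparr>carrier = Aut_pair G M \<Gamma> \<times> carrier G,
      mult = \<lambda>(\<theta>\<^sub>1, g\<^sub>1) (\<theta>\<^sub>2, g\<^sub>2). (compose (carrier G) \<theta>\<^sub>1 \<theta>\<^sub>2, g\<^sub>1 \<otimes>\<^bsub>G\<^esub> \<theta>\<^sub>1 g\<^sub>2),
      one = (\<lambda>x\<in>carrier G. x, \<one>\<^bsub>G\<^esub>)\<rparr>"

definition semidirect_ds ::
    "('a, 'b) monoid_scheme \<Rightarrow> 'a manifold \<Rightarrow> 'a set \<Rightarrow> (('a \<Rightarrow> 'a) \<times> 'a) dspace" where
  "semidirect_ds G M \<Gamma> =
     prod_ds (subset_ds (Diff_ds (manifold_ds M)) (Aut_pair G M \<Gamma>)) (manifold_ds M)"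

definition gamma_emb :: "('a, 'b) monoid_scheme \<Rightarrow> 'a \<Rightarrow> ('a \<Rightarrow> 'a) \<times> 'a" where
  "gamma_emb G \<gamma> = (\<lambda>g\<in>carrier G. \<gamma> \<otimes>\<^bsub>G\<^esub> g \<otimes>\<^bsub>G\<^esub> inv\<^bsub>G\<^esub> \<gamma>, inv\<^bsub>G\<^esub> \<gamma>)"

text \<open>
  The library's \<open>Mod\<close> uses right cosets; for the normal subgroup at hand these are the left cosets.
\<close>

definition semidirect_quot :: "('a, 'b) monoid_scheme \<Rightarrow> 'a manifold \<Rightarrow> 'a set \<Rightarrow> (('a \<Rightarrow> 'a) \<times> 'a) set monoid" where
  "semidirect_quot G M \<Gamma> = semidirect G M \<Gamma> Mod (gamma_emb G ` \<Gamma>)"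

definition semidirect_quot_ds ::
    "('a, 'b) monoid_scheme \<Rightarrow> 'a manifold \<Rightarrow> 'a set \<Rightarrow> (('a \<Rightarrow> 'a) \<times> 'a) set dspace" where
  "semidirect_quot_ds G M \<Gamma> =
     quotient_ds (semidirect_ds G M \<Gamma>) (\<lambda>s. (gamma_emb G ` \<Gamma>) #>\<^bsub>semidirect G M \<Gamma>\<^esub> s)"

end

theory Submission
  imports Defs "HOL-Homology.Invariance_of_Domain" "Jordan_Normal_Form.Determinant"
begin

text \<open>
  Two continuous lifts to \<open>G\<close> of the same map from a connected space to \<open>G/\<Gamma>\<close> differ by a
  continuous map into \<open>\<Gamma>\<close>, hence by a constant, because \<open>\<Gamma>\<close> is totally disconnected. So lifts
  behave as in a covering, and if \<open>\<alpha>\<close> is a plot of \<open>Diff(G/\<Gamma>)\<close> on a box \<open>B\<close>, the map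
  \<open>(t, x) \<mapsto> \<alpha>\<^sub>t(x\<Gamma>)\<close>, which lifts locally, has a global smooth lift \<open>A : B \<times> G \<rightarrow> G\<close>, because
  \<open>B \<times> G\<close> is simply connected. For fixed \<open>t\<close> and \<open>\<gamma> \<in> \<Gamma>\<close> the element \<open>A\<^sub>t(x)\<inverse> A\<^sub>t(x\<gamma>)\<close> of \<open>\<Gamma>\<close> does not depend
  on \<open>x\<close>; by density of \<open>\<Gamma>\<close>, \<open>\<theta>\<^sub>t(x) = A\<^sub>t(1)\<inverse> A\<^sub>t(x)\<close> is a homomorphism. Thus \<open>\<alpha>\<close> is locally the image of
  the plot \<open>(\<theta>\<^sub>t, A\<^sub>t(1))\<close> of \<open>Aut\<^sub>\<Gamma>(G) \<ltimes> G\<close>, so \<open>(\<theta>, g) \<mapsto> (x\<Gamma> \<mapsto> g\<theta>(x)\<Gamma>)\<close> is onto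
  \<open>Diff(G/\<Gamma>)\<close> and induces its diffeology; its kernel is \<open>\<Gamma>\<close>. Inversion in \<open>Diff(G/\<Gamma>)\<close> is
  differentiable because it is so in \<open>Aut\<^sub>\<Gamma>(G)\<close>, by an inverse function argument: for a family \<open>\<theta>\<^sub>t\<close> of
  automorphisms, \<open>(t, x) \<mapsto> (t, \<theta>\<^sub>t(x))\<close> is injective and has invertible derivative.
\<close>

section \<open>Differential calculus on open subsets of Euclidean space\<close>

text \<open>A dense \<open>\<Gamma>\<close> makes the quotient topology of \<open>G/\<Gamma>\<close>
  indiscrete, so the projection is not a covering and nothing can be read off from open sets
  downstairs. Local lifts come instead from the definition of the quotient diffeology, and maps into
  \<open>G/\<Gamma>\<close> are handled as set-valued maps without a topology. The global lift
  obtained by following paths is at first only continuous; it becomes smooth because on small boxes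
  it differs from a local smooth lift by a constant. The diffeology of
  \<open>Diff(G/\<Gamma>)\<close> is induced from the space of differentiable maps and says nothing
  about inverses, so smooth inversion is a genuine theorem. Lifting reduces it to finitely many
  variables. There injectivity is known on the whole domain, so invariance of domain supplies an
  open image and a continuous inverse, and only the derivative of the inverse remains to be
  computed. Dimensions of plots are terms, not types; hence calculus by partial derivatives on
  sequences, with Jacobians as matrices of variable size.\<close>

definition ebox :: "nat \<Rightarrow> (nat \<Rightarrow> real) \<Rightarrow> real \<Rightarrow> (nat \<Rightarrow> real) set" where
  "ebox n x e = {y \<in> topspace (Euclidean_space n). \<forall>i<n. \<bar>y i - x i\<bar> < e}"

lemma continuous_map_Euclidean_coord:
  "continuous_map (subtopology (Euclidean_space n) U) euclideanreal (\<lambda>x. x i)"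
  unfolding Euclidean_space_def
  by (intro continuous_map_from_subtopology continuous_map_product_projection) auto

lemma continuous_map_into_Euclidean:
  "continuous_map X (subtopology (Euclidean_space n) U) f \<longleftrightarrow>
     (\<forall>i<n. continuous_map X euclideanreal (\<lambda>x. f x i)) \<and>
     f \<in> topspace X \<rightarrow> U \<inter> topspace (Euclidean_space n)"  (is "?l \<longleftrightarrow> ?r")
proof
  assume l: ?l
  have "continuous_map X euclideanreal (\<lambda>x. f x i)" for i
    using continuous_map_compose [OF l continuous_map_Euclidean_coord] by (simp add: o_def)
  then show ?r using l by (auto simp: continuous_map_def)
next
  assume r: ?r
  \<comment> \<open>Truncation at \<open>n\<close> changes nothing on \<open>topspace X\<close>,
    where the values vanish from index \<open>n\<close> on.\<close>
  have "continuous_map X (Euclidean_space n) (\<lambda>x i. if i < n then f x i else 0)"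
    using r by (simp add: continuous_map_componentwise_Euclidean_space)
  moreover have "(\<lambda>i. if i < n then f x i else 0) = f x" if "x \<in> topspace X" for x
    using r that by (fastforce simp: topspace_Euclidean_space fun_eq_iff)
  ultimately have "continuous_map X (Euclidean_space n) f"
    by (rule continuous_map_eq)
  then show ?l using r by (simp add: continuous_map_in_subtopology Pi_iff image_subset_iff)
qed

lemma ebox_sub: "ebox n x e \<subseteq> topspace (Euclidean_space n)"
  by (auto simp: ebox_def)

lemma ebox_self: "x \<in> topspace (Euclidean_space n) \<Longrightarrow> e > 0 \<Longrightarrow> x \<in> ebox n x e"
  by (auto simp: ebox_def)

lemma openin_ebox: "openin (Euclidean_space n) (ebox n x e)"
proof -
  let ?X = "\<lambda>i. if i < n then ball (x i) e else (UNIV :: real set)"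
  have "openin (powertop_real UNIV) (PiE UNIV ?X)"
    by (rule product_topology_basis) (auto intro: finite_subset [where B = "{..<n}"])
  moreover have "ebox n x e = PiE UNIV ?X \<inter> {x. \<forall>i\<ge>n. x i = 0}"
    by (auto simp: ebox_def topspace_Euclidean_space PiE_iff dist_real_def abs_minus_commute split: if_splits)
  ultimately show ?thesis
    unfolding Euclidean_space_def openin_subtopology by blast
qed

text \<open>All points of the space agree from coordinate \<open>n\<close> on, so only the first
  \<open>n\<close> factors of a basic open set of the product topology restrict anything, and the
  smallest of finitely many radii will do.\<close>

lemma openin_contains_ebox:
  assumes "openin (Euclidean_space n) U" "x \<in> U"
  obtains e where "e > 0" "ebox n x e \<subseteq> U"
proof -
  obtain T where T: "openin (powertop_real UNIV) T" and U: "U = T \<inter> {x. \<forall>i\<ge>n. x i = 0}"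
    using assms unfolding Euclidean_space_def openin_subtopology by blast
  obtain X where X: "x \<in> PiE UNIV X" "\<And>i. open (X i)" "PiE UNIV X \<subseteq> T"
    using product_topology_open_contains_basis [OF T, of x] assms(2) U by auto
  have "\<forall>i. \<exists>d>0. ball (x i) d \<subseteq> X i"
    using X(1,2) open_contains_ball by (metis PiE_mem UNIV_I)
  then obtain d where d: "\<And>i. d i > 0" "\<And>i. ball (x i) (d i) \<subseteq> X i" by metis
  \<comment> \<open>\<open>insert 1\<close> keeps the minimum meaningful for
    \<open>n = 0\<close>.\<close>
  define e where "e = Min (insert 1 (d ` {..<n}))"
  have e: "e > 0" "\<And>i. i < n \<Longrightarrow> e \<le> d i" using d(1) by (auto simp: e_def)
  have "y \<in> U" if y: "y \<in> ebox n x e" for y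
  proof -
    have "y i \<in> X i" for i
    proof (cases "i < n")
      case True
      then have "\<bar>y i - x i\<bar> < d i" using y e(2) [OF True] by (auto simp: ebox_def)
      then show ?thesis using d(2) [of i] by (auto simp: dist_real_def abs_minus_commute subset_iff)
    next
      case False
      then have "y i = x i" using y assms(2) U by (auto simp: ebox_def topspace_Euclidean_space)
      then show ?thesis using X(1) by auto
    qed
    then show ?thesis using y X(3) U by (auto simp: ebox_def topspace_Euclidean_space)
  qed
  then show ?thesis using that e(1) by blast
qed

lemma ebox_mono: "d \<le> e \<Longrightarrow> ebox n x d \<subseteq> ebox n x e"
  by (force simp: ebox_def)

lemma pathin_segment:
  assumes "x \<in> topspace (Euclidean_space n)" "y \<in> topspace (Euclidean_space n)"
  shows "pathin (Euclidean_space n) (\<lambda>s i. x i + s * (y i - x i))"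
proof -
  have "continuous_map (top_of_set {0..1}) (subtopology (Euclidean_space n) UNIV) (\<lambda>s i. x i + s * (y i - x i))"
    unfolding continuous_map_into_Euclidean using assms
    by (auto simp: topspace_Euclidean_space intro!: continuous_intros)
  then show ?thesis by (simp add: pathin_def)
qed

lemma segment_in_ebox:
  assumes "y \<in> ebox n x e" "x \<in> topspace (Euclidean_space n)" "s \<in> {0..1}"
  shows "(\<lambda>i. x i + s * (y i - x i)) \<in> ebox n x e"
proof -
  have "\<bar>s * (y i - x i)\<bar> < e" if "i < n" for i
  proof -
    have "\<bar>s * (y i - x i)\<bar> \<le> \<bar>y i - x i\<bar>"
      using assms(3) by (auto simp: abs_mult intro: mult_left_le_one_le)
    then show ?thesis using assms(1) that by (auto simp: ebox_def intro: le_less_trans)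
  qed
  then show ?thesis using assms by (auto simp: ebox_def topspace_Euclidean_space)
qed

lemma path_connectedin_ebox:
  assumes "x \<in> topspace (Euclidean_space n)"
  shows "path_connectedin (Euclidean_space n) (ebox n x e)"
proof -
  have *: "path_component_of (subtopology (Euclidean_space n) (ebox n x e)) x y" if y: "y \<in> ebox n x e" for y
    unfolding path_component_of_def
  proof (intro exI conjI)
    show "pathin (subtopology (Euclidean_space n) (ebox n x e)) (\<lambda>s i. x i + s * (y i - x i))"
      using pathin_segment [OF assms, of y] segment_in_ebox [OF y assms] subsetD [OF ebox_sub y]
      by (auto simp: pathin_subtopology)
  qed auto
  show ?thesis
    unfolding path_connectedin_def path_connected_space_iff_path_component
    using * ebox_sub by (auto 0 0) (meson "*" path_component_of_trans path_component_of_sym)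
qed

text \<open>The filter is \<open>nhds\<close> and not \<open>at\<close>: replacing a function by one
  that agrees with it on \<open>U\<close> must preserve the value at the base point as well, or its
  derivative there could be lost.\<close>

lemma openin_coord_line:
  assumes "openin (Euclidean_space n) U" "x \<in> U" "i < n"
  shows "\<forall>\<^sub>F t in nhds (x i). x(i := t) \<in> U"
proof -
  obtain e where e: "e > 0" "ebox n x e \<subseteq> U" using openin_contains_ebox assms by blast
  have "x \<in> topspace (Euclidean_space n)" using assms openin_subset by blast
  then have "x(i := t) \<in> U" if "dist t (x i) < e" for t
    using that e assms(3) by (auto simp: ebox_def topspace_Euclidean_space dist_real_def subset_iff)
  then show ?thesis unfolding eventually_nhds_metric using e(1) by blast
qed

section \<open>Partial derivatives and functions of class C^k\<close>

definition pd :: "nat \<Rightarrow> ((nat \<Rightarrow> real) \<Rightarrow> real) \<Rightarrow> (nat \<Rightarrow> real) \<Rightarrow> real" where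
  "pd i f x = deriv (\<lambda>t. f (x(i := t))) (x i)"

lemma Ck_on_C0: "Ck_on n k U f \<Longrightarrow> continuous_map (subtopology (Euclidean_space n) U) euclideanreal f"
  by (cases k) auto

lemma deriv_cong_open:
  assumes "openin (Euclidean_space n) U" "\<And>x. x \<in> U \<Longrightarrow> f x = g x" "x \<in> U" "i < n"
    "((\<lambda>t. f (x(i := t))) has_real_derivative D) (at (x i))"
  shows "((\<lambda>t. g (x(i := t))) has_real_derivative D) (at (x i))"
proof -
  have "\<forall>\<^sub>F t in nhds (x i). f (x(i := t)) = g (x(i := t))"
    using openin_coord_line [OF assms(1,3,4)] by eventually_elim (use assms(2) in auto)
  from DERIV_cong_ev [OF refl this refl] assms(5) show ?thesis by simp
qed

lemma Ck_on_SucI: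
  assumes "continuous_map (subtopology (Euclidean_space n) U) euclideanreal f"
    "\<And>i x. i < n \<Longrightarrow> x \<in> U \<Longrightarrow> ((\<lambda>t. f (x(i := t))) has_real_derivative g i x) (at (x i))"
    "\<And>i. i < n \<Longrightarrow> Ck_on n k U (g i)"
  shows "Ck_on n (Suc k) U f"
  unfolding Ck_on.simps(2)
proof (intro conjI allI impI)
  show "\<exists>h. (\<forall>x\<in>U. ((\<lambda>t. f (x(i := t))) has_real_derivative h x) (at (x i))) \<and> Ck_on n k U h" if "i < n" for i
    by (intro exI [of _ "g i"] conjI ballI assms that)
qed (rule assms(1))

lemma Ck_on_SucE:
  assumes "Ck_on n (Suc k) U f"
  obtains g where "\<And>i x. i < n \<Longrightarrow> x \<in> U \<Longrightarrow> ((\<lambda>t. f (x(i := t))) has_real_derivative g i x) (at (x i))"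
    "\<And>i. i < n \<Longrightarrow> Ck_on n k U (g i)"
proof -
  have "\<exists>g. \<forall>i. i < n \<longrightarrow> (\<forall>x\<in>U. ((\<lambda>t. f (x(i := t))) has_real_derivative g i x) (at (x i))) \<and> Ck_on n k U (g i)"
    using assms unfolding Ck_on.simps(2) by (intro choice) blast
  then show thesis using that by blast
qed

declare Ck_on.simps(2) [simp del]

lemma Ck_on_cong:
  assumes "openin (Euclidean_space n) U" "\<And>x. x \<in> U \<Longrightarrow> f x = g x" "Ck_on n k U f"
  shows "Ck_on n k U g"
proof -
  have c: "continuous_map (subtopology (Euclidean_space n) U) euclideanreal g"
    using Ck_on_C0 [OF assms(3)] by (rule continuous_map_eq) (use assms(2) in auto)
  show ?thesis
  proof (cases k)
    case 0 then show ?thesis using c by simp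
  next
    case (Suc k')
    obtain h where h: "\<And>i x. i < n \<Longrightarrow> x \<in> U \<Longrightarrow> ((\<lambda>t. f (x(i := t))) has_real_derivative h i x) (at (x i))"
      "\<And>i. i < n \<Longrightarrow> Ck_on n k' U (h i)"
      using Ck_on_SucE assms(3) [unfolded Suc] by blast
    show ?thesis unfolding Suc
      by (rule Ck_on_SucI [OF c _ h(2)]) (rule deriv_cong_open [OF assms(1,2) _ _ h(1)])
  qed
qed

lemma pd_eqI: "((\<lambda>t. f (x(i := t))) has_real_derivative D) (at (x i)) \<Longrightarrow> pd i f x = D"
  by (simp add: pd_def DERIV_imp_deriv)

text \<open>Derivatives are unique, so on an open set the existential witnesses in
  \<open>Ck_on\<close> can be traded for the canonical \<open>pd\<close>, which does not depend on
  the set.\<close>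

lemma Ck_on_Suc_pd:
  assumes "openin (Euclidean_space n) U"
  shows "Ck_on n (Suc k) U f \<longleftrightarrow>
    continuous_map (subtopology (Euclidean_space n) U) euclideanreal f \<and>
     (\<forall>i<n. (\<forall>x\<in>U. ((\<lambda>t. f (x(i := t))) has_real_derivative pd i f x) (at (x i))) \<and> Ck_on n k U (pd i f))"
proof
  assume L: "Ck_on n (Suc k) U f"
  show "continuous_map (subtopology (Euclidean_space n) U) euclideanreal f \<and>
     (\<forall>i<n. (\<forall>x\<in>U. ((\<lambda>t. f (x(i := t))) has_real_derivative pd i f x) (at (x i))) \<and> Ck_on n k U (pd i f))"
  proof (intro conjI allI impI ballI)
    fix i assume i: "i < n"
    obtain g where g: "\<And>i x. i < n \<Longrightarrow> x \<in> U \<Longrightarrow> ((\<lambda>t. f (x(i := t))) has_real_derivative g i x) (at (x i))"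
      "\<And>i. i < n \<Longrightarrow> Ck_on n k U (g i)"
      using Ck_on_SucE L by blast
    have eq: "g i x = pd i f x" if "x \<in> U" for x using pd_eqI [OF g(1) [OF i that]] by simp
    show "((\<lambda>t. f (x(i := t))) has_real_derivative pd i f x) (at (x i))" if "x \<in> U" for x
      using g(1) [OF i that] eq [OF that] by simp
    show "Ck_on n k U (pd i f)" using Ck_on_cong [OF assms eq g(2)] i by simp
  qed (rule Ck_on_C0 [OF L])
next
  assume R: "continuous_map (subtopology (Euclidean_space n) U) euclideanreal f \<and>
     (\<forall>i<n. (\<forall>x\<in>U. ((\<lambda>t. f (x(i := t))) has_real_derivative pd i f x) (at (x i))) \<and> Ck_on n k U (pd i f))"
  show "Ck_on n (Suc k) U f"
    by (rule Ck_on_SucI [where g = "\<lambda>i. pd i f"]) (use R in auto)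
qed

lemma Ck_on_SucD:
  assumes "Ck_on n (Suc k) U f" shows "Ck_on n k U f"
  using assms
proof (induction k arbitrary: f)
  case (Suc k)
  obtain g where g: "\<And>i x. i < n \<Longrightarrow> x \<in> U \<Longrightarrow> ((\<lambda>t. f (x(i := t))) has_real_derivative g i x) (at (x i))"
      "\<And>i. i < n \<Longrightarrow> Ck_on n (Suc k) U (g i)"
    using Ck_on_SucE Suc.prems by blast
  show ?case
    by (rule Ck_on_SucI [OF Ck_on_C0 [OF Suc.prems] g(1) Suc.IH [OF g(2)]])
qed (simp add: Ck_on_C0)

lemma Ck_on_le: "Ck_on n k U f \<Longrightarrow> j \<le> k \<Longrightarrow> Ck_on n j U f"
  by (induction k) (use Ck_on_SucD le_Suc_eq in blast)+

lemma Ck_on_subset: "Ck_on n k U f \<Longrightarrow> V \<subseteq> U \<Longrightarrow> Ck_on n k V f"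
proof (induction k arbitrary: f)
  case 0
  then show ?case using continuous_map_from_subtopology_mono by auto
next
  case (Suc k)
  have c: "continuous_map (subtopology (Euclidean_space n) V) euclideanreal f"
    using Suc.prems continuous_map_from_subtopology_mono Ck_on_C0 by metis
  obtain g where g: "\<And>i x. i < n \<Longrightarrow> x \<in> U \<Longrightarrow> ((\<lambda>t. f (x(i := t))) has_real_derivative g i x) (at (x i))"
      "\<And>i. i < n \<Longrightarrow> Ck_on n k U (g i)"
    using Ck_on_SucE Suc.prems by blast
  show ?case
    by (rule Ck_on_SucI [where g = g, OF c]) (use g Suc in blast)+
qed

text \<open>Witnesses chosen separately on each neighbourhood would have to be glued;
  \<open>pd\<close> is one function for all of them, so the induction can be applied to it
  directly.\<close>

lemma Ck_on_local:
  assumes "openin (Euclidean_space n) U"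
    and "\<And>x. x \<in> U \<Longrightarrow> \<exists>V. openin (Euclidean_space n) V \<and> x \<in> V \<and> Ck_on n k V f"
  shows "Ck_on n k U f"
  using assms(2)
proof (induction k arbitrary: f)
  case 0
  then obtain V where V: "\<And>x. x \<in> U \<Longrightarrow> openin (Euclidean_space n) (V x) \<and> x \<in> V x \<and> Ck_on n 0 (V x) f" by metis
  have "continuous_map (subtopology (Euclidean_space n) U) euclideanreal f"
  proof (rule pasting_lemma [where I = U and T = "\<lambda>x. U \<inter> V x" and f = "\<lambda>_. f"])
    show "openin (subtopology (Euclidean_space n) U) (U \<inter> V i)" if "i \<in> U" for i
      using V [OF that] by (auto simp: openin_subtopology)
    show "continuous_map (subtopology (subtopology (Euclidean_space n) U) (U \<inter> V i)) euclideanreal f" if "i \<in> U" for i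
      using V [OF that] continuous_map_from_subtopology_mono [of "Euclidean_space n" "V i" _ _ "U \<inter> (U \<inter> V i)"]
      by (auto simp: subtopology_subtopology)
    show "\<And>x. x \<in> topspace (subtopology (Euclidean_space n) U) \<Longrightarrow> \<exists>j. j \<in> U \<and> x \<in> U \<inter> V j \<and> f x = f x"
      using V by auto
  qed auto
  then show ?case by simp
next
  case (Suc k)
  have c: "Ck_on n k U f" using Suc Ck_on_SucD by meson
  show ?case unfolding Ck_on_Suc_pd [OF assms(1)]
  proof (intro conjI allI impI ballI)
    show "continuous_map (subtopology (Euclidean_space n) U) euclideanreal f" using c Ck_on_C0 by blast
    fix i assume i: "i < n"
    show "Ck_on n k U (pd i f)"
      by (rule Suc.IH) (use Suc.prems Ck_on_Suc_pd i in meson)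
    fix x assume "x \<in> U"
    then show "((\<lambda>t. f (x(i := t))) has_real_derivative pd i f x) (at (x i))"
      using Suc.prems Ck_on_Suc_pd i by meson
  qed
qed

lemma Ck_on_const: "Ck_on n k U (\<lambda>_. c)"
proof (induction k arbitrary: c)
  case (Suc k)
  show ?case by (rule Ck_on_SucI [where g = "\<lambda>_ _. 0"]) (auto simp: Suc)
qed auto

lemma Ck_on_coord: "Ck_on n k U (\<lambda>x. x j)"
proof (cases k)
  case 0 then show ?thesis by (simp add: continuous_map_Euclidean_coord)
next
  case (Suc k')
  show ?thesis unfolding Suc
    by (rule Ck_on_SucI [where g = "\<lambda>i _. if i = j then 1 else 0"])
      (auto simp: continuous_map_Euclidean_coord Ck_on_const)
qed

lemma Ck_on_add: "Ck_on n k U f \<Longrightarrow> Ck_on n k U g \<Longrightarrow> Ck_on n k U (\<lambda>x. f x + g x)"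
proof (induction k arbitrary: f g)
  case 0 then show ?case by (simp add: continuous_map_add)
next
  case (Suc k)
  obtain f' where f': "\<And>i x. i < n \<Longrightarrow> x \<in> U \<Longrightarrow> ((\<lambda>t. f (x(i := t))) has_real_derivative f' i x) (at (x i))"
      "\<And>i. i < n \<Longrightarrow> Ck_on n k U (f' i)"
    using Ck_on_SucE Suc.prems(1) by blast
  obtain g' where g': "\<And>i x. i < n \<Longrightarrow> x \<in> U \<Longrightarrow> ((\<lambda>t. g (x(i := t))) has_real_derivative g' i x) (at (x i))"
      "\<And>i. i < n \<Longrightarrow> Ck_on n k U (g' i)"
    using Ck_on_SucE Suc.prems(2) by blast
  show ?case
  proof (rule Ck_on_SucI [where g = "\<lambda>i x. f' i x + g' i x"])
    show "continuous_map (subtopology (Euclidean_space n) U) euclideanreal (\<lambda>x. f x + g x)"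
      by (intro continuous_map_add Ck_on_C0 [OF Suc.prems(1)] Ck_on_C0 [OF Suc.prems(2)])
    show "((\<lambda>t. f (x(i := t)) + g (x(i := t))) has_real_derivative f' i x + g' i x) (at (x i))"
      if "i < n" "x \<in> U" for i x
      using f'(1) [OF that] g'(1) [OF that] by (intro DERIV_add) auto
    show "Ck_on n k U (\<lambda>x. f' i x + g' i x)" if "i < n" for i
      using f'(2) [OF that] g'(2) [OF that] by (intro Suc.IH) auto
  qed
qed

lemma Ck_on_mult: "Ck_on n k U f \<Longrightarrow> Ck_on n k U g \<Longrightarrow> Ck_on n k U (\<lambda>x. f x * g x)"
proof (induction k arbitrary: f g)
  case 0 then show ?case by (simp add: continuous_map_real_mult)
next
  case (Suc k)
  obtain f' where f': "\<And>i x. i < n \<Longrightarrow> x \<in> U \<Longrightarrow> ((\<lambda>t. f (x(i := t))) has_real_derivative f' i x) (at (x i))"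
      "\<And>i. i < n \<Longrightarrow> Ck_on n k U (f' i)"
    using Ck_on_SucE Suc.prems(1) by blast
  obtain g' where g': "\<And>i x. i < n \<Longrightarrow> x \<in> U \<Longrightarrow> ((\<lambda>t. g (x(i := t))) has_real_derivative g' i x) (at (x i))"
      "\<And>i. i < n \<Longrightarrow> Ck_on n k U (g' i)"
    using Ck_on_SucE Suc.prems(2) by blast
  show ?case
  proof (rule Ck_on_SucI [where g = "\<lambda>i x. f' i x * g x + g' i x * f x"])
    show "continuous_map (subtopology (Euclidean_space n) U) euclideanreal (\<lambda>x. f x * g x)"
      by (intro continuous_map_real_mult Ck_on_C0 [OF Suc.prems(1)] Ck_on_C0 [OF Suc.prems(2)])
    show "((\<lambda>t. f (x(i := t)) * g (x(i := t))) has_real_derivative f' i x * g x + g' i x * f x) (at (x i))"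
      if "i < n" "x \<in> U" for i x
      using DERIV_mult [of "\<lambda>t. f (x(i := t))" _ "x i" UNIV "\<lambda>t. g (x(i := t))"] f'(1) [OF that] g'(1) [OF that]
      by auto
    show "Ck_on n k U (\<lambda>x. f' i x * g x + g' i x * f x)" if "i < n" for i
      using f'(2) [OF that] g'(2) [OF that] Suc.prems [THEN Ck_on_SucD] by (intro Ck_on_add Suc.IH) auto
  qed
qed

lemma Ck_on_sum: "(\<And>j. j \<in> J \<Longrightarrow> Ck_on n k U (f j)) \<Longrightarrow> Ck_on n k U (\<lambda>x. \<Sum>j\<in>J. f j x)"
  by (induction J rule: infinite_finite_induct) (auto intro: Ck_on_add Ck_on_const)

lemma Ck_on_prod: "(\<And>j. j \<in> J \<Longrightarrow> Ck_on n k U (f j)) \<Longrightarrow> Ck_on n k U (\<lambda>x. \<Prod>j\<in>J. f j x)"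
  by (induction J rule: infinite_finite_induct) (auto intro: Ck_on_mult Ck_on_const)

text \<open>The derivative of the reciprocal is written with the reciprocal itself as a factor, so
  that the induction hypothesis covers it.\<close>

lemma Ck_on_inverse:
  "Ck_on n k U f \<Longrightarrow> (\<And>x. x \<in> U \<Longrightarrow> f x \<noteq> 0) \<Longrightarrow> Ck_on n k U (\<lambda>x. inverse (f x))"
proof (induction k)
  case 0 then show ?case by (auto intro!: continuous_map_real_inverse)
next
  case (Suc k)
  obtain f' where f': "\<And>i x. i < n \<Longrightarrow> x \<in> U \<Longrightarrow> ((\<lambda>t. f (x(i := t))) has_real_derivative f' i x) (at (x i))"
      "\<And>i. i < n \<Longrightarrow> Ck_on n k U (f' i)"
    using Ck_on_SucE Suc.prems(1) by blast
  have IH: "Ck_on n k U (\<lambda>x. inverse (f x))" using Suc Ck_on_SucD by blast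
  show ?case
  proof (rule Ck_on_SucI [where g = "\<lambda>i x. (-1) * (inverse (f x) * f' i x * inverse (f x))"])
    show "continuous_map (subtopology (Euclidean_space n) U) euclideanreal (\<lambda>x. inverse (f x))"
      using IH Ck_on_C0 by blast
    show "((\<lambda>t. inverse (f (x(i := t)))) has_real_derivative (-1) * (inverse (f x) * f' i x * inverse (f x))) (at (x i))"
      if "i < n" "x \<in> U" for i x
      using DERIV_inverse' [of "\<lambda>t. f (x(i := t))" "f' i x" "x i" UNIV] f'(1) [OF that] Suc.prems(2) that(2)
      by auto
    show "Ck_on n k U (\<lambda>x. (-1) * (inverse (f x) * f' i x * inverse (f x)))" if "i < n" for i
      using f'(2) [OF that] IH by (intro Ck_on_mult Ck_on_const) auto
  qed
qed

section \<open>Mean value theorem, factorisation of increments, chain rule\<close>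

lemma C0_ebox:
  assumes "openin (Euclidean_space n) U" "continuous_map (subtopology (Euclidean_space n) U) euclideanreal f"
    "x \<in> U" "\<epsilon> > 0"
  obtains \<delta> where "\<delta> > 0" "\<And>y. y \<in> ebox n x \<delta> \<Longrightarrow> \<bar>f y - f x\<bar> < \<epsilon>"
proof -
  have "openin (subtopology (Euclidean_space n) U) {y \<in> topspace (subtopology (Euclidean_space n) U). f y \<in> ball (f x) \<epsilon>}"
    by (rule openin_continuous_map_preimage [OF assms(2)]) auto
  then have "openin (Euclidean_space n) {y \<in> topspace (subtopology (Euclidean_space n) U). f y \<in> ball (f x) \<epsilon>}"
    using assms(1) openin_trans_full by blast
  moreover have "x \<in> {y \<in> topspace (subtopology (Euclidean_space n) U). f y \<in> ball (f x) \<epsilon>}"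
    using assms openin_subset by fastforce
  ultimately obtain \<delta> where d: "\<delta> > 0" "ebox n x \<delta> \<subseteq> {y \<in> topspace (subtopology (Euclidean_space n) U). f y \<in> ball (f x) \<epsilon>}"
    using openin_contains_ebox by blast
  show ?thesis
    by (rule that [OF d(1)]) (use d(2) in \<open>auto simp: dist_real_def abs_minus_commute\<close>)
qed

lemma eventually_ebox:
  assumes "\<And>i. i < n \<Longrightarrow> ((\<lambda>t. c t i) \<longlongrightarrow> x i) F" "\<forall>\<^sub>F t in F. c t \<in> topspace (Euclidean_space n)" "e > 0"
  shows "\<forall>\<^sub>F t in F. c t \<in> ebox n x e"
proof -
  have "\<forall>\<^sub>F t in F. \<forall>i\<in>{..<n}. dist (c t i) (x i) < e"
    by (rule eventually_ball_finite) (use tendstoD [OF assms(1) assms(3)] in auto)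
  then show ?thesis using assms(2) by eventually_elim (auto simp: ebox_def dist_real_def)
qed

text \<open>Continuity of \<open>A\<close> is asked for at \<open>x\<close> alone. The coefficients
  to which this is applied come from a choice of intermediate points and need not be continuous
  anywhere else.\<close>

lemma tendsto_ebox:
  assumes "\<And>i. i < n \<Longrightarrow> ((\<lambda>t. c t i) \<longlongrightarrow> x i) F" "\<forall>\<^sub>F t in F. c t \<in> topspace (Euclidean_space n)"
    and "\<And>\<epsilon>. \<epsilon> > 0 \<Longrightarrow> \<exists>\<delta>>0. \<forall>y\<in>ebox n x \<delta>. \<bar>A y - a\<bar> < (\<epsilon>::real)"
  shows "((\<lambda>t. A (c t)) \<longlongrightarrow> a) F"
proof (rule tendstoI)
  fix \<epsilon> :: real assume "\<epsilon> > 0"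
  then obtain \<delta> where d: "\<delta> > 0" "\<forall>y\<in>ebox n x \<delta>. \<bar>A y - a\<bar> < \<epsilon>" using assms(3) by blast
  have "\<forall>\<^sub>F t in F. c t \<in> ebox n x \<delta>" by (rule eventually_ebox [OF assms(1,2) d(1)])
  then show "\<forall>\<^sub>F t in F. dist (A (c t)) a < \<epsilon>"
    by eventually_elim (use d(2) in \<open>auto simp: dist_real_def\<close>)
qed

text \<open>A coordinate may move in either direction or stay fixed, so the end points are unordered
  and the quotient is cleared.\<close>

lemma MVT_segment:
  fixes \<phi> :: "real \<Rightarrow> real"
  assumes "\<And>t. t \<in> closed_segment a b \<Longrightarrow> (\<phi> has_real_derivative \<phi>' t) (at t)"
  shows "\<exists>z\<in>closed_segment a b. \<phi> b - \<phi> a = \<phi>' z * (b - a)"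
proof -
  consider "a = b" | "a < b" | "b < a" by linarith
  then show ?thesis
  proof cases
    case 1 then show ?thesis by auto
  next
    case 2
    then obtain z where "a < z" "z < b" "\<phi> b - \<phi> a = (b - a) * \<phi>' z"
      using MVT2 [OF 2, of \<phi> \<phi>'] assms by (auto simp: closed_segment_eq_real_ivl)
    then show ?thesis by (auto simp: closed_segment_eq_real_ivl mult.commute intro!: bexI [of _ z])
  next
    case 3
    then obtain z where "b < z" "z < a" "\<phi> a - \<phi> b = (a - b) * \<phi>' z"
      using MVT2 [OF 3, of \<phi> \<phi>'] assms by (auto simp: closed_segment_eq_real_ivl)
    then show ?thesis by (auto simp: closed_segment_eq_real_ivl algebra_simps intro!: bexI [of _ z])
  qed
qed

text \<open>One stair of the path from \<open>x0\<close> to \<open>x\<close>: the coordinates below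
  \<open>j\<close> have already been moved. The intermediate point lies in every box around
  \<open>x0\<close> that contains \<open>x\<close>, which is what later forces the coefficients to
  converge at \<open>x0\<close>.\<close>

lemma hadamard_coordinate:
  assumes U: "openin (Euclidean_space n) U" and f: "Ck_on n (Suc 0) U f" and x0: "x0 \<in> U"
    and e: "ebox n x0 e \<subseteq> U" and x: "x \<in> ebox n x0 e" and j: "j < n"
  shows "\<exists>\<xi>. (\<forall>\<delta>. x \<in> ebox n x0 \<delta> \<longrightarrow> \<xi> \<in> ebox n x0 \<delta>) \<and>
     f (\<lambda>i. if i < Suc j then x i else x0 i) - f (\<lambda>i. if i < j then x i else x0 i) = pd j f \<xi> * (x j - x0 j)"
proof -
  define m where "m = (\<lambda>i. if i < j then x i else x0 i)"
  have top: "x0 \<in> topspace (Euclidean_space n)" "x \<in> topspace (Euclidean_space n)"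
    using openin_subset [OF U] x0 subsetD [OF ebox_sub x] by auto
  have in_box: "m(j := t) \<in> ebox n x0 \<delta>" if t: "t \<in> closed_segment (x0 j) (x j)" and d: "x \<in> ebox n x0 \<delta>" for t \<delta>
  proof -
    have "\<bar>t - x0 j\<bar> \<le> \<bar>x j - x0 j\<bar>"
      using t by (auto simp: closed_segment_eq_real_ivl split: if_splits)
    also have "\<dots> < \<delta>" using d j by (auto simp: ebox_def)
    finally have "\<bar>t - x0 j\<bar> < \<delta>" .
    moreover have "0 < \<delta>" using calculation by linarith
    ultimately show ?thesis using top d j by (auto simp: m_def ebox_def topspace_Euclidean_space)
  qed
  have "((\<lambda>s. f (m(j := s))) has_real_derivative pd j f (m(j := t))) (at t)"
    if "t \<in> closed_segment (x0 j) (x j)" for t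
  proof -
    have "m(j := t) \<in> U" using in_box [OF that x] e by blast
    then have "((\<lambda>s. f ((m(j := t))(j := s))) has_real_derivative pd j f (m(j := t))) (at ((m(j := t)) j))"
      using f [unfolded Ck_on_Suc_pd [OF U]] j by blast
    then show ?thesis by simp
  qed
  from MVT_segment [of "x0 j" "x j" "\<lambda>s. f (m(j := s))", OF this]
  obtain z where z: "z \<in> closed_segment (x0 j) (x j)"
    "f (m(j := x j)) - f (m(j := x0 j)) = pd j f (m(j := z)) * (x j - x0 j)" by blast
  have "m(j := x j) = (\<lambda>i. if i < Suc j then x i else x0 i)" "m(j := x0 j) = (\<lambda>i. if i < j then x i else x0 i)"
    by (auto simp: m_def fun_eq_iff less_Suc_eq)
  then show ?thesis using z in_box by (intro exI [of _ "m(j := z)"]) auto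
qed

text \<open>Changing one coordinate at a time turns the mean value theorem into a factorisation whose coefficients
  are continuous at \<open>x0\<close>. The chain rule and the derivative of an inverse both follow from it, by letting
  the coefficients tend to the partial derivatives.\<close>

lemma hadamard:
  assumes U: "openin (Euclidean_space n) U" and f: "Ck_on n (Suc 0) U f" and x0: "x0 \<in> U"
  obtains e A where "e > 0" "ebox n x0 e \<subseteq> U"
    "\<And>x. x \<in> ebox n x0 e \<Longrightarrow> f x - f x0 = (\<Sum>j<n. A j x * (x j - x0 j))"
    "\<And>j \<epsilon>. j < n \<Longrightarrow> \<epsilon> > 0 \<Longrightarrow> \<exists>\<delta>>0. \<forall>x\<in>ebox n x0 \<delta>. \<bar>A j x - pd j f x0\<bar> < \<epsilon>"
proof -
  obtain e where e: "e > 0" "ebox n x0 e \<subseteq> U" using openin_contains_ebox U x0 by blast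
  define Q where "Q = (\<lambda>x j \<xi>. x \<in> ebox n x0 e \<and> j < n \<longrightarrow> (\<forall>\<delta>. x \<in> ebox n x0 \<delta> \<longrightarrow> \<xi> \<in> ebox n x0 \<delta>) \<and>
     f (\<lambda>i. if i < Suc j then x i else x0 i) - f (\<lambda>i. if i < j then x i else x0 i) = pd j f \<xi> * (x j - x0 j))"
  have "\<exists>\<xi>. Q x j \<xi>" for x j
    using hadamard_coordinate [OF U f x0 e(2), of x j] unfolding Q_def by blast
  then obtain \<xi> where "\<And>x j. Q x j (\<xi> x j)" by metis
  then have xi: "\<And>x j \<delta>. x \<in> ebox n x0 e \<Longrightarrow> j < n \<Longrightarrow> x \<in> ebox n x0 \<delta> \<Longrightarrow> \<xi> x j \<in> ebox n x0 \<delta>"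
    "\<And>x j. x \<in> ebox n x0 e \<Longrightarrow> j < n \<Longrightarrow>
       f (\<lambda>i. if i < Suc j then x i else x0 i) - f (\<lambda>i. if i < j then x i else x0 i) = pd j f (\<xi> x j) * (x j - x0 j)"
    unfolding Q_def by blast+
  show thesis
  proof (rule that [OF e, of "\<lambda>j x. pd j f (\<xi> x j)"])
    fix x assume x: "x \<in> ebox n x0 e"
    let ?m = "\<lambda>j i. if i < j then x i else x0 i"
    have "(\<Sum>j<n. pd j f (\<xi> x j) * (x j - x0 j)) = (\<Sum>j<n. f (?m (Suc j)) - f (?m j))"
      by (rule sum.cong) (use xi(2) [OF x] in auto)
    also have "\<dots> = f (?m n) - f (?m 0)" by (rule sum_lessThan_telescope)
    \<comment> \<open>The last corner is \<open>x\<close> itself because both points vanish from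
      index \<open>n\<close> on.\<close>
    also have "?m n = x"
      using x subsetD [OF openin_subset [OF U] x0] by (auto simp: ebox_def topspace_Euclidean_space fun_eq_iff)
    finally show "f x - f x0 = (\<Sum>j<n. pd j f (\<xi> x j) * (x j - x0 j))" by simp
  next
    fix j and \<epsilon> :: real assume j: "j < n" and "\<epsilon> > 0"
    have "continuous_map (subtopology (Euclidean_space n) U) euclideanreal (pd j f)"
      using f [unfolded Ck_on_Suc_pd [OF U]] j Ck_on_C0 by blast
    then obtain \<delta> where d: "\<delta> > 0" "\<And>y. y \<in> ebox n x0 \<delta> \<Longrightarrow> \<bar>pd j f y - pd j f x0\<bar> < \<epsilon>"
      using C0_ebox [OF U _ x0 \<open>\<epsilon> > 0\<close>] by blast
    have "\<forall>x\<in>ebox n x0 (min \<delta> e). \<bar>pd j f (\<xi> x j) - pd j f x0\<bar> < \<epsilon>"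
      using d(2) xi(1) [OF _ j] ebox_mono [of "min \<delta> e" \<delta>] ebox_mono [of "min \<delta> e" e] by (metis min.cobounded1 min.cobounded2 subsetD)
    then show "\<exists>\<delta>>0. \<forall>x\<in>ebox n x0 \<delta>. \<bar>pd j f (\<xi> x j) - pd j f x0\<bar> < \<epsilon>"
      using d(1) e(1) by (intro exI [of _ "min \<delta> e"]) auto
  qed
qed

text \<open>The curve needs a derivative at \<open>t0\<close> only: in
  \<open>aut_family_kernel\<close> the rule is applied to a curve whose derivative is known at a
  single point.\<close>

lemma has_derivative_chain:
  assumes U: "openin (Euclidean_space n) U" and f: "Ck_on n (Suc 0) U f" and c0: "c t0 \<in> U"
    and c: "\<And>j. j < n \<Longrightarrow> ((\<lambda>t. c t j) has_real_derivative c' j) (at t0)"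
    and top: "\<forall>\<^sub>F t in at t0. c t \<in> topspace (Euclidean_space n)"
  shows "((\<lambda>t. f (c t)) has_real_derivative (\<Sum>j<n. pd j f (c t0) * c' j)) (at t0)"
proof -
  obtain e A where A: "e > 0" "ebox n (c t0) e \<subseteq> U"
    "\<And>x. x \<in> ebox n (c t0) e \<Longrightarrow> f x - f (c t0) = (\<Sum>j<n. A j x * (x j - c t0 j))"
    "\<And>j \<epsilon>. j < n \<Longrightarrow> \<epsilon> > 0 \<Longrightarrow> \<exists>\<delta>>0. \<forall>x\<in>ebox n (c t0) \<delta>. \<bar>A j x - pd j f (c t0)\<bar> < \<epsilon>"
    by (rule hadamard [OF U f c0]) (rule that)
  have lim: "((\<lambda>t. c t i) \<longlongrightarrow> c t0 i) (at t0)" if "i < n" for i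
    using DERIV_isCont [OF c [OF that]] by (simp add: isCont_def)
  have "((\<lambda>t. \<Sum>j<n. A j (c t) * ((c t j - c t0 j) / (t - t0))) \<longlongrightarrow> (\<Sum>j<n. pd j f (c t0) * c' j)) (at t0)"
  proof (intro tendsto_sum tendsto_mult)
    fix j assume "j \<in> {..<n}"
    then have j: "j < n" by simp
    show "((\<lambda>t. A j (c t)) \<longlongrightarrow> pd j f (c t0)) (at t0)"
      by (rule tendsto_ebox [OF lim top A(4) [OF j]])
    show "((\<lambda>t. (c t j - c t0 j) / (t - t0)) \<longlongrightarrow> c' j) (at t0)"
      using c [OF j] by (simp add: has_field_derivative_iff)
  qed
  moreover have "\<forall>\<^sub>F t in at t0. (\<Sum>j<n. A j (c t) * ((c t j - c t0 j) / (t - t0))) = (f (c t) - f (c t0)) / (t - t0)"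
  proof -
    have "\<forall>\<^sub>F t in at t0. c t \<in> ebox n (c t0) e" by (rule eventually_ebox [OF lim top A(1)])
    then show ?thesis by eventually_elim (simp add: A(3) sum_divide_distrib)
  qed
  ultimately show ?thesis unfolding has_field_derivative_iff by (rule Lim_transform_eventually)
qed

lemma continuous_map_into_Euclidean_Ck:
  assumes "openin (Euclidean_space m) U" "openin (Euclidean_space n) V" "h \<in> U \<rightarrow> V"
    "\<And>j. j < n \<Longrightarrow> Ck_on m k U (\<lambda>x. h x j)"
  shows "continuous_map (subtopology (Euclidean_space m) U) (subtopology (Euclidean_space n) V) h"
  unfolding continuous_map_into_Euclidean
  using assms(3) Ck_on_C0 [OF assms(4)] openin_subset [OF assms(2)] by auto

text \<open>The chain rule expresses a partial derivative of the composite by products of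
  \<open>pd j f\<close> after \<open>h\<close> with partial derivatives of \<open>h\<close>. The
  first kind is again a composite, of one class lower, whence the induction over all
  \<open>f\<close>.\<close>

lemma Ck_on_compose:
  assumes U: "openin (Euclidean_space m) U" and V: "openin (Euclidean_space n) V" and h: "h \<in> U \<rightarrow> V"
    and "\<And>j. j < n \<Longrightarrow> Ck_on m k U (\<lambda>x. h x j)" "Ck_on n k V f"
  shows "Ck_on m k U (\<lambda>x. f (h x))"
  using assms(4,5)
proof (induction k arbitrary: f)
  case 0
  have "continuous_map (subtopology (Euclidean_space m) U) euclideanreal (f \<circ> h)"
    by (rule continuous_map_compose [OF continuous_map_into_Euclidean_Ck [OF U V h 0(1)]]) (use 0 in auto)
  then show ?case by (simp add: o_def)
next
  case (Suc k)
  have h1: "Ck_on m (Suc 0) U (\<lambda>x. h x j)" if "j < n" for j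
    using Ck_on_le Suc.prems(1) [OF that] by (metis Suc_le_mono le0)
  have f1: "Ck_on n (Suc 0) V f" using Ck_on_le Suc.prems(2) by (metis Suc_le_mono le0)
  show ?case
  proof (rule Ck_on_SucI [where g = "\<lambda>i x. \<Sum>j<n. pd j f (h x) * pd i (\<lambda>x. h x j) x"])
    have "continuous_map (subtopology (Euclidean_space m) U) euclideanreal (f \<circ> h)"
      by (rule continuous_map_compose [OF continuous_map_into_Euclidean_Ck [OF U V h Suc.prems(1)] Ck_on_C0 [OF Suc.prems(2)]])
    then show "continuous_map (subtopology (Euclidean_space m) U) euclideanreal (\<lambda>x. f (h x))" by (simp add: o_def)
    fix i assume i: "i < m"
    show "((\<lambda>t. f (h (x(i := t)))) has_real_derivative (\<Sum>j<n. pd j f (h x) * pd i (\<lambda>x. h x j) x)) (at (x i))"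
      if x: "x \<in> U" for x
    proof -
      have "\<forall>\<^sub>F t in nhds (x i). x(i := t) \<in> U" by (rule openin_coord_line [OF U x i])
      then have "\<forall>\<^sub>F t in nhds (x i). h (x(i := t)) \<in> topspace (Euclidean_space n)"
        by eventually_elim (use h openin_subset [OF V] in blast)
      then have "\<forall>\<^sub>F t in at (x i). h (x(i := t)) \<in> topspace (Euclidean_space n)"
        by (simp add: eventually_at_filter eventually_mono)
      then have "((\<lambda>t. f (h (x(i := t)))) has_real_derivative (\<Sum>j<n. pd j f (h (x(i := x i))) * pd i (\<lambda>x. h x j) x)) (at (x i))"
      proof (rule has_derivative_chain [OF V f1, where c = "\<lambda>t. h (x(i := t))", rotated 2])
        show "((\<lambda>t. h (x(i := t)) j) has_real_derivative pd i (\<lambda>x. h x j) x) (at (x i))" if "j < n" for j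
          using h1 [OF that] x i unfolding Ck_on_Suc_pd [OF U] by blast
      qed (use h x in auto)
      then show ?thesis by simp
    qed
    show "Ck_on m k U (\<lambda>x. \<Sum>j<n. pd j f (h x) * pd i (\<lambda>x. h x j) x)"
    proof (intro Ck_on_sum Ck_on_mult)
      fix j assume "j \<in> {..<n}"
      then have j: "j < n" by simp
      show "Ck_on m k U (\<lambda>x. pd j f (h x))"
        by (rule Suc.IH) (use Suc.prems(1) Ck_on_SucD Suc.prems(2) [unfolded Ck_on_Suc_pd [OF V]] j in blast)+
      show "Ck_on m k U (pd i (\<lambda>x. h x j))"
        using Suc.prems(1) [OF j] i unfolding Ck_on_Suc_pd [OF U] by blast
    qed
  qed
qed

section \<open>Determinants and adjugates of matrices depending on a point\<close>

definition mdet :: "nat \<Rightarrow> (nat \<Rightarrow> nat \<Rightarrow> real) \<Rightarrow> real" where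
  "mdet n a = Determinant.det (Matrix.mat n n (\<lambda>(i, j). a i j))"

definition madj :: "nat \<Rightarrow> (nat \<Rightarrow> nat \<Rightarrow> real) \<Rightarrow> nat \<Rightarrow> nat \<Rightarrow> real" where
  "madj n a i j = Matrix.index_mat (adj_mat (Matrix.mat n n (\<lambda>(i, j). a i j))) (i, j)"

text \<open>Leibniz' formula exhibits the determinant as a polynomial in the entries; its continuity
  and its class C^k in a parameter are read off from there.\<close>

lemma mdet_eq: "mdet n a = (\<Sum>p\<in>{p. p permutes {0..<n}}. of_int (sign p) * (\<Prod>i=0..<n. a i (p i)))"
proof -
  have "(\<Prod>i=0..<n. Matrix.index_mat (Matrix.mat n n (\<lambda>(i, j). a i j)) (i, p i)) = (\<Prod>i=0..<n. a i (p i))"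
    if "p permutes {0..<n}" for p
  proof (rule prod.cong)
    fix i assume "i \<in> {0..<n}"
    moreover from this have "p i \<in> {0..<n}" using that permutes_in_image by metis
    ultimately show "Matrix.index_mat (Matrix.mat n n (\<lambda>(i, j). a i j)) (i, p i) = a i (p i)" by simp
  qed simp
  then show ?thesis unfolding mdet_def Determinant.det_def by simp
qed

text \<open>The conditional indices skip row \<open>j\<close> and column \<open>i\<close>,
  transposed as the adjugate demands. Each entry becomes a smaller determinant, so that the facts on
  \<open>mdet\<close> transfer.\<close>

lemma madj_eq:
  assumes "i < n" "j < n"
  shows "madj n a i j = (-1) ^ (j + i) * mdet (n - 1) (\<lambda>k l. a (if k < j then k else Suc k) (if l < i then l else Suc l))"
proof -
  have "mat_delete (Matrix.mat n n (\<lambda>(i, j). a i j)) j i =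
    Matrix.mat (n - 1) (n - 1) (\<lambda>(k, l). a (if k < j then k else Suc k) (if l < i then l else Suc l))"
    by (rule eq_matI) (use assms in \<open>auto simp: mat_delete_def\<close>)
  then show ?thesis using assms by (simp add: madj_def adj_mat_def cofactor_def mdet_def)
qed

lemma madj_mult:
  assumes "i < n" "j < n"
  shows "(\<Sum>k<n. madj n a i k * a k j) = (if i = j then mdet n a else 0)"
proof -
  let ?A = "Matrix.mat n n (\<lambda>(i, j). a i j)"
  have A: "?A \<in> carrier_mat n n" by simp
  have "Matrix.index_mat (adj_mat ?A * ?A) (i, j) = Matrix.index_mat (Determinant.det ?A \<cdot>\<^sub>m 1\<^sub>m n) (i, j)"
    using adj_mat(3) [OF A] by simp
  moreover have "Matrix.index_mat (adj_mat ?A * ?A) (i, j) = (\<Sum>k<n. madj n a i k * a k j)"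
    using assms adj_mat(1) [OF A]
    by (auto simp: madj_def scalar_prod_def lessThan_atLeast0 intro!: sum.cong)
  ultimately show ?thesis using assms by (simp add: mdet_def)
qed

lemma mdet_nonzero:
  assumes "\<And>v. (\<And>i. i < n \<Longrightarrow> (\<Sum>j<n. a i j * v j) = 0) \<Longrightarrow> (\<forall>j<n. v j = 0)"
  shows "mdet n a \<noteq> 0"
proof
  let ?A = "Matrix.mat n n (\<lambda>(i, j). a i j)"
  assume "mdet n a = 0"
  then have "\<exists>v. v \<in> carrier_vec n \<and> v \<noteq> 0\<^sub>v n \<and> ?A *\<^sub>v v = 0\<^sub>v n"
    using det_0_iff_vec_prod_zero_field [of ?A n] by (simp add: mdet_def)
  then obtain v where v: "v \<in> carrier_vec n" "v \<noteq> 0\<^sub>v n" "?A *\<^sub>v v = 0\<^sub>v n" by blast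
  have "(\<Sum>j<n. a i j * Matrix.vec_index v j) = 0" if i: "i < n" for i
  proof -
    have "Matrix.vec_index (?A *\<^sub>v v) i = (\<Sum>j<n. a i j * Matrix.vec_index v j)"
      using i v(1) by (auto simp: scalar_prod_def lessThan_atLeast0 intro!: sum.cong)
    then show ?thesis using v(3) i by simp
  qed
  then have "\<forall>j<n. Matrix.vec_index v j = 0" by (rule assms)
  then have "v = 0\<^sub>v n" using v(1) by (intro eq_vecI) auto
  then show False using v(2) by blast
qed

lemma Ck_on_mdet:
  assumes "\<And>i j. i < n \<Longrightarrow> j < n \<Longrightarrow> Ck_on m k U (\<lambda>x. a x i j)"
  shows "Ck_on m k U (\<lambda>x. mdet n (a x))"
proof -
  have "p i < n" if "p permutes {0..<n}" "i < n" for p i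
    using permutes_in_image [OF that(1), of i] that(2) by simp
  then show ?thesis
    unfolding mdet_eq using assms by (intro Ck_on_sum Ck_on_mult Ck_on_const Ck_on_prod) auto
qed

lemma Ck_on_madj:
  assumes "\<And>i j. i < n \<Longrightarrow> j < n \<Longrightarrow> Ck_on m k U (\<lambda>x. a x i j)" "i < n" "j < n"
  shows "Ck_on m k U (\<lambda>x. madj n (a x) i j)"
  unfolding madj_eq [OF assms(2,3)]
  by (intro Ck_on_mult Ck_on_const Ck_on_mdet assms(1)) auto

lemma tendsto_mdet:
  assumes "\<And>i j. i < n \<Longrightarrow> j < n \<Longrightarrow> ((\<lambda>x. a x i j) \<longlongrightarrow> b i j) F"
  shows "((\<lambda>x. mdet n (a x)) \<longlongrightarrow> mdet n b) F"
proof -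
  have "p i < n" if "p permutes {0..<n}" "i < n" for p i
    using permutes_in_image [OF that(1), of i] that(2) by simp
  then show ?thesis
    unfolding mdet_eq using assms by (intro tendsto_sum tendsto_mult tendsto_const tendsto_prod) auto
qed

lemma tendsto_madj:
  assumes "\<And>i j. i < n \<Longrightarrow> j < n \<Longrightarrow> ((\<lambda>x. a x i j) \<longlongrightarrow> b i j) F" "i < n" "j < n"
  shows "((\<lambda>x. madj n (a x) i j) \<longlongrightarrow> madj n b i j) F"
  unfolding madj_eq [OF assms(2,3)]
  by (intro tendsto_mult tendsto_const tendsto_mdet assms(1)) auto

text \<open>With the coefficient matrix \<open>B\<close> of \<open>hadamard\<close>, \<open>B t (c t - u0) = (t - y0 i) e\<^sub>i\<close> is solved by Cramer's rule,
  so that the limit of the difference quotient only needs the continuity of determinant and adjugate.\<close>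

lemma has_derivative_inverse:
  assumes O: "openin (Euclidean_space m) S" and O': "openin (Euclidean_space m) (h ` S)"
    and inj: "inj_on h S" and h: "\<And>r. r < m \<Longrightarrow> Ck_on m (Suc 0) S (\<lambda>x. h x r)"
    and cont: "continuous_map (subtopology (Euclidean_space m) (h ` S)) (subtopology (Euclidean_space m) S) (inv_into S h)"
    and det: "mdet m (\<lambda>r j. pd j (\<lambda>x. h x r) (inv_into S h y0)) \<noteq> 0"
    and y0: "y0 \<in> h ` S" and i: "i < m" and j: "j < m"
  shows "((\<lambda>t. inv_into S h (y0(i := t)) j) has_real_derivative
     inverse (mdet m (\<lambda>r j. pd j (\<lambda>x. h x r) (inv_into S h y0))) *
       madj m (\<lambda>r j. pd j (\<lambda>x. h x r) (inv_into S h y0)) j i) (at (y0 i))"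
proof -
  define g where "g = inv_into S h"
  define u0 where "u0 = g y0"
  define J where "J = (\<lambda>r j. pd j (\<lambda>x. h x r) u0)"
  define c where "c = (\<lambda>t. g (y0(i := t)))"
  have gS: "g y \<in> S" "h (g y) = y" if "y \<in> h ` S" for y
    using that by (auto simp: g_def inv_into_into f_inv_into_f)
  have u0: "u0 \<in> S" "h u0 = y0" using gS y0 by (auto simp: u0_def)
  define Q where "Q = (\<lambda>r e A. r < m \<longrightarrow> e > 0 \<and>
      (\<forall>x \<in> ebox m u0 e. h x r - h u0 r = (\<Sum>j<m. A j x * (x j - u0 j))) \<and>
      (\<forall>j \<epsilon>. j < m \<longrightarrow> \<epsilon> > 0 \<longrightarrow> (\<exists>\<delta>>0. \<forall>x\<in>ebox m u0 \<delta>. \<bar>A j x - J r j\<bar> < \<epsilon>)))"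
  have "\<exists>e A. Q r e A" for r
  proof (cases "r < m")
    case True
    show ?thesis
    proof (rule hadamard [OF O h [OF True] u0(1)])
      fix e A
      assume "e > 0" "\<And>x. x \<in> ebox m u0 e \<Longrightarrow> h x r - h u0 r = (\<Sum>j<m. A j x * (x j - u0 j))"
        "\<And>j \<epsilon>. j < m \<Longrightarrow> \<epsilon> > 0 \<Longrightarrow> \<exists>\<delta>>0. \<forall>x\<in>ebox m u0 \<delta>. \<bar>A j x - pd j (\<lambda>x. h x r) u0\<bar> < \<epsilon>"
      then have "Q r e A" unfolding Q_def J_def by blast
      then show ?thesis by blast
    qed
  qed (simp add: Q_def)
  then obtain e A where "\<And>r. Q r (e r) (A r)" by metis
  then have e: "\<And>r. r < m \<Longrightarrow> e r > 0"
    and A: "\<And>r x. r < m \<Longrightarrow> x \<in> ebox m u0 (e r) \<Longrightarrow> h x r - h u0 r = (\<Sum>j<m. A r j x * (x j - u0 j))"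
    and Alim: "\<And>r j \<epsilon>. r < m \<Longrightarrow> j < m \<Longrightarrow> \<epsilon> > 0 \<Longrightarrow> \<exists>\<delta>>0. \<forall>x\<in>ebox m u0 \<delta>. \<bar>A r j x - J r j\<bar> < \<epsilon>"
    unfolding Q_def by blast+
  have ev0: "\<forall>\<^sub>F t in nhds (y0 i). y0(i := t) \<in> h ` S" by (rule openin_coord_line [OF O' y0 i])
  then have ev: "\<forall>\<^sub>F t in at (y0 i). y0(i := t) \<in> h ` S" by (simp add: eventually_at_filter eventually_mono)
  then have top: "\<forall>\<^sub>F t in at (y0 i). c t \<in> topspace (Euclidean_space m)"
    by eventually_elim (use gS(1) openin_subset [OF O] in \<open>auto simp: c_def\<close>)
  \<comment> \<open>Only the continuity of the inverse is available here; it suffices, since the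
    coefficients are controlled in terms of how close \<open>c t\<close> is to
    \<open>u0\<close>.\<close>
  have lim: "((\<lambda>t. c t l) \<longlongrightarrow> u0 l) (at (y0 i))" if l: "l < m" for l
  proof (rule tendstoI)
    fix \<epsilon> :: real assume eps: "\<epsilon> > 0"
    have "continuous_map (subtopology (Euclidean_space m) (h ` S)) euclideanreal (\<lambda>y. g y l)"
      using cont l unfolding continuous_map_into_Euclidean g_def by blast
    then obtain \<delta> where d: "\<delta> > 0" "\<And>y. y \<in> ebox m y0 \<delta> \<Longrightarrow> \<bar>g y l - g y0 l\<bar> < \<epsilon>"
      using C0_ebox [OF O' _ y0 eps] by blast
    have y0t: "y0 \<in> topspace (Euclidean_space m)" using y0 openin_subset [OF O'] by blast
    have "\<forall>\<^sub>F t in nhds (y0 i). y0(i := t) \<in> ebox m y0 \<delta>"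
      by (rule openin_coord_line [OF openin_ebox ebox_self [OF y0t d(1)] i])
    then have "\<forall>\<^sub>F t in at (y0 i). y0(i := t) \<in> ebox m y0 \<delta>" by (simp add: eventually_at_filter eventually_mono)
    then show "\<forall>\<^sub>F t in at (y0 i). dist (c t l) (u0 l) < \<epsilon>"
      by eventually_elim (use d(2) in \<open>auto simp: c_def u0_def dist_real_def\<close>)
  qed
  define B where "B = (\<lambda>t r l. A r l (c t))"
  have Blim: "((\<lambda>t. B t r l) \<longlongrightarrow> J r l) (at (y0 i))" if "r < m" "l < m" for r l
    unfolding B_def by (rule tendsto_ebox [OF lim top Alim [OF that]])
  have det0: "mdet m J \<noteq> 0" using det by (simp add: J_def u0_def g_def)
  have "((\<lambda>t. inverse (mdet m (B t)) * madj m (B t) j i) \<longlongrightarrow> inverse (mdet m J) * madj m J j i) (at (y0 i))"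
    by (intro tendsto_mult tendsto_inverse tendsto_mdet tendsto_madj Blim i j det0)
  moreover have "\<forall>\<^sub>F t in at (y0 i). inverse (mdet m (B t)) * madj m (B t) j i = (g (y0(i := t)) j - g y0 j) / (t - y0 i)"
  proof -
    have "\<forall>\<^sub>F t in at (y0 i). \<forall>r\<in>{..<m}. c t \<in> ebox m u0 (e r)"
    proof (rule eventually_ball_finite, safe)
      fix r assume "r < m"
      show "\<forall>\<^sub>F t in at (y0 i). c t \<in> ebox m u0 (e r)"
        by (rule eventually_ebox [OF lim top e [OF \<open>r < m\<close>]])
    qed
    moreover have "\<forall>\<^sub>F t in at (y0 i). mdet m (B t) \<noteq> 0"
      by (rule tendsto_imp_eventually_ne [OF tendsto_mdet [OF Blim] det0])
    moreover have "\<forall>\<^sub>F t in at (y0 i). t \<noteq> y0 i" by (simp add: eventually_at_filter)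
    ultimately show ?thesis using ev
    proof eventually_elim
      case (elim t)
      have 1: "(\<Sum>l<m. B t r l * (c t l - u0 l)) = (if r = i then t - y0 i else 0)" if "r < m" for r
      proof -
        have "(\<Sum>l<m. B t r l * (c t l - u0 l)) = h (c t) r - h u0 r"
          using A [OF that, of "c t"] elim(1) that by (auto simp: B_def)
        then show ?thesis using gS(2) [OF elim(4)] u0(2) by (simp add: c_def)
      qed
      have "mdet m (B t) * (c t j - u0 j) = (\<Sum>l<m. (if j = l then mdet m (B t) else 0) * (c t l - u0 l))"
        using j by (simp add: if_distrib [of "\<lambda>z. z * _"] cong: if_cong)
      also have "\<dots> = (\<Sum>l<m. (\<Sum>r<m. madj m (B t) j r * B t r l) * (c t l - u0 l))"
        by (rule sum.cong) (simp_all add: madj_mult [OF j])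
      also have "\<dots> = (\<Sum>r<m. madj m (B t) j r * (\<Sum>l<m. B t r l * (c t l - u0 l)))"
        unfolding sum_distrib_left sum_distrib_right by (subst sum.swap) (simp add: mult.assoc)
      also have "\<dots> = (\<Sum>r<m. madj m (B t) j r * (if r = i then t - y0 i else 0))"
        by (rule sum.cong) (simp_all add: 1)
      also have "\<dots> = madj m (B t) j i * (t - y0 i)"
        using i by (simp add: if_distrib [of "\<lambda>z. _ * z"] cong: if_cong)
      finally show ?case using elim(2,3) by (simp add: c_def u0_def field_simps)
    qed
  qed
  ultimately have "((\<lambda>t. g (y0(i := t)) j) has_real_derivative inverse (mdet m J) * madj m J j i) (at (y0 i))"
    unfolding has_field_derivative_iff by (simp add: Lim_transform_eventually)
  then show ?thesis by (simp add: g_def J_def u0_def)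
qed

text \<open>With injectivity given on all of \<open>S\<close>, invariance of domain takes over the
  existence part of an inverse function theorem: \<open>h\<close> is an open embedding. The inverse
  Jacobian is a rational expression in the partial derivatives of \<open>h\<close>, evaluated at the
  inverse, so each class C^k of the inverse yields the next one.\<close>

theorem smooth_inverse:
  assumes O: "openin (Euclidean_space m) S" and h: "h \<in> S \<rightarrow> topspace (Euclidean_space m)"
    and inj: "inj_on h S" and sm: "\<And>k r. r < m \<Longrightarrow> Ck_on m k S (\<lambda>x. h x r)"
    and ker: "\<And>u v. u \<in> S \<Longrightarrow> (\<And>r. r < m \<Longrightarrow> (\<Sum>j<m. pd j (\<lambda>x. h x r) u * v j) = 0) \<Longrightarrow> \<forall>j<m. v j = 0"
  shows "openin (Euclidean_space m) (h ` S)"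
    and "j < m \<Longrightarrow> Ck_on m k (h ` S) (\<lambda>y. inv_into S h y j)"
proof -
  have "continuous_map (subtopology (Euclidean_space m) S) (subtopology (Euclidean_space m) UNIV) h"
    unfolding continuous_map_into_Euclidean using h Ck_on_C0 [OF sm] by auto
  then have hc: "continuous_map (subtopology (Euclidean_space m) S) (Euclidean_space m) h" by simp
  show O': "openin (Euclidean_space m) (h ` S)"
    by (rule invariance_of_domain_Euclidean_space [OF O hc inj])
  have SS: "topspace (Euclidean_space m) \<inter> S = S" using openin_subset [OF O] by blast
  have "homeomorphic_map (subtopology (Euclidean_space m) S) (subtopology (Euclidean_space m) (h ` S)) h"
    using invariance_of_domain_Euclidean_space_embedding_map [OF O hc inj] by (simp add: embedding_map_def SS)
  then obtain g where g: "homeomorphic_maps (subtopology (Euclidean_space m) S) (subtopology (Euclidean_space m) (h ` S)) h g"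
    using homeomorphic_map_maps by blast
  have cont: "continuous_map (subtopology (Euclidean_space m) (h ` S)) (subtopology (Euclidean_space m) S) (inv_into S h)"
  proof (rule continuous_map_eq)
    show "continuous_map (subtopology (Euclidean_space m) (h ` S)) (subtopology (Euclidean_space m) S) g"
      using g by (simp add: homeomorphic_maps_def)
    show "g y = inv_into S h y" if "y \<in> topspace (subtopology (Euclidean_space m) (h ` S))" for y
      using that g inj SS by (auto simp: homeomorphic_maps_def inv_into_f_f)
  qed
  have invS: "inv_into S h \<in> h ` S \<rightarrow> S" by (auto simp: inv_into_into)
  define J where "J = (\<lambda>u r j. pd j (\<lambda>x. h x r) u)"
  have det: "mdet m (J u) \<noteq> 0" if "u \<in> S" for u
    by (rule mdet_nonzero) (use ker [OF that] in \<open>auto simp: J_def\<close>)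
  have JC: "Ck_on m k S (\<lambda>u. J u r j)" if "r < m" "j < m" for k r j
    using sm [OF that(1), of "Suc k"] that(2) unfolding Ck_on_Suc_pd [OF O] J_def by simp
  \<comment> \<open>The entries of the inverse Jacobian by Cramer's rule, still as functions on
    \<open>S\<close>.\<close>
  define N where "N = (\<lambda>j i u. inverse (mdet m (J u)) * madj m (J u) j i)"
  have NC: "Ck_on m k S (N j i)" if "i < m" "j < m" for k i j
    unfolding N_def using that by (intro Ck_on_mult Ck_on_inverse Ck_on_mdet Ck_on_madj JC det)
  have "\<forall>j<m. Ck_on m k (h ` S) (\<lambda>y. inv_into S h y j)" for k
  proof (induction k)
    case 0
    then show ?case using cont unfolding continuous_map_into_Euclidean by simp
  next
    case (Suc k)
    show ?case
    proof (intro allI impI)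
      fix j assume j: "j < m"
      show "Ck_on m (Suc k) (h ` S) (\<lambda>y. inv_into S h y j)"
      proof (rule Ck_on_SucI [where g = "\<lambda>i y. N j i (inv_into S h y)"])
        show "continuous_map (subtopology (Euclidean_space m) (h ` S)) euclideanreal (\<lambda>y. inv_into S h y j)"
          using Suc j Ck_on_C0 by blast
        fix i assume i: "i < m"
        show "Ck_on m k (h ` S) (\<lambda>y. N j i (inv_into S h y))"
          \<comment> \<open>The bootstrap: \<open>N j i\<close> is smooth on \<open>S\<close>, and
            the inverse map is of class C^k by the induction hypothesis.\<close>
          by (rule Ck_on_compose [OF O' O invS _ NC [OF i j]]) (use Suc in blast)
        fix y assume y: "y \<in> h ` S"
        have u: "inv_into S h y \<in> S" using y by (rule inv_into_into)
        show "((\<lambda>t. inv_into S h (y(i := t)) j) has_real_derivative N j i (inv_into S h y)) (at (y i))"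
          using has_derivative_inverse [OF O O' inj sm cont _ y i j] det [OF u] by (simp add: N_def J_def)
      qed
    qed
  qed
  then show "j < m \<Longrightarrow> Ck_on m k (h ` S) (\<lambda>y. inv_into S h y j)" by blast
qed

section \<open>Lifting through a totally disconnected subgroup\<close>

lemma pathin_join:
  assumes "pathin X p" "pathin X g" "p 1 = g 0"
  shows "pathin X (\<lambda>t. if t \<le> 1/2 then p (2 * t) else g (2 * t - 1))"
  unfolding pathin_def
proof (rule continuous_map_cases_le)
  show "continuous_map (subtopology (top_of_set {0..1}) {x \<in> topspace (top_of_set {0..1}). x \<le> 1/2}) X (\<lambda>t. p (2 * t))"
  proof -
    have "continuous_map (top_of_set ({0..1} \<inter> {x \<in> {0..1}. x \<le> 1/2})) (top_of_set {0..1}) (\<lambda>t::real. 2 * t)"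
      by (auto intro!: continuous_intros)
    from continuous_map_compose [OF this assms(1) [unfolded pathin_def]] show ?thesis
      by (simp add: o_def subtopology_subtopology)
  qed
  show "continuous_map (subtopology (top_of_set {0..1}) {x \<in> topspace (top_of_set {0..1}). 1/2 \<le> x}) X (\<lambda>t. g (2 * t - 1))"
  proof -
    have "continuous_map (top_of_set ({0..1} \<inter> {x \<in> {0..1}. 1/2 \<le> x})) (top_of_set {0..1}) (\<lambda>t::real. 2 * t - 1)"
      by (auto intro!: continuous_intros)
    from continuous_map_compose [OF this assms(2) [unfolded pathin_def]] show ?thesis
      by (simp add: o_def subtopology_subtopology)
  qed
  show "p (2 * t) = g (2 * t - 1)" if t: "t = 1/2" for t unfolding t by (simp add: assms(3))
qed auto

locale disconnected_fibres = group G for G (structure) +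
  fixes T :: "'a topology" and \<Gamma> :: "'a set"
  assumes top: "topspace T = carrier G"
    and mult_cont: "continuous_map (prod_topology T T) T (\<lambda>(x, y). x \<otimes> y)"
    and inv_cont: "continuous_map T T (\<lambda>x. inv x)"
    and sub: "subgroup \<Gamma> G"
    and td: "totally_disconnected_space (subtopology T \<Gamma>)"
begin

lemma Gamma_carrier: "\<gamma> \<in> \<Gamma> \<Longrightarrow> \<gamma> \<in> carrier G"
  by (rule subgroup.mem_carrier [OF sub])

lemma coset_eq_iff:
  assumes "x \<in> carrier G" "y \<in> carrier G"
  shows "x <# \<Gamma> = y <# \<Gamma> \<longleftrightarrow> inv x \<otimes> y \<in> \<Gamma>"
proof
  assume eq: "x <# \<Gamma> = y <# \<Gamma>"
  have "y \<otimes> \<one> \<in> y <# \<Gamma>" unfolding l_coset_def using subgroup.one_closed [OF sub] by blast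
  then obtain \<gamma> where "\<gamma> \<in> \<Gamma>" "y = x \<otimes> \<gamma>" using eq assms unfolding l_coset_def by auto
  then show "inv x \<otimes> y \<in> \<Gamma>" using assms Gamma_carrier by (simp flip: m_assoc)
next
  assume g: "inv x \<otimes> y \<in> \<Gamma>"
  have y: "y = x \<otimes> (inv x \<otimes> y)" using assms by (simp flip: m_assoc)
  show "x <# \<Gamma> = y <# \<Gamma>"
  proof
    show "x <# \<Gamma> \<subseteq> y <# \<Gamma>"
    proof
      fix z assume "z \<in> x <# \<Gamma>"
      then obtain \<delta> where d: "\<delta> \<in> \<Gamma>" "z = x \<otimes> \<delta>" unfolding l_coset_def by blast
      have "z = y \<otimes> (inv (inv x \<otimes> y) \<otimes> \<delta>)"
        using d assms Gamma_carrier by (simp add: inv_mult_group m_assoc) (simp flip: m_assoc)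
      moreover have "inv (inv x \<otimes> y) \<otimes> \<delta> \<in> \<Gamma>"
        by (intro subgroup.m_inv_closed [OF sub] subgroup.m_closed [OF sub] g d(1))
      ultimately show "z \<in> y <# \<Gamma>" unfolding l_coset_def by blast
    qed
    show "y <# \<Gamma> \<subseteq> x <# \<Gamma>"
    proof
      fix z assume "z \<in> y <# \<Gamma>"
      then obtain \<delta> where d: "\<delta> \<in> \<Gamma>" "z = y \<otimes> \<delta>" unfolding l_coset_def by blast
      have "z = x \<otimes> (inv x \<otimes> y \<otimes> \<delta>)"
        using d assms Gamma_carrier by (simp flip: m_assoc)
      moreover have "inv x \<otimes> y \<otimes> \<delta> \<in> \<Gamma>" by (intro subgroup.m_closed [OF sub] g d(1))
      ultimately show "z \<in> x <# \<Gamma>" unfolding l_coset_def by blast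
    qed
  qed
qed

lemma coset_translate:
  assumes "x \<in> carrier G" "\<gamma> \<in> \<Gamma>" shows "(x \<otimes> \<gamma>) <# \<Gamma> = x <# \<Gamma>"
proof -
  have "inv x \<otimes> (x \<otimes> \<gamma>) = \<gamma>" using assms Gamma_carrier by (simp flip: m_assoc)
  then show ?thesis using coset_eq_iff [of x "x \<otimes> \<gamma>"] assms Gamma_carrier by auto
qed

lemma continuous_map_mult:
  assumes "continuous_map A T L" "continuous_map A T L'"
  shows "continuous_map A T (\<lambda>a. L a \<otimes> L' a)"
proof -
  have "continuous_map A (prod_topology T T) (\<lambda>a. (L a, L' a))"
    using assms by (simp add: continuous_map_pairedI)
  from continuous_map_compose [OF this mult_cont] show ?thesis by (simp add: o_def)
qed

lemma continuous_map_inv: "continuous_map A T L \<Longrightarrow> continuous_map A T (\<lambda>a. inv (L a))"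
  using continuous_map_compose [OF _ inv_cont] by (fastforce simp: o_def)

lemma continuous_map_carrier: "continuous_map A T L \<Longrightarrow> a \<in> topspace A \<Longrightarrow> L a \<in> carrier G"
  using top by (auto simp: continuous_map_def)

text \<open>\<open>q\<close> is an arbitrary map into sets and carries no continuity requirement,
  since the cosets are given no topology. All topological information is in
  \<open>L\<close>.\<close>

definition lift :: "'c topology \<Rightarrow> ('c \<Rightarrow> 'a set) \<Rightarrow> ('c \<Rightarrow> 'a) \<Rightarrow> bool" where
  "lift A q L \<longleftrightarrow> continuous_map A T L \<and> (\<forall>a\<in>topspace A. L a <# \<Gamma> = q a)"

lemma lift_carrier: "lift A q L \<Longrightarrow> a \<in> topspace A \<Longrightarrow> L a \<in> carrier G"
  using continuous_map_carrier by (auto simp: lift_def)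

lemma lift_coset: "lift A q L \<Longrightarrow> a \<in> topspace A \<Longrightarrow> L a <# \<Gamma> = q a"
  by (simp add: lift_def)

lemma lift_unique:
  assumes "connected_space A" "lift A q L" "lift A q L'"
  obtains \<gamma> where "\<gamma> \<in> \<Gamma>" "\<And>a. a \<in> topspace A \<Longrightarrow> L' a = L a \<otimes> \<gamma>"
proof (cases "topspace A = {}")
  case True then show thesis using that subgroup.one_closed [OF sub] by blast
next
  case False
  then obtain a0 where a0: "a0 \<in> topspace A" by blast
  define d where "d = (\<lambda>a. inv (L a) \<otimes> L' a)"
  have d: "d a \<in> \<Gamma>" if "a \<in> topspace A" for a
    using coset_eq_iff [OF lift_carrier [OF assms(2) that] lift_carrier [OF assms(3) that]]
      lift_coset [OF assms(2) that] lift_coset [OF assms(3) that] by (simp add: d_def)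
  have "continuous_map A T d"
    unfolding d_def using assms by (intro continuous_map_mult continuous_map_inv) (auto simp: lift_def)
  then have "continuous_map A (subtopology T \<Gamma>) d"
    using d by (auto simp: continuous_map_in_subtopology)
  then have "connectedin (subtopology T \<Gamma>) (d ` topspace A)"
    using assms(1) connectedin_continuous_map_image connectedin_topspace by blast
  then obtain c where c: "d ` topspace A \<subseteq> {c}"
    using td unfolding totally_disconnected_space_def by blast
  have "L' a = L a \<otimes> c" if "a \<in> topspace A" for a
  proof -
    have "d a = c" using c that by blast
    moreover have "L' a = L a \<otimes> d a"
      using lift_carrier [OF assms(2) that] lift_carrier [OF assms(3) that] by (simp add: d_def flip: m_assoc)
    ultimately show ?thesis by simp
  qed
  moreover have "c \<in> \<Gamma>" using c d a0 by blast
  ultimately show thesis using that by blast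
qed

lemma lift_translate:
  assumes "lift A q L" "\<gamma> \<in> \<Gamma>"
  shows "lift A q (\<lambda>a. L a \<otimes> \<gamma>)"
  unfolding lift_def
proof
  show "continuous_map A T (\<lambda>a. L a \<otimes> \<gamma>)"
    using assms Gamma_carrier top by (intro continuous_map_mult) (auto simp: lift_def)
  show "\<forall>a\<in>topspace A. L a \<otimes> \<gamma> <# \<Gamma> = q a"
    using coset_translate [OF lift_carrier [OF assms(1)] assms(2)] lift_coset [OF assms(1)] by simp
qed

text \<open>The initial condition of a lifting problem can be prescribed afterwards, by a
  translation inside the fibre.\<close>

lemma lift_through:
  assumes "lift A q L" "a \<in> topspace A" "y \<in> carrier G" "y <# \<Gamma> = q a"
  obtains L' where "lift A q L'" "L' a = y"
proof -
  have La: "L a \<in> carrier G" "L a <# \<Gamma> = y <# \<Gamma>"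
    using lift_carrier [OF assms(1,2)] lift_coset [OF assms(1,2)] assms(4) by simp_all
  then have g: "inv (L a) \<otimes> y \<in> \<Gamma>" using assms coset_eq_iff by blast
  show thesis
    by (rule that [OF lift_translate [OF assms(1) g]]) (use La assms in \<open>simp flip: m_assoc\<close>)
qed

lemma lift_subtopology: "lift A q L \<Longrightarrow> lift (subtopology A S) q L"
  by (auto simp: lift_def continuous_map_from_subtopology)

lemma lift_compose: "lift X q L \<Longrightarrow> continuous_map A X h \<Longrightarrow> lift A (\<lambda>a. q (h a)) (\<lambda>a. L (h a))"
  unfolding lift_def using continuous_map_compose [of A X h T L] continuous_map_image_subset_topspace [of A X h]
  by (auto simp: o_def)

lemma lift_unique_at:
  assumes "connected_space A" "lift A q L" "lift A q L'" "a0 \<in> topspace A" "L a0 = L' a0" "a \<in> topspace A"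
  shows "L a = L' a"
proof -
  obtain \<gamma> where g: "\<gamma> \<in> \<Gamma>" "\<And>a. a \<in> topspace A \<Longrightarrow> L' a = L a \<otimes> \<gamma>"
    using lift_unique assms(1-3) by metis
  have "L a0 \<otimes> \<gamma> = L a0 \<otimes> \<one>" using g(2) [OF assms(4)] assms(5) lift_carrier [OF assms(2,4)] by simp
  then have "\<gamma> = \<one>" using lift_carrier [OF assms(2,4)] Gamma_carrier [OF g(1)] by (metis Units_eq Units_l_cancel one_closed)
  then show ?thesis using g(2) [OF assms(6)] lift_carrier [OF assms(2,6)] by simp
qed

text \<open>On the connected overlap the two lifts differ by a single element of
  \<open>\<Gamma>\<close>; translating one of them by it makes them agree there.\<close>

lemma lift_glue:
  assumes C: "closedin A C" and D: "closedin A D" and cover: "topspace A \<subseteq> C \<union> D"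
    and conn: "connected_space (subtopology A (C \<inter> D))"
    and L: "lift (subtopology A C) q L" and L': "lift (subtopology A D) q L'"
  shows "\<exists>K. lift A q K"
proof -
  have "lift (subtopology A (C \<inter> D)) q L" "lift (subtopology A (C \<inter> D)) q L'"
    using lift_subtopology [OF L, of D] lift_subtopology [OF L', of C]
    by (simp_all add: subtopology_subtopology Int_commute)
  from lift_unique [OF conn this(2,1)] obtain \<gamma> where g: "\<gamma> \<in> \<Gamma>"
    "\<And>a. a \<in> topspace (subtopology A (C \<inter> D)) \<Longrightarrow> L a = L' a \<otimes> \<gamma>" by blast
  have L'': "lift (subtopology A D) q (\<lambda>a. L' a \<otimes> \<gamma>)" using lift_translate [OF L' g(1)] .
  define K where "K = (\<lambda>a. if a \<in> C then L a else L' a \<otimes> \<gamma>)"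
  have KD: "K a = L' a \<otimes> \<gamma>" if "a \<in> topspace A" "a \<in> D" for a
    using g(2) that by (auto simp: K_def)
  have "continuous_map A T K"
  proof (rule pasting_lemma_closed [where I = "{True, False}" and T = "\<lambda>b. if b then C else D"
        and f = "\<lambda>b. if b then L else (\<lambda>a. L' a \<otimes> \<gamma>)"])
    show "\<And>i. i \<in> {True, False} \<Longrightarrow> closedin A (if i then C else D)" using C D by auto
    show "continuous_map (subtopology A (if i then C else D)) T (if i then L else (\<lambda>a. L' a \<otimes> \<gamma>))" if "i \<in> {True, False}" for i
      using L L'' by (auto simp: lift_def)
    show "(if i then L else (\<lambda>a. L' a \<otimes> \<gamma>)) x = (if j then L else (\<lambda>a. L' a \<otimes> \<gamma>)) x"
      if "x \<in> topspace A \<inter> (if i then C else D) \<inter> (if j then C else D)" for i j x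
      using that g(2) by (auto split: if_splits)
    show "\<exists>j. j \<in> {True, False} \<and> x \<in> (if j then C else D) \<and> K x = (if j then L else (\<lambda>a. L' a \<otimes> \<gamma>)) x"
      if "x \<in> topspace A" for x
      using that cover by (cases "x \<in> C") (auto simp: K_def intro: exI [of _ True] exI [of _ False])
  qed simp
  moreover have "K a <# \<Gamma> = q a" if "a \<in> topspace A" for a
    using that cover L L'' KD by (cases "a \<in> C") (auto simp: K_def lift_def)
  ultimately show ?thesis unfolding lift_def by blast
qed

lemma lift_local:
  assumes "\<And>x. x \<in> topspace X \<Longrightarrow> \<exists>V. openin X V \<and> x \<in> V \<and> lift (subtopology X V) q L"
  shows "lift X q L"
proof -
  obtain V where V: "\<And>x. x \<in> topspace X \<Longrightarrow> openin X (V x)" "\<And>x. x \<in> topspace X \<Longrightarrow> x \<in> V x"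
    "\<And>x. x \<in> topspace X \<Longrightarrow> lift (subtopology X (V x)) q L" using assms by metis
  have "continuous_map X T L"
    by (rule pasting_lemma [where I = "topspace X" and T = V and f = "\<lambda>_. L"]) (use V in \<open>auto simp: lift_def\<close>)
  moreover have "L a <# \<Gamma> = q a" if "a \<in> topspace X" for a
    using V(2,3) [OF that] that by (auto simp: lift_def)
  ultimately show ?thesis by (simp add: lift_def)
qed

section \<open>Lifting over the unit square\<close>

abbreviation "unit_square \<equiv> {0..1} \<times> {0..1} :: (real \<times> real) set"

lemma lift_glue_sets:
  fixes C D :: "(real \<times> real) set"
  assumes "closed C" "closed D" "connected (C \<inter> D)" "lift (top_of_set C) q L" "lift (top_of_set D) q L'"
  shows "\<exists>K. lift (top_of_set (C \<union> D)) q K"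
proof (rule lift_glue [where C = C and D = D])
  show "closedin (top_of_set (C \<union> D)) C" "closedin (top_of_set (C \<union> D)) D"
    using assms(1,2) by (auto simp: closedin_closed)
  have "(C \<union> D) \<inter> (C \<inter> D) = C \<inter> D" by blast
  then show "connected_space (subtopology (top_of_set (C \<union> D)) (C \<inter> D))"
    using assms(3) connectedin_def [of euclidean "C \<inter> D"] by (simp add: subtopology_subtopology)
  have "(C \<union> D) \<inter> C = C" "(C \<union> D) \<inter> D = D" by blast+
  then show "lift (subtopology (top_of_set (C \<union> D)) C) q L" "lift (subtopology (top_of_set (C \<union> D)) D) q L'"
    using assms(4,5) by (simp_all add: subtopology_subtopology)
qed auto

lemma lift_subset:
  assumes "lift (top_of_set C) q L" "D \<subseteq> C" shows "lift (top_of_set D) q L"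
  using lift_subtopology [OF assms(1), of D] assms(2) by (simp add: subtopology_subtopology Int_absorb1)

text \<open>Liftability of strips and of rectangles is additive because the overlap is connected, so Bolzano's
  bisection principle, used once in each variable, passes from small rectangles to the square.\<close>

lemma lift_strip:
  fixes q :: "real \<times> real \<Rightarrow> 'a set"
  assumes loc: "\<And>z. z \<in> unit_square \<Longrightarrow> \<exists>U L. open U \<and> z \<in> U \<and> lift (top_of_set (U \<inter> unit_square)) q L"
    and s: "s \<in> {0..1}"
  shows "\<exists>\<epsilon>>0. \<exists>L. lift (top_of_set (({s - \<epsilon>..s + \<epsilon>} \<inter> {0..1}) \<times> {0..1})) q L"
proof -
  \<comment> \<open>The width of the strip may depend on the interval in the second variable;
    joining two intervals keeps the smaller of the two widths.\<close>
  define P where "P = (\<lambda>c d. \<exists>\<epsilon>>0. \<exists>L. lift (top_of_set (({s - \<epsilon>..s + \<epsilon>} \<inter> {0..1}) \<times> ({c..d} \<inter> {0..1}))) q L)"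
  have "P 0 1"
  proof (rule Bolzano)
    fix a b c :: real assume "P a b" "P b c" and abc: "a \<le> b" "b \<le> c"
    then obtain \<epsilon>1 \<epsilon>2 L1 L2 where 1: "\<epsilon>1 > 0" "\<epsilon>2 > 0"
      "lift (top_of_set (({s - \<epsilon>1..s + \<epsilon>1} \<inter> {0..1}) \<times> ({a..b} \<inter> {0..1}))) q L1"
      "lift (top_of_set (({s - \<epsilon>2..s + \<epsilon>2} \<inter> {0..1}) \<times> ({b..c} \<inter> {0..1}))) q L2" by (auto simp: P_def)
    define \<epsilon> where "\<epsilon> = min \<epsilon>1 \<epsilon>2"
    let ?I = "{s - \<epsilon>..s + \<epsilon>} \<inter> {0..1}"
    have "\<exists>K. lift (top_of_set (?I \<times> ({a..b} \<inter> {0..1}) \<union> ?I \<times> ({b..c} \<inter> {0..1}))) q K"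
    proof (rule lift_glue_sets)
      show "lift (top_of_set (?I \<times> ({a..b} \<inter> {0..1}))) q L1"
        by (rule lift_subset [OF 1(3)]) (auto simp: \<epsilon>_def)
      show "lift (top_of_set (?I \<times> ({b..c} \<inter> {0..1}))) q L2"
        by (rule lift_subset [OF 1(4)]) (auto simp: \<epsilon>_def)
      show "connected (?I \<times> ({a..b} \<inter> {0..1}) \<inter> ?I \<times> ({b..c} \<inter> {0..1}))"
        unfolding Times_Int_Times by (intro convex_connected convex_Times convex_Int) auto
    qed (auto intro!: closed_Times)
    moreover have "?I \<times> ({a..b} \<inter> {0..1}) \<union> ?I \<times> ({b..c} \<inter> {0..1}) = ?I \<times> ({a..c} \<inter> {0..1})"
      using abc by auto
    ultimately show "P a c" unfolding P_def using 1(1,2) by (intro exI [of _ \<epsilon>]) (auto simp: \<epsilon>_def)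
  next
    fix x :: real assume x: "0 \<le> x" "x \<le> 1"
    then obtain U L where U: "open U" "(s, x) \<in> U" "lift (top_of_set (U \<inter> unit_square)) q L"
      using loc [of "(s, x)"] s by auto
    then obtain A B where AB: "open A" "open B" "s \<in> A" "x \<in> B" "A \<times> B \<subseteq> U"
      by (metis open_prod_elim mem_Sigma_iff)
    obtain d1 d2 where d: "d1 > 0" "d2 > 0" "cball s d1 \<subseteq> A" "cball x d2 \<subseteq> B"
      using AB open_contains_cball by metis
    have "P a b" if ab: "a \<le> x" "x \<le> b" "b - a < d2" for a b
    proof -
      have "({s - d1..s + d1} \<inter> {0..1}) \<times> ({a..b} \<inter> {0..1}) \<subseteq> U \<inter> unit_square"
        using AB(5) d(3,4) ab by (auto simp: cball_eq_atLeastAtMost subset_iff)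
      then show ?thesis unfolding P_def using d(1) lift_subset [OF U(3)] by blast
    qed
    then show "\<exists>d>0. \<forall>a b. a \<le> x \<and> x \<le> b \<and> b - a < d \<longrightarrow> P a b" using d(2) by blast
  qed simp
  then show ?thesis by (simp add: P_def)
qed

lemma lift_square:
  fixes q :: "real \<times> real \<Rightarrow> 'a set"
  assumes loc: "\<And>z. z \<in> unit_square \<Longrightarrow> \<exists>U L. open U \<and> z \<in> U \<and> lift (top_of_set (U \<inter> unit_square)) q L"
  shows "\<exists>L. lift (top_of_set unit_square) q L"
proof -
  define P where "P = (\<lambda>a b. \<exists>L. lift (top_of_set (({a..b} \<inter> {0..1}) \<times> {0..1})) q L)"
  have "P 0 1"
  proof (rule Bolzano)
    fix a b c :: real assume "P a b" "P b c" and abc: "a \<le> b" "b \<le> c"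
    then obtain L1 L2 where 1:
      "lift (top_of_set (({a..b} \<inter> {0..1}) \<times> {0..1})) q L1"
      "lift (top_of_set (({b..c} \<inter> {0..1}) \<times> {0..1})) q L2" by (auto simp: P_def)
    have "\<exists>K. lift (top_of_set (({a..b} \<inter> {0..1}) \<times> {0..1} \<union> ({b..c} \<inter> {0..1}) \<times> {0..1})) q K"
    proof (rule lift_glue_sets [OF _ _ _ 1])
      show "connected (({a..b} \<inter> {0..1}) \<times> {0..1} \<inter> ({b..c} \<inter> {0..1}) \<times> {0..1::real})"
        unfolding Times_Int_Times by (intro convex_connected convex_Times convex_Int) auto
    qed (auto intro!: closed_Times)
    moreover have "({a..b} \<inter> {0..1}) \<times> {0..1} \<union> ({b..c} \<inter> {0..1}) \<times> {0..1} = ({a..c} \<inter> {0..1}) \<times> {0..1::real}"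
      using abc by auto
    ultimately show "P a c" by (simp add: P_def)
  next
    fix x :: real assume x: "0 \<le> x" "x \<le> 1"
    then obtain \<epsilon> L where e: "\<epsilon> > 0" "lift (top_of_set (({x - \<epsilon>..x + \<epsilon>} \<inter> {0..1}) \<times> {0..1})) q L"
      using lift_strip [OF loc, of x] by auto
    have "P a b" if ab: "a \<le> x" "x \<le> b" "b - a < \<epsilon>" for a b
    proof -
      have "({a..b} \<inter> {0..1}) \<times> {0..1} \<subseteq> ({x - \<epsilon>..x + \<epsilon>} \<inter> {0..1}) \<times> {0..1::real}" using ab by auto
      then show ?thesis unfolding P_def using lift_subset [OF e(2)] by blast
    qed
    then show "\<exists>d>0. \<forall>a b. a \<le> x \<and> x \<le> b \<and> b - a < d \<longrightarrow> P a b" using e(1) by blast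
  qed simp
  then show ?thesis by (simp add: P_def)
qed

lemma lift_square_map:
  assumes loc: "\<And>x. x \<in> topspace X \<Longrightarrow> \<exists>V L. openin X V \<and> x \<in> V \<and> lift (subtopology X V) q L"
    and H: "continuous_map (top_of_set unit_square) X H"
  shows "\<exists>L. lift (top_of_set unit_square) (\<lambda>z. q (H z)) L"
proof (rule lift_square)
  fix z :: "real \<times> real" assume z: "z \<in> unit_square"
  then have "H z \<in> topspace X" using H by (auto simp: continuous_map_def)
  then obtain V L where V: "openin X V" "H z \<in> V" "lift (subtopology X V) q L" using loc by blast
  have "openin (top_of_set unit_square) {w \<in> topspace (top_of_set unit_square). H w \<in> V}"
    by (rule openin_continuous_map_preimage [OF H V(1)])
  then obtain U where U: "open U" "{w \<in> topspace (top_of_set unit_square). H w \<in> V} = unit_square \<inter> U"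
    unfolding openin_open by blast
  have "continuous_map (top_of_set (unit_square \<inter> U)) (subtopology X V) H"
    using continuous_map_from_subtopology [OF H, of U] U(2)
    by (auto simp: continuous_map_in_subtopology subtopology_subtopology)
  then have "lift (top_of_set (U \<inter> unit_square)) (\<lambda>w. q (H w)) (\<lambda>w. L (H w))"
    using lift_compose [OF V(3)] by (simp add: Int_commute)
  moreover have "z \<in> U" using U(2) z V(2) by auto
  ultimately show "\<exists>U L. open U \<and> z \<in> U \<and> lift (top_of_set (U \<inter> unit_square)) (\<lambda>z. q (H z)) L"
    using U(1) by blast
qed

section \<open>Lifting of paths and monodromy\<close>

lemma connected_unit: "connected_space (top_of_set {0..1::real})"
  using connectedin_def [of euclidean "{0..1::real}"] by simp

text \<open>A path is a square that is constant in the second variable, so the square already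
  contains this case; the lift is read off along its bottom side.\<close>

lemma lift_path:
  assumes loc: "\<And>x. x \<in> topspace X \<Longrightarrow> \<exists>V L. openin X V \<and> x \<in> V \<and> lift (subtopology X V) q L"
    and p: "pathin X p"
  shows "\<exists>L. lift (top_of_set {0..1}) (\<lambda>t. q (p t)) L"
proof -
  have "continuous_map (top_of_set unit_square) (top_of_set {0..1::real}) fst"
    by (auto intro!: continuous_intros)
  from continuous_map_compose [OF this p [unfolded pathin_def]]
  have "continuous_map (top_of_set unit_square) X (p \<circ> fst)" .
  from lift_square_map [OF loc this] obtain L where L: "lift (top_of_set unit_square) (\<lambda>z. q ((p \<circ> fst) z)) L" by blast
  have "continuous_map (top_of_set {0..1::real}) (top_of_set unit_square) (\<lambda>t. (t, 0))"
    by (auto intro!: continuous_intros)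
  from lift_compose [OF L this] show ?thesis by auto
qed

text \<open>The constant map at \<open>L 0\<close> is a lift of the same map with the same start. In
  a totally disconnected fibre a path cannot move.\<close>

lemma lift_const:
  assumes "lift (top_of_set {0..1::real}) q L" "\<And>t. t \<in> {0..1} \<Longrightarrow> q t = q 0"
  shows "L 1 = L 0"
proof -
  have "lift (top_of_set {0..1::real}) q (\<lambda>_. L 0)"
    unfolding lift_def
  proof
    show "continuous_map (top_of_set {0..1}) T (\<lambda>_. L 0)"
      using lift_carrier [OF assms(1), of 0] by (simp add: top)
    show "\<forall>a\<in>topspace (top_of_set {0..1}). L 0 <# \<Gamma> = q a"
      using lift_coset [OF assms(1), of 0] assms(2) [symmetric] by simp
  qed
  from lift_unique_at [OF connected_unit this assms(1), of 0 1] show ?thesis by simp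
qed

text \<open>Lift a null homotopy of the loop over the square. Three sides of the square go to the
  base point, so the lift is constant along them and its four corners coincide; the fourth side
  lifts the loop itself.\<close>

lemma lift_loop:
  assumes loc: "\<And>x. x \<in> topspace X \<Longrightarrow> \<exists>V L. openin X V \<and> x \<in> V \<and> lift (subtopology X V) q L"
    and sc: "simply_connected_space X" and p: "pathin X p" "p 0 = p 1"
    and K: "lift (top_of_set {0..1}) (\<lambda>t. q (p t)) K"
  shows "K 0 = K 1"
proof -
  have "homotopic_with (\<lambda>q. q 0 = p 0 \<and> q 1 = p 0) (top_of_set {0..1}) X p (\<lambda>_. p 0)"
    using sc p unfolding simply_connected_space_def by blast
  then have "\<exists>h. continuous_map (prod_topology (top_of_set {0..1::real}) (top_of_set {0..1::real})) X h \<and>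
      (\<forall>x. h (0, x) = p x) \<and> (\<forall>x. h (1, x) = p 0) \<and> (\<forall>t\<in>{0..1}. h (t, 0) = p 0 \<and> h (t, 1) = p 0)"
    by (simp only: homotopic_with_def)
  then obtain h where h: "continuous_map (prod_topology (top_of_set {0..1::real}) (top_of_set {0..1::real})) X h"
    "\<forall>x. h (0, x) = p x" "\<forall>x. h (1, x) = p 0" "\<forall>t\<in>{0..1}. h (t, 0) = p 0 \<and> h (t, 1) = p 0"
    by (elim exE conjE)
  have "continuous_map (top_of_set unit_square) X h"
    using h(1) by (simp flip: subtopology_Times)
  from lift_square_map [OF loc this] obtain L where L: "lift (top_of_set unit_square) (\<lambda>z. q (h z)) L" by blast
  have c: "continuous_map (top_of_set {0..1::real}) (top_of_set unit_square) (\<lambda>t. (t, 0))"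
    "continuous_map (top_of_set {0..1::real}) (top_of_set unit_square) (\<lambda>t. (t, 1))"
    "continuous_map (top_of_set {0..1::real}) (top_of_set unit_square) (\<lambda>t. (0, t))"
    "continuous_map (top_of_set {0..1::real}) (top_of_set unit_square) (\<lambda>t. (1, t))"
    by (auto intro!: continuous_intros)
  have "L (1, 0) = L (0, 0)" by (rule lift_const [OF lift_compose [OF L c(1)]]) (simp add: h(2-4) p(2))
  moreover have "L (1, 1) = L (0, 1)" by (rule lift_const [OF lift_compose [OF L c(2)]]) (simp add: h(2-4) p(2))
  moreover have "L (1, 1) = L (1, 0)" by (rule lift_const [OF lift_compose [OF L c(4)]]) (simp add: h(2-4) p(2))
  ultimately have closed: "L (0, 0) = L (0, 1)" by simp
  have l: "lift (top_of_set {0..1}) (\<lambda>t. q (p t)) (\<lambda>t. L (0, t))"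
    using lift_compose [OF L c(3)] by (simp add: h(2-4) p(2))
  obtain \<gamma> where "\<And>a. a \<in> {0..1} \<Longrightarrow> K a = L (0, a) \<otimes> \<gamma>"
    by (rule lift_unique [OF connected_unit l K]) auto
  then show ?thesis using closed by simp
qed

text \<open>Run along \<open>p\<close> and back along \<open>p'\<close>. A lift \<open>R\<close> of
  this loop closes up, so its two halves, read from the outer ends inwards, are lifts of
  \<open>p\<close> and \<open>p'\<close> with common start \<open>R 0 = R 1\<close> and common end
  \<open>R (1/2)\<close>. Equal starts of \<open>K\<close> and \<open>K'\<close> then force the same
  translation for both.\<close>

lemma lift_paths_same_end:
  assumes loc: "\<And>x. x \<in> topspace X \<Longrightarrow> \<exists>V L. openin X V \<and> x \<in> V \<and> lift (subtopology X V) q L"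
    and sc: "simply_connected_space X" and p: "pathin X p" and p': "pathin X p'" and ends: "p 0 = p' 0" "p 1 = p' 1"
    and K: "lift (top_of_set {0..1}) (\<lambda>t. q (p t)) K"
    and K': "lift (top_of_set {0..1}) (\<lambda>t. q (p' t)) K'" and start: "K 0 = K' 0"
  shows "K 1 = K' 1"
proof -
  \<comment> \<open>The second half is \<open>p'\<close> backwards, written in the variable
    \<open>2 * t - 1\<close> that \<open>pathin_join\<close> expects.\<close>
  define r where "r = (\<lambda>t. if t \<le> 1/2 then p (2 * t) else p' (1 - (2 * t - 1)))"
  have "continuous_map (top_of_set {0..1::real}) (top_of_set {0..1::real}) (\<lambda>t. 1 - t)"
    by (auto intro!: continuous_intros)
  from continuous_map_compose [OF this p' [unfolded pathin_def]]
  have rev: "pathin X (\<lambda>t. p' (1 - t))" by (simp add: pathin_def o_def)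
  have r: "pathin X r" unfolding r_def
    using pathin_join [OF p rev] ends by simp
  obtain R where R: "lift (top_of_set {0..1}) (\<lambda>t. q (r t)) R" using lift_path [OF loc r] by blast
  have closed: "R 0 = R 1" by (rule lift_loop [OF loc sc r _ R]) (simp_all add: r_def ends)
  have c: "continuous_map (top_of_set {0..1::real}) (top_of_set {0..1::real}) (\<lambda>t. t / 2)"
    "continuous_map (top_of_set {0..1::real}) (top_of_set {0..1::real}) (\<lambda>t. 1 - t / 2)"
    by (auto intro!: continuous_intros)
  have "r (t / 2) = p t" if "t \<in> {0..1}" for t using that by (auto simp: r_def)
  then have 1: "lift (top_of_set {0..1}) (\<lambda>t. q (p t)) (\<lambda>t. R (t / 2))"
    using lift_compose [OF R c(1)] by (auto simp: lift_def)
  have "r (1 - t / 2) = p' t" if "t \<in> {0..1}" for t using that ends by (auto simp: r_def)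
  then have 2: "lift (top_of_set {0..1}) (\<lambda>t. q (p' t)) (\<lambda>t. R (1 - t / 2))"
    using lift_compose [OF R c(2)] by (auto simp: lift_def)
  obtain \<gamma> where g: "\<gamma> \<in> \<Gamma>" "\<And>t. t \<in> {0..1} \<Longrightarrow> K t = R (t / 2) \<otimes> \<gamma>"
    by (rule lift_unique [OF connected_unit 1 K]) auto
  obtain \<gamma>' where g': "\<gamma>' \<in> \<Gamma>" "\<And>t. t \<in> {0..1} \<Longrightarrow> K' t = R (1 - t / 2) \<otimes> \<gamma>'"
    by (rule lift_unique [OF connected_unit 2 K']) auto
  have "R 0 \<otimes> \<gamma> = R 0 \<otimes> \<gamma>'" using g(2) [of 0] g'(2) [of 0] start closed by simp
  then have "\<gamma> = \<gamma>'" using lift_carrier [OF R, of 0] g(1) g'(1) Gamma_carrier by simp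
  then show ?thesis using g(2) [of 1] g'(2) [of 1] by simp
qed

text \<open>As in covering theory, the value at \<open>x\<close> is the end of a lifted path from a
  base point, and simple connectedness makes it independent of the path. Continuity is obtained by
  showing that near \<open>x\<close> this function coincides with a given local lift.\<close>

theorem lift_exists:
  assumes loc: "\<And>x. x \<in> topspace X \<Longrightarrow> \<exists>V L. openin X V \<and> x \<in> V \<and> lift (subtopology X V) q L"
    and sc: "simply_connected_space X" and lpc: "locally_path_connected_space X"
  shows "\<exists>L. lift X q L"
proof (cases "topspace X = {}")
  case True
  then have "lift X q L" for L unfolding lift_def by (auto simp: continuous_map_def)
  then show ?thesis by blast
next
  case False
  then obtain b where b: "b \<in> topspace X" by blast
  obtain V L where "b \<in> V" "openin X V" "lift (subtopology X V) q L" using loc [OF b] by blast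
  \<comment> \<open>A local lift at \<open>b\<close> also shows that \<open>q b\<close> is a coset
    at all, so that there is a point to start from.\<close>
  then obtain y0 where y0: "y0 \<in> carrier G" "y0 <# \<Gamma> = q b"
    using b lift_carrier [of "subtopology X V" q L b] by (auto simp: lift_def)
  define E where "E = (\<lambda>x y. \<exists>p K. pathin X p \<and> p 0 = b \<and> p 1 = x \<and> lift (top_of_set {0..1}) (\<lambda>t. q (p t)) K \<and> K 0 = y0 \<and> K 1 = y)"
  have E_ex: "\<exists>y. E x y" if x: "x \<in> topspace X" for x
  proof -
    have "path_connected_space X" using sc by (simp add: simply_connected_space_def)
    then obtain p where p: "pathin X p" "p 0 = b" "p 1 = x"
      using b x unfolding path_connected_space_def by blast
    obtain L where L: "lift (top_of_set {0..1}) (\<lambda>t. q (p t)) L" using lift_path [OF loc p(1)] by blast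
    obtain K where "lift (top_of_set {0..1}) (\<lambda>t. q (p t)) K" "K 0 = y0"
      by (rule lift_through [OF L, of 0 y0]) (use y0 p in auto)
    then show ?thesis unfolding E_def using p by blast
  qed
  have E_unique: "y = y'" if "E x y" "E x y'" for x y y'
    using that lift_paths_same_end [OF loc sc] unfolding E_def by metis
  obtain F where F: "\<And>x. x \<in> topspace X \<Longrightarrow> E x (F x)" using E_ex by metis
  have "lift X q F"
  proof (rule lift_local)
    fix x assume x: "x \<in> topspace X"
    then obtain V L where V: "openin X V" "x \<in> V" "lift (subtopology X V) q L" using loc by blast
    obtain V' where V': "openin X V'" "path_connectedin X V'" "x \<in> V'" "V' \<subseteq> V"
      using lpc V(1,2) unfolding locally_path_connected_space by blast
    obtain p K where p: "pathin X p" "p 0 = b" "p 1 = x" and K: "lift (top_of_set {0..1}) (\<lambda>t. q (p t)) K" "K 0 = y0" "K 1 = F x"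
      using F [OF x] unfolding E_def by blast
    have L': "lift (subtopology X V') q L"
      using lift_subtopology [OF V(3), of V'] V'(4) by (simp add: subtopology_subtopology Int_absorb1)
    obtain s where s: "lift (subtopology X V') q s" "s x = F x"
    proof (rule lift_through [OF L', of x "F x"])
      show "x \<in> topspace (subtopology X V')" using x V' by simp
      show "F x \<in> carrier G" "F x <# \<Gamma> = q x"
        using K(3) p(3) lift_carrier [OF K(1), of 1] lift_coset [OF K(1), of 1] by simp_all
    qed
    have "F v = s v" if v: "v \<in> V'" for v
    proof -
      obtain g where g: "pathin (subtopology X V') g" "g 0 = x" "g 1 = v"
        using V'(2,3) v openin_subset [OF V'(1)] unfolding path_connectedin_def path_connected_space_def by fastforce
      \<comment> \<open>A path to \<open>v\<close> through \<open>x\<close>: along \<open>p\<close>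
        first, then inside \<open>V'\<close>. Its lift follows \<open>K\<close> and then the local
        section \<open>s\<close>, which was chosen to agree with \<open>K\<close> at
        \<open>x\<close>.\<close>
      define r where "r = (\<lambda>t. if t \<le> 1/2 then p (2 * t) else g (2 * t - 1))"
      define R where "R = (\<lambda>t. if t \<le> 1/2 then K (2 * t) else s (g (2 * t - 1)))"
      have r: "pathin X r" unfolding r_def
        by (rule pathin_join) (use p g in \<open>auto simp: pathin_subtopology\<close>)
      have sg: "lift (top_of_set {0..1}) (\<lambda>t. q (g t)) (\<lambda>t. s (g t))"
        using lift_compose [OF s(1) g(1) [unfolded pathin_def]] .
      have "pathin T R" unfolding R_def
        by (rule pathin_join) (use K s g sg in \<open>auto simp: pathin_def lift_def\<close>)
      moreover have "R t <# \<Gamma> = q (r t)" if "t \<in> {0..1}" for t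
        using that K(1) sg by (auto simp: R_def r_def lift_def)
      ultimately have R: "lift (top_of_set {0..1}) (\<lambda>t. q (r t)) R" by (auto simp: lift_def pathin_def)
      have "r 0 = b" "r 1 = v" "R 0 = y0" "R 1 = s v" using p g K by (auto simp: r_def R_def)
      then have "E v (s v)" using r R unfolding E_def by blast
      then show ?thesis using E_unique F v openin_subset [OF V'(1)] by blast
    qed
    then have "lift (subtopology X V') q F"
      using s(1) unfolding lift_def by (auto intro: continuous_map_eq)
    then show "\<exists>V. openin X V \<and> x \<in> V \<and> lift (subtopology X V) q F" using V' by blast
  qed
  then show ?thesis by blast
qed

end

section \<open>Manifolds as diffeological spaces\<close>

lemma smooth_onD: "smooth_on m U n h \<Longrightarrow> i < n \<Longrightarrow> Ck_on m k U (\<lambda>x. h x i)"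
  by (simp add: smooth_on_def)

lemma smooth_on_cong:
  "openin (Euclidean_space m) U \<Longrightarrow> (\<And>x. x \<in> U \<Longrightarrow> f x = g x) \<Longrightarrow> smooth_on m U n f \<Longrightarrow> smooth_on m U n g"
  unfolding smooth_on_def using Ck_on_cong [of m U "\<lambda>x. f x i" "\<lambda>x. g x i" for i] by metis

lemma smooth_on_subset: "smooth_on m U n h \<Longrightarrow> V \<subseteq> U \<Longrightarrow> smooth_on m V n h"
  unfolding smooth_on_def using Ck_on_subset by metis

lemma smooth_on_local:
  assumes "openin (Euclidean_space m) U"
    "\<And>x. x \<in> U \<Longrightarrow> \<exists>V. openin (Euclidean_space m) V \<and> x \<in> V \<and> smooth_on m V n h"
  shows "smooth_on m U n h"
  unfolding smooth_on_def
proof (intro allI impI)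
  fix k i assume "i < n"
  show "Ck_on m k U (\<lambda>x. h x i)"
    by (rule Ck_on_local [OF assms(1)]) (use assms(2) smooth_onD [OF _ \<open>i < n\<close>] in meson)
qed

lemma smooth_on_compose:
  assumes "openin (Euclidean_space m) U" "openin (Euclidean_space n) V" "h \<in> U \<rightarrow> V"
    "smooth_on m U n h" "smooth_on n V p f"
  shows "smooth_on m U p (\<lambda>x. f (h x))"
  unfolding smooth_on_def
proof (intro allI impI)
  fix k i assume "i < p"
  show "Ck_on m k U (\<lambda>x. f (h x) i)"
    by (rule Ck_on_compose [OF assms(1-3) smooth_onD [OF assms(4)] smooth_onD [OF assms(5) \<open>i < p\<close>]])
qed

lemma smooth_on_const: "smooth_on m U n (\<lambda>_. c)"
  by (simp add: smooth_on_def Ck_on_const)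

lemma smooth_on_ident: "smooth_on m U n (\<lambda>x. x)"
  by (simp add: smooth_on_def Ck_on_coord)

lemma smooth_on_continuous:
  assumes "smooth_on m U n h" "openin (Euclidean_space m) U" "openin (Euclidean_space n) V" "h \<in> U \<rightarrow> V"
  shows "continuous_map (subtopology (Euclidean_space m) U) (subtopology (Euclidean_space n) V) h"
  by (rule continuous_map_into_Euclidean_Ck [OF assms(2-4), where k = 0]) (rule smooth_onD [OF assms(1)])

lemma openin_preimage:
  assumes "openin X U" "continuous_map (subtopology X U) Y f" "openin Y W"
  shows "openin X (U \<inter> f -` W)"
proof -
  have "openin (subtopology X U) {x \<in> topspace (subtopology X U). f x \<in> W}"
    by (rule openin_continuous_map_preimage [OF assms(2,3)])
  moreover have "{x \<in> topspace (subtopology X U). f x \<in> W} = U \<inter> f -` W"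
    using openin_subset [OF assms(1)] by auto
  ultimately show ?thesis using openin_trans_full [OF _ assms(1)] by simp
qed

lemma openin_subspace_preimage:
  assumes "openin X U" "openin Y V" "continuous_map (subtopology X U) (subtopology Y V) f" "openin Y W"
  shows "openin X (U \<inter> f -` W)"
  by (rule openin_preimage [OF assms(1) _ assms(4)]) (use assms(3) in \<open>simp add: continuous_map_in_subtopology\<close>)

lemma topspace_subtopology_open: "openin X U \<Longrightarrow> topspace (subtopology X U) = U"
  using openin_subset by (metis topspace_subtopology_subset)

text \<open>A manifold without the Hausdorff, countability and compatibility axioms. This is all that is needed of
  \<open>prod_manifold M M\<close>, so that its transition maps never have to be computed.\<close>

definition charted :: "'a manifold \<Rightarrow> bool" where
  "charted M \<longleftrightarrow> \<Union>(fst ` atlas M) = topspace (mtop M) \<and>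
     (\<forall>(V, \<phi>) \<in> atlas M. openin (mtop M) V \<and> openin (Euclidean_space (mdim M)) (\<phi> ` V) \<and>
        homeomorphic_map (subtopology (mtop M) V) (subtopology (Euclidean_space (mdim M)) (\<phi> ` V)) \<phi>)"

lemma smooth_manifold_charted: "smooth_manifold M \<Longrightarrow> charted M"
  by (auto simp: smooth_manifold_def charted_def)

lemma
  assumes "charted M" "(V, \<phi>) \<in> atlas M"
  shows chart_open: "openin (mtop M) V" and chart_image_open: "openin (Euclidean_space (mdim M)) (\<phi> ` V)"
    and chart_homeo: "homeomorphic_map (subtopology (mtop M) V) (subtopology (Euclidean_space (mdim M)) (\<phi> ` V)) \<phi>"
  using assms by (auto simp: charted_def)

lemma chart_at:
  assumes "charted M" "x \<in> topspace (mtop M)"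
  obtains V \<phi> where "(V, \<phi>) \<in> atlas M" "x \<in> V"
proof -
  have "x \<in> \<Union>(fst ` atlas M)" using assms by (simp add: charted_def)
  then obtain c where "c \<in> atlas M" "x \<in> fst c" by blast
  then show thesis using that [of "fst c" "snd c"] by simp
qed

lemma
  assumes "charted M" "(V, \<phi>) \<in> atlas M"
  shows chart_inj: "inj_on \<phi> V"
    and chart_continuous: "continuous_map (subtopology (mtop M) V) (subtopology (Euclidean_space (mdim M)) (\<phi> ` V)) \<phi>"
    and chart_inv_continuous: "continuous_map (subtopology (Euclidean_space (mdim M)) (\<phi> ` V)) (subtopology (mtop M) V) (inv_into V \<phi>)"
proof -
  note h = chart_homeo [OF assms]
  have top: "topspace (subtopology (mtop M) V) = V" using topspace_subtopology_open [OF chart_open [OF assms]] .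
  show inj: "inj_on \<phi> V" using homeomorphic_imp_injective_map [OF h] top by simp
  show "continuous_map (subtopology (mtop M) V) (subtopology (Euclidean_space (mdim M)) (\<phi> ` V)) \<phi>"
    using h by (rule homeomorphic_imp_continuous_map)
  obtain g where g: "homeomorphic_maps (subtopology (mtop M) V) (subtopology (Euclidean_space (mdim M)) (\<phi> ` V)) \<phi> g"
    using h homeomorphic_map_maps by blast
  show "continuous_map (subtopology (Euclidean_space (mdim M)) (\<phi> ` V)) (subtopology (mtop M) V) (inv_into V \<phi>)"
  proof (rule continuous_map_eq)
    show "continuous_map (subtopology (Euclidean_space (mdim M)) (\<phi> ` V)) (subtopology (mtop M) V) g"
      using g by (simp add: homeomorphic_maps_def)
    show "g y = inv_into V \<phi> y" if "y \<in> topspace (subtopology (Euclidean_space (mdim M)) (\<phi> ` V))" for y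
      using that g inj top by (auto simp: homeomorphic_maps_def inv_into_f_f)
  qed
qed

section \<open>Plots of a manifold\<close>

lemma plot_manifold_iff:
  assumes "charted M"
  shows "plot (manifold_ds M) n U \<alpha> \<longleftrightarrow> openin (Euclidean_space n) U \<and>
     continuous_map (subtopology (Euclidean_space n) U) (mtop M) \<alpha> \<and>
     (\<forall>(W, \<psi>) \<in> atlas M. smooth_on n (U \<inter> \<alpha> -` W) (mdim M) (\<lambda>x. \<psi> (\<alpha> x)))"
proof -
  have "smooth_on n (U \<inter> \<alpha> -` W) (mdim M) (\<psi> \<circ> \<alpha> \<circ> inv_into U id) = smooth_on n (U \<inter> \<alpha> -` W) (mdim M) (\<lambda>x. \<psi> (\<alpha> x))"
    if "openin (Euclidean_space n) U" "continuous_map (subtopology (Euclidean_space n) U) (mtop M) \<alpha>" "(W, \<psi>) \<in> atlas M" for W \<psi>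
  proof -
    have o: "openin (Euclidean_space n) (U \<inter> \<alpha> -` W)"
      using openin_preimage [OF that(1,2) chart_open [OF assms that(3)]] .
    have "inv_into U id x = x" if "x \<in> U" for x
      using f_inv_into_f [of x id U] that by simp
    then have eq: "(\<psi> \<circ> \<alpha> \<circ> inv_into U id) x = \<psi> (\<alpha> x)" if "x \<in> U \<inter> \<alpha> -` W" for x using that by simp
    show ?thesis
    proof
      show "smooth_on n (U \<inter> \<alpha> -` W) (mdim M) (\<lambda>x. \<psi> (\<alpha> x))"
        if "smooth_on n (U \<inter> \<alpha> -` W) (mdim M) (\<psi> \<circ> \<alpha> \<circ> inv_into U id)"
        by (rule smooth_on_cong [OF o eq that])
      show "smooth_on n (U \<inter> \<alpha> -` W) (mdim M) (\<psi> \<circ> \<alpha> \<circ> inv_into U id)"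
        if "smooth_on n (U \<inter> \<alpha> -` W) (mdim M) (\<lambda>x. \<psi> (\<alpha> x))"
        by (rule smooth_on_cong [OF o eq [symmetric] that])
    qed
  qed
  then show ?thesis
    by (auto simp: manifold_ds_def smooth_map_def open_manifold_def)
qed

lemma plot_manifold_chart:
  assumes "charted M" "plot (manifold_ds M) n U \<alpha>" "(W, \<psi>) \<in> atlas M" "\<alpha> \<in> U \<rightarrow> W"
  shows "smooth_on n U (mdim M) (\<lambda>x. \<psi> (\<alpha> x))"
proof -
  have "U \<inter> \<alpha> -` W = U" using assms(4) by auto
  then show ?thesis using assms(2,3) unfolding plot_manifold_iff [OF assms(1)] by fastforce
qed

lemma plot_manifold_continuous:
  "charted M \<Longrightarrow> plot (manifold_ds M) n U \<alpha> \<Longrightarrow> continuous_map (subtopology (Euclidean_space n) U) (mtop M) \<alpha>"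
  by (simp add: plot_manifold_iff)

lemma points_manifold_ds [simp]: "points (manifold_ds M) = topspace (mtop M)"
  by (simp add: manifold_ds_def)

section \<open>Rules for general diffeological spaces\<close>

lemma
  assumes "diffeological_space X"
  shows ds_open: "plot X n U \<alpha> \<Longrightarrow> openin (Euclidean_space n) U"
    and ds_points: "plot X n U \<alpha> \<Longrightarrow> x \<in> U \<Longrightarrow> \<alpha> x \<in> points X"
    and ds_const: "openin (Euclidean_space n) U \<Longrightarrow> c \<in> points X \<Longrightarrow> plot X n U (\<lambda>_. c)"
    and ds_compose: "plot X n U \<alpha> \<Longrightarrow> openin (Euclidean_space m) V \<Longrightarrow> h \<in> V \<rightarrow> U \<Longrightarrow> smooth_on m V n h
        \<Longrightarrow> plot X m V (\<lambda>x. \<alpha> (h x))"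
proof -
  note d = assms [unfolded diffeological_space_def]
  note d1 = conjunct1 [OF d] and d2 = conjunct1 [OF conjunct2 [OF d]] and d3 = conjunct1 [OF conjunct2 [OF conjunct2 [OF d]]]
  show "plot X n U \<alpha> \<Longrightarrow> openin (Euclidean_space n) U" using d1 by blast
  show "plot X n U \<alpha> \<Longrightarrow> x \<in> U \<Longrightarrow> \<alpha> x \<in> points X" using d1 by blast
  show "openin (Euclidean_space n) U \<Longrightarrow> c \<in> points X \<Longrightarrow> plot X n U (\<lambda>_. c)" using d2 by blast
  show "plot X n U \<alpha> \<Longrightarrow> openin (Euclidean_space m) V \<Longrightarrow> h \<in> V \<rightarrow> U \<Longrightarrow> smooth_on m V n h
        \<Longrightarrow> plot X m V (\<lambda>x. \<alpha> (h x))" using d3 [rule_format, of n U \<alpha> m V h] by (simp add: o_def)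
qed

lemma ds_local:
  assumes "diffeological_space X" "openin (Euclidean_space n) U"
    "\<And>x. x \<in> U \<Longrightarrow> \<exists>V \<beta>. x \<in> V \<and> V \<subseteq> U \<and> plot X n V \<beta> \<and> (\<forall>y\<in>V. \<alpha> y = \<beta> y)"
  shows "plot X n U \<alpha>"
proof -
  have pts: "\<alpha> x \<in> points X" if x: "x \<in> U" for x
  proof -
    obtain V \<beta> where "x \<in> V" "plot X n V \<beta>" "\<forall>y\<in>V. \<alpha> y = \<beta> y" using assms(3) [OF x] by blast
    then show ?thesis using ds_points [OF assms(1)] by simp
  qed
  note d = conjunct2 [OF conjunct2 [OF conjunct2 [OF assms(1) [unfolded diffeological_space_def]]]]
  show ?thesis
  proof (rule d [rule_format], intro conjI ballI)
    show "\<alpha> \<in> U \<rightarrow> points X" using pts by blast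
  qed (rule assms(2,3), assumption?)+
qed

text \<open>Needed wherever a map is altered off its carrier, as happens each time it is made
  extensional or an inverse is replaced by \<open>inv_into\<close>.\<close>

lemma ds_cong:
  assumes "diffeological_space X" "plot X n U \<alpha>" "\<And>x. x \<in> U \<Longrightarrow> \<beta> x = \<alpha> x"
  shows "plot X n U \<beta>"
  by (rule ds_local [OF assms(1) ds_open [OF assms(1,2)]]) (use assms(2,3) in blast)

lemma ds_subset:
  assumes "diffeological_space X" "plot X n U \<alpha>" "openin (Euclidean_space n) V" "V \<subseteq> U"
  shows "plot X n V \<alpha>"
  using ds_compose [OF assms(1,2,3), of "\<lambda>x. x"] assms(4) smooth_on_ident by auto

lemma diffeological_spaceI:
  assumes "\<And>n U \<alpha>. plot X n U \<alpha> \<Longrightarrow> openin (Euclidean_space n) U"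
    and "\<And>n U \<alpha> x. plot X n U \<alpha> \<Longrightarrow> x \<in> U \<Longrightarrow> \<alpha> x \<in> points X"
    and "\<And>n U c. openin (Euclidean_space n) U \<Longrightarrow> c \<in> points X \<Longrightarrow> plot X n U (\<lambda>_. c)"
    and "\<And>n U \<alpha> m V h. plot X n U \<alpha> \<Longrightarrow> openin (Euclidean_space m) V \<Longrightarrow> h \<in> V \<rightarrow> U \<Longrightarrow> smooth_on m V n h
        \<Longrightarrow> plot X m V (\<lambda>x. \<alpha> (h x))"
    and "\<And>n U \<alpha>. openin (Euclidean_space n) U \<Longrightarrow> (\<And>x. x \<in> U \<Longrightarrow> \<alpha> x \<in> points X) \<Longrightarrow>
        (\<And>x. x \<in> U \<Longrightarrow> \<exists>V \<beta>. x \<in> V \<and> V \<subseteq> U \<and> plot X n V \<beta> \<and> (\<forall>y\<in>V. \<alpha> y = \<beta> y)) \<Longrightarrow> plot X n U \<alpha>"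
  shows "diffeological_space X"
  unfolding diffeological_space_def o_def
proof (intro conjI allI impI)
  show "plot X n U \<alpha>"
    if "openin (Euclidean_space n) U \<and> \<alpha> \<in> U \<rightarrow> points X \<and>
       (\<forall>x\<in>U. \<exists>V \<beta>. x \<in> V \<and> V \<subseteq> U \<and> plot X n V \<beta> \<and> (\<forall>y\<in>V. \<alpha> y = \<beta> y))" for n U \<alpha>
    by (rule assms(5)) (use that in blast)+
  show "openin (Euclidean_space n) U" "\<alpha> \<in> U \<rightarrow> points X" if "plot X n U \<alpha>" for n U \<alpha>
    using assms(1) [OF that] assms(2) [OF that] by auto
  show "plot X n U (\<lambda>_. c)" if "openin (Euclidean_space n) U \<and> c \<in> points X" for n U c
    using assms(3) that by blast
  show "plot X m V (\<lambda>x. \<alpha> (h x))"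
    if "plot X n U \<alpha> \<and> openin (Euclidean_space m) V \<and> h \<in> V \<rightarrow> U \<and> smooth_on m V n h" for n U \<alpha> m V h
    using that by (elim conjE) (rule assms(4))
qed

section \<open>Manifolds are diffeological spaces, and their smooth maps are the differentiable
  maps\<close>

lemma diffeological_manifold:
  assumes M: "charted M"
  shows "diffeological_space (manifold_ds M)"
proof (rule diffeological_spaceI)
  fix n U \<alpha> assume "plot (manifold_ds M) n U \<alpha>"
  then show "openin (Euclidean_space n) U" by (simp add: plot_manifold_iff [OF M])
next
  fix n U \<alpha> x assume p: "plot (manifold_ds M) n U \<alpha>" "x \<in> U"
  then have U: "openin (Euclidean_space n) U" by (simp add: plot_manifold_iff [OF M])
  show "\<alpha> x \<in> points (manifold_ds M)"
    using plot_manifold_continuous [OF M p(1)] p(2) topspace_subtopology_open [OF U]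
    by (auto simp: continuous_map_def)
next
  fix n U and c :: 'a assume U: "openin (Euclidean_space n) U" "c \<in> points (manifold_ds M)"
  then show "plot (manifold_ds M) n U (\<lambda>_. c)"
    by (auto simp: plot_manifold_iff [OF M] smooth_on_const)
next
  fix n U \<alpha> m V h
  assume p: "plot (manifold_ds M) n U \<alpha>" and V: "openin (Euclidean_space m) V" and h: "h \<in> V \<rightarrow> U" "smooth_on m V n h"
  have U: "openin (Euclidean_space n) U" using p by (simp add: plot_manifold_iff [OF M])
  note ac = plot_manifold_continuous [OF M p]
  note hc = smooth_on_continuous [OF h(2) V U h(1)]
  show "plot (manifold_ds M) m V (\<lambda>x. \<alpha> (h x))"
    unfolding plot_manifold_iff [OF M]
  proof (intro conjI V ballI)
    show "continuous_map (subtopology (Euclidean_space m) V) (mtop M) (\<lambda>x. \<alpha> (h x))"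
      using continuous_map_compose [OF hc ac] by (simp add: o_def)
    fix c assume "c \<in> atlas M"
    moreover obtain W \<psi> where c: "c = (W, \<psi>)" by (cases c)
    ultimately have ch: "(W, \<psi>) \<in> atlas M" by simp
    have o: "openin (Euclidean_space n) (U \<inter> \<alpha> -` W)" using openin_preimage [OF U ac chart_open [OF M ch]] .
    have o': "openin (Euclidean_space m) (V \<inter> h -` (U \<inter> \<alpha> -` W))" by (rule openin_subspace_preimage [OF V U hc o])
    have eq: "V \<inter> (\<lambda>x. \<alpha> (h x)) -` W = V \<inter> h -` (U \<inter> \<alpha> -` W)" using h(1) by auto
    have "smooth_on n (U \<inter> \<alpha> -` W) (mdim M) (\<lambda>x. \<psi> (\<alpha> x))" using p ch by (auto simp: plot_manifold_iff [OF M])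
    then have "smooth_on m (V \<inter> h -` (U \<inter> \<alpha> -` W)) (mdim M) (\<lambda>x. \<psi> (\<alpha> (h x)))"
      by (intro smooth_on_compose [OF o' o _ smooth_on_subset [OF h(2)]]) auto
    then show "case c of (W, \<psi>) \<Rightarrow> smooth_on m (V \<inter> (\<lambda>x. \<alpha> (h x)) -` W) (mdim M) (\<lambda>x. \<psi> (\<alpha> (h x)))"
      by (simp only: c prod.case eq)
  qed
next
  fix n U \<alpha>
  assume U: "openin (Euclidean_space n) U" and loc: "\<And>x. x \<in> U \<Longrightarrow> \<exists>V \<beta>. x \<in> V \<and> V \<subseteq> U \<and> plot (manifold_ds M) n V \<beta> \<and> (\<forall>y\<in>V. \<alpha> y = \<beta> y)"
  have loc': "\<exists>V. x \<in> V \<and> V \<subseteq> U \<and> plot (manifold_ds M) n V \<alpha>" if x: "x \<in> U" for x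
  proof -
    obtain V \<beta> where V: "x \<in> V" "V \<subseteq> U" "plot (manifold_ds M) n V \<beta>" "\<forall>y\<in>V. \<alpha> y = \<beta> y"
      using loc [OF x] by blast
    have Vo: "openin (Euclidean_space n) V" using V(3) by (simp add: plot_manifold_iff [OF M])
    note cb = plot_manifold_continuous [OF M V(3)]
    have "smooth_on n (V \<inter> \<alpha> -` W) (mdim M) (\<lambda>x. \<psi> (\<alpha> x))" if ch: "(W, \<psi>) \<in> atlas M" for W \<psi>
    proof -
      have eq: "V \<inter> \<alpha> -` W = V \<inter> \<beta> -` W" using V(4) by auto
      have "smooth_on n (V \<inter> \<beta> -` W) (mdim M) (\<lambda>x. \<psi> (\<beta> x))"
        using V(3) ch by (auto simp: plot_manifold_iff [OF M])
      then show ?thesis unfolding eq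
        by (rule smooth_on_cong [OF openin_preimage [OF Vo cb chart_open [OF M ch]], rotated]) (use V(4) in auto)
    qed
    moreover have "continuous_map (subtopology (Euclidean_space n) V) (mtop M) \<alpha>"
      using cb by (rule continuous_map_eq) (use V(4) in auto)
    ultimately have "plot (manifold_ds M) n V \<alpha>" using Vo by (auto simp: plot_manifold_iff [OF M])
    then show ?thesis using V(1,2) by blast
  qed
  obtain V where V: "\<And>x. x \<in> U \<Longrightarrow> x \<in> V x" "\<And>x. x \<in> U \<Longrightarrow> V x \<subseteq> U" "\<And>x. x \<in> U \<Longrightarrow> plot (manifold_ds M) n (V x) \<alpha>"
    using loc' by metis
  have Vo: "openin (Euclidean_space n) (V x)" if "x \<in> U" for x using V(3) [OF that] by (simp add: plot_manifold_iff [OF M])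
  \<comment> \<open>Continuity has to come first: smoothness can be localised only on preimages of
    chart domains that are known to be open.\<close>
  have ac: "continuous_map (subtopology (Euclidean_space n) U) (mtop M) \<alpha>"
  proof (rule pasting_lemma [where I = U and T = V and f = "\<lambda>_. \<alpha>"])
    fix x assume x: "x \<in> U"
    show "openin (subtopology (Euclidean_space n) U) (V x)"
      using V(2) [OF x] Vo [OF x] by (simp add: openin_open_subtopology [OF U])
    show "continuous_map (subtopology (subtopology (Euclidean_space n) U) (V x)) (mtop M) \<alpha>"
      using plot_manifold_continuous [OF M V(3) [OF x]] V(2) [OF x] by (simp add: subtopology_subtopology Int_absorb1)
  qed (use V(1) in auto)
  show "plot (manifold_ds M) n U \<alpha>"
    unfolding plot_manifold_iff [OF M]
  proof (intro conjI U ac ballI)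
    fix c assume "c \<in> atlas M"
    moreover obtain W \<psi> where c: "c = (W, \<psi>)" by (cases c)
    ultimately have ch: "(W, \<psi>) \<in> atlas M" by simp
    have "smooth_on n (U \<inter> \<alpha> -` W) (mdim M) (\<lambda>x. \<psi> (\<alpha> x))"
    proof (rule smooth_on_local)
      show "openin (Euclidean_space n) (U \<inter> \<alpha> -` W)" by (rule openin_preimage [OF U ac chart_open [OF M ch]])
      fix x assume x: "x \<in> U \<inter> \<alpha> -` W"
      then have xU: "x \<in> U" by simp
      have "openin (Euclidean_space n) (V x \<inter> \<alpha> -` W)"
        by (rule openin_preimage [OF Vo [OF xU] plot_manifold_continuous [OF M V(3) [OF xU]] chart_open [OF M ch]])
      moreover have "smooth_on n (V x \<inter> \<alpha> -` W) (mdim M) (\<lambda>x. \<psi> (\<alpha> x))"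
        using V(3) [OF xU] ch by (auto simp: plot_manifold_iff [OF M])
      ultimately show "\<exists>V. openin (Euclidean_space n) V \<and> x \<in> V \<and> smooth_on n V (mdim M) (\<lambda>x. \<psi> (\<alpha> x))"
        using V(1) [OF xU] x by blast
    qed
    then show "case c of (W, \<psi>) \<Rightarrow> smooth_on n (U \<inter> \<alpha> -` W) (mdim M) (\<lambda>x. \<psi> (\<alpha> x))" by (simp add: c)
  qed
qed

text \<open>The compatibility of the charts in the atlas enters here: it says precisely that inverse
  charts are plots.\<close>

lemma chart_plot:
  assumes "smooth_manifold M" "(V, \<phi>) \<in> atlas M"
  shows "plot (manifold_ds M) (mdim M) (\<phi> ` V) (inv_into V \<phi>)"
proof -
  have M: "charted M" using assms(1) by (rule smooth_manifold_charted)
  show ?thesis unfolding plot_manifold_iff [OF M]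
  proof (intro conjI ballI chart_image_open [OF M assms(2)])
    show "continuous_map (subtopology (Euclidean_space (mdim M)) (\<phi> ` V)) (mtop M) (inv_into V \<phi>)"
      using chart_inv_continuous [OF M assms(2)] by (simp add: continuous_map_in_subtopology)
    fix c assume "c \<in> atlas M"
    moreover obtain W \<psi> where c: "c = (W, \<psi>)" by (cases c)
    ultimately have ch: "(W, \<psi>) \<in> atlas M" by simp
    have "\<phi> ` V \<inter> inv_into V \<phi> -` W = \<phi> ` (V \<inter> W)"
      using inv_into_f_f [OF chart_inj [OF M assms(2)]] by auto
    moreover have "smooth_on (mdim M) (\<phi> ` (V \<inter> W)) (mdim M) (\<psi> \<circ> inv_into V \<phi>)"
      using assms ch unfolding smooth_manifold_def by blast
    ultimately show "case c of (W, \<psi>) \<Rightarrow> smooth_on (mdim M) (\<phi> ` V \<inter> inv_into V \<phi> -` W) (mdim M) (\<lambda>x. \<psi> (inv_into V \<phi> x))"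
      by (simp add: c o_def)
  qed
qed

lemma ds_differentiableD: "ds_differentiable X Y f \<Longrightarrow> plot X n U \<alpha> \<Longrightarrow> plot Y n U (\<lambda>x. f (\<alpha> x))"
  by (simp add: ds_differentiable_def o_def)

lemma ds_differentiableI:
  "(\<And>x. x \<in> points X \<Longrightarrow> f x \<in> points Y) \<Longrightarrow> (\<And>n U \<alpha>. plot X n U \<alpha> \<Longrightarrow> plot Y n U (\<lambda>x. f (\<alpha> x))) \<Longrightarrow> ds_differentiable X Y f"
  by (simp add: ds_differentiable_def o_def)

text \<open>Around each parameter the plot is cut down to a set that stays in one chart of
  \<open>M\<close>; there the coordinate form of \<open>f\<close> after the plot is a composite of
  two smooth maps between open sets.\<close>

lemma smooth_map_imp_ds:
  assumes M: "charted M" and N: "charted N" and f: "smooth_map M N f"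
  shows "ds_differentiable (manifold_ds M) (manifold_ds N) f"
proof (rule ds_differentiableI)
  have fc: "continuous_map (mtop M) (mtop N) f" using f by (simp add: smooth_map_def)
  then show "\<And>x. x \<in> points (manifold_ds M) \<Longrightarrow> f x \<in> points (manifold_ds N)" by (auto simp: continuous_map_def)
  fix n U \<alpha> assume p: "plot (manifold_ds M) n U \<alpha>"
  note dM = diffeological_manifold [OF M]
  have U: "openin (Euclidean_space n) U" by (rule ds_open [OF dM p])
  have ac: "continuous_map (subtopology (Euclidean_space n) U) (mtop M) \<alpha>" by (rule plot_manifold_continuous [OF M p])
  have fac: "continuous_map (subtopology (Euclidean_space n) U) (mtop N) (\<lambda>x. f (\<alpha> x))"
    using continuous_map_compose [OF ac fc] by (simp add: o_def)
  show "plot (manifold_ds N) n U (\<lambda>x. f (\<alpha> x))"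
    unfolding plot_manifold_iff [OF N]
  proof (intro conjI U fac ballI)
    fix c assume "c \<in> atlas N"
    moreover obtain W \<psi> where c: "c = (W, \<psi>)" by (cases c)
    ultimately have ch: "(W, \<psi>) \<in> atlas N" by simp
    have "smooth_on n (U \<inter> (\<lambda>x. f (\<alpha> x)) -` W) (mdim N) (\<lambda>x. \<psi> (f (\<alpha> x)))"
    proof (rule smooth_on_local)
      show "openin (Euclidean_space n) (U \<inter> (\<lambda>x. f (\<alpha> x)) -` W)"
        by (rule openin_preimage [OF U fac chart_open [OF N ch]])
      fix x assume x: "x \<in> U \<inter> (\<lambda>x. f (\<alpha> x)) -` W"
      then have "\<alpha> x \<in> topspace (mtop M)" using ds_points [OF dM p] by auto
      then obtain V \<phi> where V: "(V, \<phi>) \<in> atlas M" "\<alpha> x \<in> V" using chart_at [OF M] by blast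
      have Z: "openin (mtop M) (V \<inter> f -` W)"
        using openin_preimage [OF chart_open [OF M V(1)] continuous_map_from_subtopology [OF fc] chart_open [OF N ch]] .
      define O1 where "O1 = U \<inter> \<alpha> -` (V \<inter> f -` W)"
      have O1: "openin (Euclidean_space n) O1" unfolding O1_def by (rule openin_preimage [OF U ac Z])
      have img: "openin (Euclidean_space (mdim M)) (\<phi> ` (V \<inter> f -` W))"
      proof -
        have "openin (subtopology (mtop M) V) (V \<inter> f -` W)"
          using Z by (simp add: openin_open_subtopology [OF chart_open [OF M V(1)]])
        then have "openin (subtopology (Euclidean_space (mdim M)) (\<phi> ` V)) (\<phi> ` (V \<inter> f -` W))"
          using homeomorphic_map_openness_eq [OF chart_homeo [OF M V(1)]] by blast
        then show ?thesis using openin_trans_full [OF _ chart_image_open [OF M V(1)]] by blast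
      qed
      have "smooth_on (mdim M) (\<phi> ` (V \<inter> f -` W)) (mdim N) (\<psi> \<circ> f \<circ> inv_into V \<phi>)"
        using f V(1) ch unfolding smooth_map_def by blast
      note s1 = this
      have s2: "smooth_on n O1 (mdim M) (\<lambda>x. \<phi> (\<alpha> x))"
        by (rule plot_manifold_chart [OF M ds_subset [OF dM p O1] V(1)]) (auto simp: O1_def)
      have "smooth_on n O1 (mdim N) (\<lambda>x. (\<psi> \<circ> f \<circ> inv_into V \<phi>) (\<phi> (\<alpha> x)))"
        by (rule smooth_on_compose [OF O1 img _ s2 s1]) (auto simp: O1_def)
      then have "smooth_on n O1 (mdim N) (\<lambda>x. \<psi> (f (\<alpha> x)))"
        by (rule smooth_on_cong [OF O1, rotated]) (use inv_into_f_f [OF chart_inj [OF M V(1)]] in \<open>auto simp: O1_def\<close>)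
      then show "\<exists>V. openin (Euclidean_space n) V \<and> x \<in> V \<and> smooth_on n V (mdim N) (\<lambda>x. \<psi> (f (\<alpha> x)))"
        using O1 x V(2) by (intro exI [of _ O1]) (auto simp: O1_def)
    qed
    then show "case c of (W, \<psi>) \<Rightarrow> smooth_on n (U \<inter> (\<lambda>x. f (\<alpha> x)) -` W) (mdim N) (\<lambda>x. \<psi> (f (\<alpha> x)))" by (simp add: c)
  qed
qed

text \<open>Inverse charts are plots, so \<open>f\<close> turns them into plots of \<open>N\<close>,
  which are continuous. This has to be shown separately because continuity is a clause of
  \<open>smooth_map\<close>.\<close>

lemma ds_imp_continuous:
  assumes sM: "smooth_manifold M" and N: "charted N" and f: "ds_differentiable (manifold_ds M) (manifold_ds N) f"
  shows "continuous_map (mtop M) (mtop N) f"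
proof -
  have M: "charted M" using sM by (rule smooth_manifold_charted)
  have "\<exists>V. openin (mtop M) V \<and> x \<in> V \<and> continuous_map (subtopology (mtop M) V) (mtop N) f" if x: "x \<in> topspace (mtop M)" for x
  proof -
    obtain V \<phi> where V: "(V, \<phi>) \<in> atlas M" "x \<in> V" using chart_at [OF M x] by blast
    have p: "plot (manifold_ds N) (mdim M) (\<phi> ` V) (\<lambda>x. f (inv_into V \<phi> x))"
      by (rule ds_differentiableD [OF f chart_plot [OF sM V(1)]])
    from continuous_map_compose [OF chart_continuous [OF M V(1)] plot_manifold_continuous [OF N p]]
    have "continuous_map (subtopology (mtop M) V) (mtop N) f"
      by (rule continuous_map_eq) (use inv_into_f_f [OF chart_inj [OF M V(1)]] in auto)
    then show ?thesis using chart_open [OF M V(1)] V(2) by blast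
  qed
  then obtain V where V: "\<And>x. x \<in> topspace (mtop M) \<Longrightarrow> openin (mtop M) (V x)" "\<And>x. x \<in> topspace (mtop M) \<Longrightarrow> x \<in> V x"
    "\<And>x. x \<in> topspace (mtop M) \<Longrightarrow> continuous_map (subtopology (mtop M) (V x)) (mtop N) f" by metis
  show ?thesis
    by (rule pasting_lemma [where I = "topspace (mtop M)" and T = V and f = "\<lambda>_. f"]) (use V in auto)
qed

lemma ds_imp_smooth_map:
  assumes sM: "smooth_manifold M" and N: "charted N" and f: "ds_differentiable (manifold_ds M) (manifold_ds N) f"
  shows "smooth_map M N f"
proof -
  have M: "charted M" using sM by (rule smooth_manifold_charted)
  have "smooth_on (mdim M) (\<phi> ` (V \<inter> f -` W)) (mdim N) (\<psi> \<circ> f \<circ> inv_into V \<phi>)"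
    if V: "(V, \<phi>) \<in> atlas M" and W: "(W, \<psi>) \<in> atlas N" for V \<phi> W \<psi>
  proof -
    have p: "plot (manifold_ds N) (mdim M) (\<phi> ` V) (\<lambda>x. f (inv_into V \<phi> x))"
      by (rule ds_differentiableD [OF f chart_plot [OF sM V]])
    have "\<phi> ` V \<inter> (\<lambda>x. f (inv_into V \<phi> x)) -` W = \<phi> ` (V \<inter> f -` W)"
      using inv_into_f_f [OF chart_inj [OF M V]] by auto
    then show ?thesis using p W by (auto simp: plot_manifold_iff [OF N] o_def)
  qed
  then show ?thesis using ds_imp_continuous [OF assms] unfolding smooth_map_def by auto
qed

section \<open>Splitting of Euclidean spaces and products of manifolds\<close>

definition efst :: "nat \<Rightarrow> (nat \<Rightarrow> real) \<Rightarrow> (nat \<Rightarrow> real)" where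
  "efst n u = (\<lambda>i. if i < n then u i else 0)"

definition esnd :: "nat \<Rightarrow> (nat \<Rightarrow> real) \<Rightarrow> (nat \<Rightarrow> real)" where
  "esnd n u = (\<lambda>i. u (i + n))"

definition ejoin :: "nat \<Rightarrow> (nat \<Rightarrow> real) \<Rightarrow> (nat \<Rightarrow> real) \<Rightarrow> (nat \<Rightarrow> real)" where
  "ejoin n x y = (\<lambda>i. if i < n then x i else y (i - n))"

definition eprod :: "nat \<Rightarrow> nat \<Rightarrow> (nat \<Rightarrow> real) set \<Rightarrow> (nat \<Rightarrow> real) set \<Rightarrow> (nat \<Rightarrow> real) set" where
  "eprod n d U W = {u \<in> topspace (Euclidean_space (n + d)). efst n u \<in> U \<and> esnd n u \<in> W}"

text \<open>The hypothesis on \<open>x\<close> matters because \<open>efst\<close> fills in zeros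
  from index \<open>n\<close> on, whatever \<open>x\<close> has there.\<close>

lemma efst_ejoin: "x \<in> topspace (Euclidean_space n) \<Longrightarrow> efst n (ejoin n x y) = x"
  by (auto simp: efst_def ejoin_def topspace_Euclidean_space fun_eq_iff)

lemma esnd_ejoin [simp]: "esnd n (ejoin n x y) = y"
  by (auto simp: esnd_def ejoin_def)

lemma ejoin_efst_esnd [simp]: "ejoin n (efst n u) (esnd n u) = u"
  by (auto simp: efst_def esnd_def ejoin_def fun_eq_iff)

lemma ejoin_top: "y \<in> topspace (Euclidean_space d) \<Longrightarrow> ejoin n x y \<in> topspace (Euclidean_space (n + d))"
  by (auto simp: ejoin_def topspace_Euclidean_space)

lemma efst_top: "efst n u \<in> topspace (Euclidean_space n)"
  by (auto simp: efst_def topspace_Euclidean_space)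

lemma esnd_top: "u \<in> topspace (Euclidean_space (n + d)) \<Longrightarrow> esnd n u \<in> topspace (Euclidean_space d)"
  by (auto simp: esnd_def topspace_Euclidean_space)

lemma ejoin_in_eprod:
  "x \<in> U \<Longrightarrow> U \<subseteq> topspace (Euclidean_space n) \<Longrightarrow> y \<in> W \<Longrightarrow> W \<subseteq> topspace (Euclidean_space d) \<Longrightarrow> ejoin n x y \<in> eprod n d U W"
  using ejoin_top [of y d n x] efst_ejoin [of x n y] by (auto simp: eprod_def)

lemma continuous_map_efst: "continuous_map (subtopology (Euclidean_space m) U) (Euclidean_space n) (efst n)"
proof -
  have "continuous_map (subtopology (Euclidean_space m) U) (subtopology (Euclidean_space n) UNIV) (efst n)"
    unfolding continuous_map_into_Euclidean using continuous_map_Euclidean_coord efst_top by (auto simp: efst_def)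
  then show ?thesis by simp
qed

lemma continuous_map_esnd: "continuous_map (subtopology (Euclidean_space (n + d)) U) (Euclidean_space d) (esnd n)"
proof -
  have "continuous_map (subtopology (Euclidean_space (n + d)) U) (subtopology (Euclidean_space d) UNIV) (esnd n)"
    unfolding continuous_map_into_Euclidean using continuous_map_Euclidean_coord esnd_top [of _ n d] by (auto simp: esnd_def)
  then show ?thesis by simp
qed

lemma continuous_map_ejoin:
  assumes "continuous_map X (Euclidean_space n) f" "continuous_map X (Euclidean_space d) g"
  shows "continuous_map X (Euclidean_space (n + d)) (\<lambda>x. ejoin n (f x) (g x))"
proof -
  have f: "continuous_map X (subtopology (Euclidean_space n) UNIV) f" and g: "continuous_map X (subtopology (Euclidean_space d) UNIV) g"
    using assms by simp_all
  have "continuous_map X (subtopology (Euclidean_space (n + d)) UNIV) (\<lambda>x. ejoin n (f x) (g x))"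
    unfolding continuous_map_into_Euclidean
  proof (intro conjI allI impI)
    fix i assume i: "i < n + d"
    show "continuous_map X euclideanreal (\<lambda>x. ejoin n (f x) (g x) i)"
      using f g i unfolding continuous_map_into_Euclidean by (cases "i < n") (auto simp: ejoin_def)
  next
    show "(\<lambda>x. ejoin n (f x) (g x)) \<in> topspace X \<rightarrow> UNIV \<inter> topspace (Euclidean_space (n + d))"
      using g ejoin_top unfolding continuous_map_into_Euclidean by fastforce
  qed
  then show ?thesis by simp
qed

lemma openin_eprod:
  assumes "openin (Euclidean_space n) U" "openin (Euclidean_space d) W"
  shows "openin (Euclidean_space (n + d)) (eprod n d U W)"
proof -
  have 1: "openin (Euclidean_space (n + d)) {u \<in> topspace (Euclidean_space (n + d)). efst n u \<in> U}"
    using continuous_map_efst [of "n + d" UNIV n] assms(1) by (intro openin_continuous_map_preimage) auto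
  have 2: "openin (Euclidean_space (n + d)) {u \<in> topspace (Euclidean_space (n + d)). esnd n u \<in> W}"
    using continuous_map_esnd [of n d UNIV] assms(2) by (intro openin_continuous_map_preimage) auto
  have "eprod n d U W = {u \<in> topspace (Euclidean_space (n + d)). efst n u \<in> U} \<inter> {u \<in> topspace (Euclidean_space (n + d)). esnd n u \<in> W}"
    by (auto simp: eprod_def)
  then show ?thesis using openin_Int [OF 1 2] by simp
qed

lemma smooth_on_efst: "smooth_on m U n (efst n)"
  unfolding smooth_on_def efst_def by (simp add: Ck_on_coord)

lemma smooth_on_esnd: "smooth_on m U d (esnd n)"
  unfolding smooth_on_def esnd_def by (simp add: Ck_on_coord)

lemma smooth_on_ejoin:
  assumes "smooth_on m U n f" "smooth_on m U d g"
  shows "smooth_on m U (n + d) (\<lambda>x. ejoin n (f x) (g x))"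
  unfolding smooth_on_def ejoin_def
proof (intro allI impI)
  fix k i assume "i < n + d"
  then show "Ck_on m k U (\<lambda>x. if i < n then f x i else g x (i - n))"
    using smooth_onD [OF assms(1), of i k] smooth_onD [OF assms(2), of "i - n" k] by (cases "i < n") auto
qed

lemma prod_manifold_atlas:
  "c \<in> atlas (prod_manifold M N) \<longleftrightarrow>
     (\<exists>V \<phi> W \<psi>. (V, \<phi>) \<in> atlas M \<and> (W, \<psi>) \<in> atlas N \<and> c = (V \<times> W, \<lambda>z. ejoin (mdim M) (\<phi> (fst z)) (\<psi> (snd z))))"
proof -
  have "(\<lambda>(p, q) i. if i < mdim M then \<phi> p i else \<psi> q (i - mdim M)) = (\<lambda>z. ejoin (mdim M) (\<phi> (fst z)) (\<psi> (snd z)))"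
    for \<phi> :: "'a \<Rightarrow> nat \<Rightarrow> real" and \<psi> :: "'b \<Rightarrow> nat \<Rightarrow> real"
    by (auto simp: ejoin_def fun_eq_iff)
  then show ?thesis by (auto simp: prod_manifold_def)
qed

lemma charted_prod:
  assumes M: "charted M" and N: "charted N"
  shows "charted (prod_manifold M N)"
proof -
  let ?P = "prod_manifold M N" and ?m = "mdim M" and ?n = "mdim N"
  have P: "mtop ?P = prod_topology (mtop M) (mtop N)" "mdim ?P = ?m + ?n" by (auto simp: prod_manifold_def)
  have main: "openin (mtop ?P) (V \<times> W) \<and> openin (Euclidean_space (mdim ?P)) (\<kappa> ` (V \<times> W)) \<and>
      homeomorphic_map (subtopology (mtop ?P) (V \<times> W)) (subtopology (Euclidean_space (mdim ?P)) (\<kappa> ` (V \<times> W))) \<kappa>"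
    if V: "(V, \<phi>) \<in> atlas M" and W: "(W, \<psi>) \<in> atlas N" and chi: "\<kappa> = (\<lambda>z. ejoin ?m (\<phi> (fst z)) (\<psi> (snd z)))" for V \<phi> W \<psi> \<kappa>
  proof -
    have tops: "\<phi> ` V \<subseteq> topspace (Euclidean_space ?m)" "\<psi> ` W \<subseteq> topspace (Euclidean_space ?n)"
      using openin_subset [OF chart_image_open [OF M V]] openin_subset [OF chart_image_open [OF N W]] by auto
    have im: "\<kappa> ` (V \<times> W) = eprod ?m ?n (\<phi> ` V) (\<psi> ` W)"
    proof
      show "\<kappa> ` (V \<times> W) \<subseteq> eprod ?m ?n (\<phi> ` V) (\<psi> ` W)"
      proof
        fix u assume "u \<in> \<kappa> ` (V \<times> W)"
        then obtain p q where "p \<in> V" "q \<in> W" "u = ejoin ?m (\<phi> p) (\<psi> q)" by (auto simp: chi)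
        then show "u \<in> eprod ?m ?n (\<phi> ` V) (\<psi> ` W)" using tops by (auto intro!: ejoin_in_eprod)
      qed
      show "eprod ?m ?n (\<phi> ` V) (\<psi> ` W) \<subseteq> \<kappa> ` (V \<times> W)"
      proof
        fix u assume "u \<in> eprod ?m ?n (\<phi> ` V) (\<psi> ` W)"
        then obtain p q where "p \<in> V" "q \<in> W" "efst ?m u = \<phi> p" "esnd ?m u = \<psi> q" by (auto simp: eprod_def)
        then have "u = \<kappa> (p, q)" unfolding chi by (simp flip: \<open>efst ?m u = \<phi> p\<close> \<open>esnd ?m u = \<psi> q\<close>)
        then show "u \<in> \<kappa> ` (V \<times> W)" using \<open>p \<in> V\<close> \<open>q \<in> W\<close> by blast
      qed
    qed
    have o: "openin (Euclidean_space (mdim ?P)) (\<kappa> ` (V \<times> W))"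
      unfolding im P by (rule openin_eprod [OF chart_image_open [OF M V] chart_image_open [OF N W]])
    have o1: "openin (mtop ?P) (V \<times> W)"
      unfolding P using chart_open [OF M V] chart_open [OF N W] by (simp add: openin_prod_Times_iff)
    let ?X = "subtopology (mtop ?P) (V \<times> W)" and ?Y = "subtopology (Euclidean_space (mdim ?P)) (\<kappa> ` (V \<times> W))"
    have topX: "topspace ?X = V \<times> W" by (rule topspace_subtopology_open [OF o1])
    have topY: "topspace ?Y = \<kappa> ` (V \<times> W)" by (rule topspace_subtopology_open [OF o])
    have X: "?X = prod_topology (subtopology (mtop M) V) (subtopology (mtop N) W)"
      unfolding P by (simp add: subtopology_Times)
    have cM: "continuous_map (subtopology (mtop M) V) (Euclidean_space ?m) \<phi>"
      and cN: "continuous_map (subtopology (mtop N) W) (Euclidean_space ?n) \<psi>"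
      using chart_continuous [OF M V] chart_continuous [OF N W] by (simp_all add: continuous_map_in_subtopology)
    have f: "continuous_map ?X ?Y \<kappa>"
      unfolding continuous_map_in_subtopology
    proof
      show "continuous_map ?X (Euclidean_space (mdim ?P)) \<kappa>"
        unfolding X P(2) chi
        using continuous_map_compose [OF continuous_map_fst cM] continuous_map_compose [OF continuous_map_snd cN]
        by (intro continuous_map_ejoin) (simp_all add: o_def)
      show "\<kappa> \<in> topspace ?X \<rightarrow> \<kappa> ` (V \<times> W)" unfolding topX by blast
    qed
    define g where "g = (\<lambda>u. (inv_into V \<phi> (efst ?m u), inv_into W \<psi> (esnd ?m u)))"
    have 1: "continuous_map ?Y (subtopology (Euclidean_space ?m) (\<phi> ` V)) (efst ?m)"
      unfolding continuous_map_in_subtopology using continuous_map_efst by (auto simp: topY im eprod_def)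
    have 2: "continuous_map ?Y (subtopology (Euclidean_space ?n) (\<psi> ` W)) (esnd ?m)"
      unfolding continuous_map_in_subtopology P(2) using continuous_map_esnd by (auto simp: im eprod_def)
    have g: "continuous_map ?Y ?X g"
      unfolding X g_def
      using continuous_map_compose [OF 1 chart_inv_continuous [OF M V]] continuous_map_compose [OF 2 chart_inv_continuous [OF N W]]
      by (intro continuous_map_pairedI) (simp_all add: o_def)
    have gf: "g (\<kappa> z) = z" if "z \<in> V \<times> W" for z
    proof -
      have "\<phi> (fst z) \<in> topspace (Euclidean_space ?m)" using that tops by auto
      then show ?thesis
        using that inv_into_f_f [OF chart_inj [OF M V]] inv_into_f_f [OF chart_inj [OF N W]]
        by (auto simp: g_def chi efst_ejoin)
    qed
    have "homeomorphic_maps ?X ?Y \<kappa> g"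
      unfolding homeomorphic_maps_def topX topY using f g gf by auto
    then show ?thesis using o o1 homeomorphic_map_maps by blast
  qed
  have "\<Union>(fst ` atlas ?P) = topspace (mtop ?P)"
  proof
    show "\<Union>(fst ` atlas ?P) \<subseteq> topspace (mtop ?P)"
      using M N openin_subset [OF chart_open [OF M]] openin_subset [OF chart_open [OF N]]
      by (fastforce simp: prod_manifold_atlas P)
    show "topspace (mtop ?P) \<subseteq> \<Union>(fst ` atlas ?P)"
    proof
      fix z assume "z \<in> topspace (mtop ?P)"
      then have "fst z \<in> topspace (mtop M)" "snd z \<in> topspace (mtop N)" by (auto simp: P)
      then obtain V \<phi> W \<psi> where V: "(V, \<phi>) \<in> atlas M" "fst z \<in> V" and W: "(W, \<psi>) \<in> atlas N" "snd z \<in> W"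
        using chart_at [OF M] chart_at [OF N] by metis
      have "(V \<times> W, \<lambda>z. ejoin ?m (\<phi> (fst z)) (\<psi> (snd z))) \<in> atlas ?P"
        unfolding prod_manifold_atlas using V W by blast
      moreover have "z \<in> fst (V \<times> W, \<lambda>z. ejoin ?m (\<phi> (fst z)) (\<psi> (snd z)))" using V(2) W(2) by (simp add: mem_Times_iff)
      ultimately show "z \<in> \<Union>(fst ` atlas ?P)" by blast
    qed
  qed
  moreover have "case c of (V, \<phi>) \<Rightarrow> openin (mtop ?P) V \<and> openin (Euclidean_space (mdim ?P)) (\<phi> ` V) \<and>
        homeomorphic_map (subtopology (mtop ?P) V) (subtopology (Euclidean_space (mdim ?P)) (\<phi> ` V)) \<phi>" if "c \<in> atlas ?P" for c
    using that main unfolding prod_manifold_atlas by (elim exE conjE) simp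
  ultimately show ?thesis unfolding charted_def by blast
qed

text \<open>Together with the smoothness of the group multiplication as a map on the product
  manifold this shows that pointwise products of plots are plots.\<close>

lemma plot_pair:
  assumes M: "charted M" and N: "charted N"
    and a: "plot (manifold_ds M) n U a" and b: "plot (manifold_ds N) n U b"
  shows "plot (manifold_ds (prod_manifold M N)) n U (\<lambda>x. (a x, b x))"
proof -
  let ?P = "prod_manifold M N"
  have P: "mtop ?P = prod_topology (mtop M) (mtop N)" "mdim ?P = mdim M + mdim N" by (auto simp: prod_manifold_def)
  note U = ds_open [OF diffeological_manifold [OF M] a]
  note ca = plot_manifold_continuous [OF M a] and cb = plot_manifold_continuous [OF N b]
  show ?thesis unfolding plot_manifold_iff [OF charted_prod [OF M N]]
  proof (intro conjI U ballI)
    show "continuous_map (subtopology (Euclidean_space n) U) (mtop ?P) (\<lambda>x. (a x, b x))"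
      unfolding P using ca cb by (rule continuous_map_pairedI)
    fix c assume "c \<in> atlas ?P"
    then obtain V \<phi> W \<psi> where V: "(V, \<phi>) \<in> atlas M" and W: "(W, \<psi>) \<in> atlas N"
      and c: "c = (V \<times> W, \<lambda>z. ejoin (mdim M) (\<phi> (fst z)) (\<psi> (snd z)))" unfolding prod_manifold_atlas by blast
    have "smooth_on n (U \<inter> a -` V) (mdim M) (\<lambda>x. \<phi> (a x))" "smooth_on n (U \<inter> b -` W) (mdim N) (\<lambda>x. \<psi> (b x))"
      using a b V W by (auto simp: plot_manifold_iff [OF M] plot_manifold_iff [OF N])
    then have "smooth_on n (U \<inter> (\<lambda>x. (a x, b x)) -` (V \<times> W)) (mdim M + mdim N) (\<lambda>x. ejoin (mdim M) (\<phi> (a x)) (\<psi> (b x)))"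
      by (intro smooth_on_ejoin; elim smooth_on_subset) auto
    then show "case c of (W, \<psi>) \<Rightarrow> smooth_on n (U \<inter> (\<lambda>x. (a x, b x)) -` W) (mdim ?P) (\<lambda>x. \<psi> (a x, b x))"
      by (simp add: c P)
  qed
qed

lemma charted_open_manifold:
  assumes "openin (Euclidean_space n) U" shows "charted (open_manifold n U)"
  using assms openin_subset [OF assms]
  by (auto simp: charted_def open_manifold_def topspace_subtopology_open openin_open_subtopology subtopology_subtopology
      intro: homeomorphic_map_id [THEN iffD2])

text \<open>This identifies the first component of a plot of \<open>U \<times> X\<close> with an
  ordinary smooth reparametrisation \<open>h\<close> into \<open>U\<close>, the form in which the
  functional diffeology is used.\<close>

lemma plot_open_manifold:
  assumes U: "openin (Euclidean_space n) U"
  shows "plot (manifold_ds (open_manifold n U)) m V h \<longleftrightarrow> openin (Euclidean_space m) V \<and> h \<in> V \<rightarrow> U \<and> smooth_on m V n h"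
proof -
  note c = charted_open_manifold [OF U]
  have o: "mtop (open_manifold n U) = subtopology (Euclidean_space n) U" "mdim (open_manifold n U) = n"
    "atlas (open_manifold n U) = {(U, id)}" by (auto simp: open_manifold_def)
  show ?thesis
  proof
    assume p: "plot (manifold_ds (open_manifold n U)) m V h"
    have V: "openin (Euclidean_space m) V" by (rule ds_open [OF diffeological_manifold [OF c] p])
    have h: "h \<in> V \<rightarrow> U"
      using ds_points [OF diffeological_manifold [OF c] p] by (auto simp: o)
    have "smooth_on m V n h"
      using plot_manifold_chart [OF c p, of U id] h by (simp add: o)
    then show "openin (Euclidean_space m) V \<and> h \<in> V \<rightarrow> U \<and> smooth_on m V n h" using V h by blast
  next
    assume a: "openin (Euclidean_space m) V \<and> h \<in> V \<rightarrow> U \<and> smooth_on m V n h"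
    then have "V \<inter> h -` U = V" by auto
    then show "plot (manifold_ds (open_manifold n U)) m V h"
      using a smooth_on_continuous [OF _ _ U, of m V h] unfolding plot_manifold_iff [OF c] by (simp add: o)
  qed
qed

section \<open>Constructions of diffeological spaces\<close>

lemma diffeological_prod:
  assumes X: "diffeological_space X" and Y: "diffeological_space Y"
  shows "diffeological_space (prod_ds X Y)"
proof (rule diffeological_spaceI)
  fix n U and \<alpha> :: "(nat \<Rightarrow> real) \<Rightarrow> 'a \<times> 'b"
  assume p: "plot (prod_ds X Y) n U \<alpha>"
  then have p1: "plot X n U (fst \<circ> \<alpha>)" and p2: "plot Y n U (snd \<circ> \<alpha>)" by (simp_all add: prod_ds_def)
  show "openin (Euclidean_space n) U" by (rule ds_open [OF X p1])
  show "\<alpha> x \<in> points (prod_ds X Y)" if "x \<in> U" for x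
    using ds_points [OF X p1 that] ds_points [OF Y p2 that] by (simp add: prod_ds_def mem_Times_iff)
  show "plot (prod_ds X Y) m V (\<lambda>x. \<alpha> (h x))"
    if "openin (Euclidean_space m) V" "h \<in> V \<rightarrow> U" "smooth_on m V n h" for m V h
    using ds_compose [OF X p1 that] ds_compose [OF Y p2 that] by (simp add: prod_ds_def o_def)
next
  fix n U and c :: "'a \<times> 'b" assume "openin (Euclidean_space n) U" "c \<in> points (prod_ds X Y)"
  then show "plot (prod_ds X Y) n U (\<lambda>_. c)"
    using ds_const [OF X] ds_const [OF Y] by (simp add: prod_ds_def o_def mem_Times_iff)
next
  fix n U and \<alpha> :: "(nat \<Rightarrow> real) \<Rightarrow> 'a \<times> 'b"
  assume U: "openin (Euclidean_space n) U"
    and loc: "\<And>x. x \<in> U \<Longrightarrow> \<exists>V \<beta>. x \<in> V \<and> V \<subseteq> U \<and> plot (prod_ds X Y) n V \<beta> \<and> (\<forall>y\<in>V. \<alpha> y = \<beta> y)"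
  have "plot X n U (\<lambda>x. fst (\<alpha> x))"
  proof (rule ds_local [OF X U])
    fix x assume "x \<in> U"
    then obtain V \<beta> where "x \<in> V" "V \<subseteq> U" "plot (prod_ds X Y) n V \<beta>" "\<forall>y\<in>V. \<alpha> y = \<beta> y" using loc by blast
    then show "\<exists>V \<beta>. x \<in> V \<and> V \<subseteq> U \<and> plot X n V \<beta> \<and> (\<forall>y\<in>V. fst (\<alpha> y) = \<beta> y)"
      by (intro exI [of _ V] exI [of _ "fst \<circ> \<beta>"]) (simp add: prod_ds_def)
  qed
  moreover have "plot Y n U (\<lambda>x. snd (\<alpha> x))"
  proof (rule ds_local [OF Y U])
    fix x assume "x \<in> U"
    then obtain V \<beta> where "x \<in> V" "V \<subseteq> U" "plot (prod_ds X Y) n V \<beta>" "\<forall>y\<in>V. \<alpha> y = \<beta> y" using loc by blast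
    then show "\<exists>V \<beta>. x \<in> V \<and> V \<subseteq> U \<and> plot Y n V \<beta> \<and> (\<forall>y\<in>V. snd (\<alpha> y) = \<beta> y)"
      by (intro exI [of _ V] exI [of _ "snd \<circ> \<beta>"]) (simp add: prod_ds_def)
  qed
  ultimately show "plot (prod_ds X Y) n U \<alpha>" by (simp add: prod_ds_def o_def)
qed

lemma diffeological_subset:
  assumes X: "diffeological_space X" and A: "A \<subseteq> points X"
  shows "diffeological_space (subset_ds X A)"
proof (rule diffeological_spaceI)
  fix n U \<alpha>
  assume p: "plot (subset_ds X A) n U \<alpha>"
  then have p1: "plot X n U \<alpha>" and p2: "\<alpha> \<in> U \<rightarrow> A" by (simp_all add: subset_ds_def)
  show "openin (Euclidean_space n) U" by (rule ds_open [OF X p1])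
  show "\<alpha> x \<in> points (subset_ds X A)" if "x \<in> U" for x
    using p2 that by (auto simp: subset_ds_def)
  show "plot (subset_ds X A) m V (\<lambda>x. \<alpha> (h x))"
    if "openin (Euclidean_space m) V" "h \<in> V \<rightarrow> U" "smooth_on m V n h" for m V h
    using ds_compose [OF X p1 that] p2 that(2) by (auto simp: subset_ds_def)
next
  fix n U c assume "openin (Euclidean_space n) U" "c \<in> points (subset_ds X A)"
  then show "plot (subset_ds X A) n U (\<lambda>_. c)"
    using ds_const [OF X] A by (auto simp: subset_ds_def)
next
  fix n U \<alpha>
  assume U: "openin (Euclidean_space n) U" and pts: "\<And>x. x \<in> U \<Longrightarrow> \<alpha> x \<in> points (subset_ds X A)"
    and loc: "\<And>x. x \<in> U \<Longrightarrow> \<exists>V \<beta>. x \<in> V \<and> V \<subseteq> U \<and> plot (subset_ds X A) n V \<beta> \<and> (\<forall>y\<in>V. \<alpha> y = \<beta> y)"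
  have "plot X n U \<alpha>"
  proof (rule ds_local [OF X U])
    fix x assume "x \<in> U"
    then obtain V \<beta> where "x \<in> V" "V \<subseteq> U" "plot (subset_ds X A) n V \<beta>" "\<forall>y\<in>V. \<alpha> y = \<beta> y" using loc by blast
    then show "\<exists>V \<beta>. x \<in> V \<and> V \<subseteq> U \<and> plot X n V \<beta> \<and> (\<forall>y\<in>V. \<alpha> y = \<beta> y)"
      by (intro exI [of _ V] exI [of _ \<beta>]) (simp add: subset_ds_def)
  qed
  then show "plot (subset_ds X A) n U \<alpha>" using pts by (simp add: subset_ds_def)
qed

lemma diffeological_quotient:
  assumes X: "diffeological_space X"
  shows "diffeological_space (quotient_ds X \<pi>)"
proof (rule diffeological_spaceI)
  fix n U \<alpha>
  assume "plot (quotient_ds X \<pi>) n U \<alpha>"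
  then have U: "openin (Euclidean_space n) U"
    and p: "\<And>x. x \<in> U \<Longrightarrow> \<exists>V \<beta>. x \<in> V \<and> V \<subseteq> U \<and> plot X n V \<beta> \<and> (\<forall>y\<in>V. \<alpha> y = \<pi> (\<beta> y))"
    by (simp_all add: quotient_ds_def)
  show "openin (Euclidean_space n) U" by (rule U)
  show "\<alpha> x \<in> points (quotient_ds X \<pi>)" if x: "x \<in> U" for x
  proof -
    obtain V \<beta> where "x \<in> V" "plot X n V \<beta>" "\<forall>y\<in>V. \<alpha> y = \<pi> (\<beta> y)" using p [OF x] by blast
    then show ?thesis using ds_points [OF X, of n V \<beta> x] by (simp add: quotient_ds_def)
  qed
  show "plot (quotient_ds X \<pi>) m V (\<lambda>x. \<alpha> (h x))"
    if V: "openin (Euclidean_space m) V" and h: "h \<in> V \<rightarrow> U" "smooth_on m V n h" for m V h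
  proof -
    have "\<exists>W \<beta>. x \<in> W \<and> W \<subseteq> V \<and> plot X m W \<beta> \<and> (\<forall>y\<in>W. \<alpha> (h y) = \<pi> (\<beta> y))" if x: "x \<in> V" for x
    proof -
      have "h x \<in> U" using h(1) x by blast
      from p [OF this] obtain V' \<beta> where b: "h x \<in> V'" "V' \<subseteq> U" "plot X n V' \<beta>" "\<forall>y\<in>V'. \<alpha> y = \<pi> (\<beta> y)"
        by blast
      have o: "openin (Euclidean_space m) (V \<inter> h -` V')"
        by (rule openin_subspace_preimage [OF V U smooth_on_continuous [OF h(2) V U h(1)] ds_open [OF X b(3)]])
      have "plot X m (V \<inter> h -` V') (\<lambda>x. \<beta> (h x))"
        by (rule ds_compose [OF X b(3) o _ smooth_on_subset [OF h(2)]]) auto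
      then show ?thesis using b x by (intro exI [of _ "V \<inter> h -` V'"] exI [of _ "\<lambda>x. \<beta> (h x)"]) auto
    qed
    then show ?thesis using V by (simp add: quotient_ds_def)
  qed
next
  fix n U c assume U: "openin (Euclidean_space n) U" and "c \<in> points (quotient_ds X \<pi>)"
  then obtain x where "x \<in> points X" "c = \<pi> x" by (auto simp: quotient_ds_def)
  then have "plot X n U (\<lambda>_. x)" "\<forall>y\<in>U. c = \<pi> x" using ds_const [OF X U] by auto
  then show "plot (quotient_ds X \<pi>) n U (\<lambda>_. c)" using U by (auto simp: quotient_ds_def)
next
  fix n U \<alpha>
  assume U: "openin (Euclidean_space n) U"
    and loc: "\<And>x. x \<in> U \<Longrightarrow> \<exists>V \<beta>. x \<in> V \<and> V \<subseteq> U \<and> plot (quotient_ds X \<pi>) n V \<beta> \<and> (\<forall>y\<in>V. \<alpha> y = \<beta> y)"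
  have "\<exists>W \<gamma>. x \<in> W \<and> W \<subseteq> U \<and> plot X n W \<gamma> \<and> (\<forall>y\<in>W. \<alpha> y = \<pi> (\<gamma> y))" if x: "x \<in> U" for x
  proof -
    obtain V \<beta> where V: "x \<in> V" "V \<subseteq> U" "plot (quotient_ds X \<pi>) n V \<beta>" "\<forall>y\<in>V. \<alpha> y = \<beta> y" using loc [OF x] by blast
    then obtain W \<gamma> where "x \<in> W" "W \<subseteq> V" "plot X n W \<gamma>" "\<forall>y\<in>W. \<beta> y = \<pi> (\<gamma> y)"
      by (auto simp: quotient_ds_def)
    then show ?thesis using V by (intro exI [of _ W] exI [of _ \<gamma>]) auto
  qed
  then show "plot (quotient_ds X \<pi>) n U \<alpha>" using U by (simp add: quotient_ds_def)
qed

text \<open>The generating family of the functional diffeology, which is already a diffeology.\<close>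

definition fplot :: "'a dspace \<Rightarrow> 'b dspace \<Rightarrow> nat \<Rightarrow> (nat \<Rightarrow> real) set \<Rightarrow> ((nat \<Rightarrow> real) \<Rightarrow> 'a \<Rightarrow> 'b) \<Rightarrow> bool" where
  "fplot X Y n U \<alpha> \<longleftrightarrow> openin (Euclidean_space n) U \<and> (\<forall>t\<in>U. \<alpha> t \<in> diff_maps X Y) \<and>
     (\<forall>m V h b. h \<in> V \<rightarrow> U \<longrightarrow> smooth_on m V n h \<longrightarrow> plot X m V b \<longrightarrow> plot Y m V (\<lambda>s. \<alpha> (h s) (b s)))"

lemma fplotD:
  assumes "fplot X Y n U \<alpha>"
  shows "openin (Euclidean_space n) U" "t \<in> U \<Longrightarrow> \<alpha> t \<in> diff_maps X Y"
    "h \<in> V \<rightarrow> U \<Longrightarrow> smooth_on m V n h \<Longrightarrow> plot X m V b \<Longrightarrow> plot Y m V (\<lambda>s. \<alpha> (h s) (b s))"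
  using assms by (auto simp: fplot_def)

text \<open>A plot of the product of \<open>U\<close> and \<open>X\<close> is a pair of a smooth
  \<open>h\<close> and a plot \<open>b\<close> on the same domain, so testing the uncurried map on
  such plots is the last clause of \<open>fplot\<close>.\<close>

lemma fplot_iff:
  assumes X: "diffeological_space X"
  shows "fplot X Y n U \<alpha> \<longleftrightarrow> openin (Euclidean_space n) U \<and> \<alpha> \<in> U \<rightarrow> diff_maps X Y \<and>
          ds_differentiable (prod_ds (manifold_ds (open_manifold n U)) X) Y (\<lambda>(t, x). \<alpha> t x)"
    (is "?l \<longleftrightarrow> ?r")
proof
  assume l: ?l
  note U = fplotD(1) [OF l]
  have "ds_differentiable (prod_ds (manifold_ds (open_manifold n U)) X) Y (\<lambda>(t, x). \<alpha> t x)"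
  proof (rule ds_differentiableI)
    fix z assume "z \<in> points (prod_ds (manifold_ds (open_manifold n U)) X)"
    then have "fst z \<in> U" "snd z \<in> points X"
      by (auto simp: prod_ds_def open_manifold_def)
    then show "(case z of (t, x) \<Rightarrow> \<alpha> t x) \<in> points Y"
      using fplotD(2) [OF l, of "fst z"] by (auto simp: diff_maps_def case_prod_unfold)
  next
    fix m V \<gamma> assume "plot (prod_ds (manifold_ds (open_manifold n U)) X) m V \<gamma>"
    then have 1: "plot (manifold_ds (open_manifold n U)) m V (fst \<circ> \<gamma>)" and 2: "plot X m V (snd \<circ> \<gamma>)"
      by (simp_all add: prod_ds_def)
    show "plot Y m V (\<lambda>x. case \<gamma> x of (t, x) \<Rightarrow> \<alpha> t x)"
      using fplotD(3) [OF l _ _ 2, of "fst \<circ> \<gamma>"] 1 by (simp add: plot_open_manifold [OF U] case_prod_unfold)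
  qed
  then show ?r using U fplotD(2) [OF l] by blast
next
  assume r: ?r
  then have U: "openin (Euclidean_space n) U"
    and d: "ds_differentiable (prod_ds (manifold_ds (open_manifold n U)) X) Y (\<lambda>(t, x). \<alpha> t x)" by auto
  have "plot Y m V (\<lambda>s. \<alpha> (h s) (b s))" if "h \<in> V \<rightarrow> U" "smooth_on m V n h" "plot X m V b" for m V h b
  proof -
    have "plot (prod_ds (manifold_ds (open_manifold n U)) X) m V (\<lambda>s. (h s, b s))"
      using that ds_open [OF X that(3)] by (simp add: prod_ds_def plot_open_manifold [OF U] o_def)
    from ds_differentiableD [OF d this] show ?thesis by simp
  qed
  then show ?l using r by (auto simp: fplot_def)
qed

lemma diff_mapsD: "f \<in> diff_maps X Y \<Longrightarrow> x \<in> points X \<Longrightarrow> f x \<in> points Y"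
  "f \<in> diff_maps X Y \<Longrightarrow> ds_differentiable X Y f"
  by (auto simp: diff_maps_def)

text \<open>Since \<open>fplot\<close> quantifies over all reparametrisations \<open>h\<close>,
  closure under composition amounts to composing with \<open>h\<close> once more. For locality the
  pieces of the domain are pulled back along \<open>h\<close> and the locality of \<open>Y\<close>
  is used.\<close>

lemma diffeological_fplot:
  assumes X: "diffeological_space X" and Y: "diffeological_space Y"
  shows "diffeological_space \<lparr>points = diff_maps X Y, plot = fplot X Y\<rparr>" (is "diffeological_space ?D")
proof (rule diffeological_spaceI)
  fix n U \<alpha>
  assume "plot ?D n U \<alpha>"
  then have p: "fplot X Y n U \<alpha>" by simp
  show "openin (Euclidean_space n) U" by (rule fplotD(1) [OF p])
  show "\<alpha> x \<in> points ?D" if "x \<in> U" for x using fplotD(2) [OF p that] by simp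
  show "plot ?D m V (\<lambda>x. \<alpha> (h x))"
    if V: "openin (Euclidean_space m) V" and h: "h \<in> V \<rightarrow> U" "smooth_on m V n h" for m V h
  proof -
    have "plot Y k W (\<lambda>s. \<alpha> (h (g s)) (b s))" if g: "g \<in> W \<rightarrow> V" "smooth_on k W m g" and b: "plot X k W b" for k W g b
    proof -
      have hg: "smooth_on k W n (\<lambda>s. h (g s))" by (rule smooth_on_compose [OF ds_open [OF X b] V g h(2)])
      show ?thesis by (rule fplotD(3) [OF p _ hg b]) (use g h in auto)
    qed
    moreover have "\<alpha> (h t) \<in> diff_maps X Y" if "t \<in> V" for t
      by (rule fplotD(2) [OF p]) (use h(1) that in blast)
    ultimately show ?thesis using V by (simp add: fplot_def)
  qed
next
  fix n U c assume "openin (Euclidean_space n) U" "c \<in> points ?D"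
  then show "plot ?D n U (\<lambda>_. c)" using ds_differentiableD [OF diff_mapsD(2) [of c X Y]] by (simp add: fplot_def)
next
  fix n U \<alpha>
  assume U: "openin (Euclidean_space n) U" and pts: "\<And>x. x \<in> U \<Longrightarrow> \<alpha> x \<in> points ?D"
    and loc: "\<And>x. x \<in> U \<Longrightarrow> \<exists>V \<beta>. x \<in> V \<and> V \<subseteq> U \<and> plot ?D n V \<beta> \<and> (\<forall>y\<in>V. \<alpha> y = \<beta> y)"
  have "plot Y m W (\<lambda>s. \<alpha> (h s) (b s))" if h: "h \<in> W \<rightarrow> U" "smooth_on m W n h" and b: "plot X m W b" for m W h b
  proof (rule ds_local [OF Y])
    show W: "openin (Euclidean_space m) W" by (rule ds_open [OF X b])
    fix s assume s: "s \<in> W"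
    then have "h s \<in> U" using h(1) by blast
    from loc [OF this] obtain V \<beta> where V: "h s \<in> V" "V \<subseteq> U" "plot ?D n V \<beta>" "\<forall>y\<in>V. \<alpha> y = \<beta> y" by blast
    then have p: "fplot X Y n V \<beta>" by simp
    have o: "openin (Euclidean_space m) (W \<inter> h -` V)"
      by (rule openin_subspace_preimage [OF W U smooth_on_continuous [OF h(2) W U h(1)] fplotD(1) [OF p]])
    have "plot Y m (W \<inter> h -` V) (\<lambda>s. \<beta> (h s) (b s))"
      by (rule fplotD(3) [OF p _ smooth_on_subset [OF h(2)] ds_subset [OF X b o]]) auto
    then show "\<exists>V \<gamma>. s \<in> V \<and> V \<subseteq> W \<and> plot Y m V \<gamma> \<and> (\<forall>y\<in>V. \<alpha> (h y) (b y) = \<gamma> y)"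
      using s V(1,4) by (intro exI [of _ "W \<inter> h -` V"] exI [of _ "\<lambda>s. \<beta> (h s) (b s)"]) auto
  qed
  then show "plot ?D n U \<alpha>" using U pts by (simp add: fplot_def)
qed

text \<open>The generated diffeology is an intersection, and by the preceding lemma the generating
  family is itself one of the diffeologies that are intersected.\<close>

lemma plot_functional:
  assumes X: "diffeological_space X" and Y: "diffeological_space Y"
  shows "plot (functional_ds X Y) n U \<alpha> \<longleftrightarrow> fplot X Y n U \<alpha>"
proof -
  have "functional_ds X Y = generated_ds (diff_maps X Y) (fplot X Y)"
    unfolding functional_ds_def
    by (rule arg_cong [where f = "generated_ds (diff_maps X Y)"]) (intro ext, rule fplot_iff [OF X, symmetric])
  then have *: "plot (functional_ds X Y) n U \<alpha> \<longleftrightarrow> (\<forall>Z. diffeological_space Z \<and> points Z = diff_maps X Y \<and>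
               (\<forall>m V \<beta>. fplot X Y m V \<beta> \<longrightarrow> plot Z m V \<beta>) \<longrightarrow> plot Z n U \<alpha>)"
    by (simp add: generated_ds_def)
  show ?thesis
  proof
    assume "plot (functional_ds X Y) n U \<alpha>"
    from spec [OF this [unfolded *], of "\<lparr>points = diff_maps X Y, plot = fplot X Y\<rparr>"]
    show "fplot X Y n U \<alpha>" using diffeological_fplot [OF X Y] by simp
  next
    assume "fplot X Y n U \<alpha>"
    then show "plot (functional_ds X Y) n U \<alpha>" unfolding * by blast
  qed
qed

lemma diffeological_functional:
  assumes X: "diffeological_space X" and Y: "diffeological_space Y"
  shows "diffeological_space (functional_ds X Y)"
proof -
  have "plot (functional_ds X Y) = fplot X Y" by (intro ext) (rule plot_functional [OF X Y])
  moreover have "points (functional_ds X Y) = diff_maps X Y" by (simp add: functional_ds_def generated_ds_def)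
  ultimately have "functional_ds X Y = \<lparr>points = diff_maps X Y, plot = fplot X Y\<rparr>"
    by (intro dspace.equality) auto
  then show ?thesis using diffeological_fplot [OF X Y] by simp
qed

section \<open>Groups of diffeomorphisms\<close>

lemma Diff_subset_diff_maps: "Diff X \<subseteq> diff_maps X X"
  by (auto simp: Diff_def diff_maps_def diffeomorphism_def Bij_def bij_betw_def PiE_def)

lemma diffeological_Diff:
  assumes "diffeological_space X" shows "diffeological_space (Diff_ds X)"
  unfolding Diff_ds_def
proof (rule diffeological_subset [OF diffeological_functional [OF assms assms]])
  have "points (functional_ds X X) = diff_maps X X" by (simp add: functional_ds_def generated_ds_def)
  then show "Diff X \<subseteq> points (functional_ds X X)" using Diff_subset_diff_maps by simp
qed

text \<open>A plot puts a joint condition on the maps \<open>\<alpha> t\<close> but none on the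
  family of their inverses; for cosets that is supplied by \<open>inverse_family\<close>.\<close>

lemma plot_Diff:
  assumes "diffeological_space X"
  shows "plot (Diff_ds X) n U \<alpha> \<longleftrightarrow> openin (Euclidean_space n) U \<and> (\<forall>t\<in>U. \<alpha> t \<in> Diff X) \<and>
     (\<forall>m V h b. h \<in> V \<rightarrow> U \<longrightarrow> smooth_on m V n h \<longrightarrow> plot X m V b \<longrightarrow> plot X m V (\<lambda>s. \<alpha> (h s) (b s)))"
proof -
  have "plot (Diff_ds X) n U \<alpha> \<longleftrightarrow> fplot X X n U \<alpha> \<and> \<alpha> \<in> U \<rightarrow> Diff X"
    by (simp add: Diff_ds_def subset_ds_def plot_functional [OF assms assms])
  moreover have "\<alpha> \<in> U \<rightarrow> Diff X \<longleftrightarrow> (\<forall>t\<in>U. \<alpha> t \<in> Diff X)" by blast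
  moreover have "(\<forall>t\<in>U. \<alpha> t \<in> Diff X) \<Longrightarrow> (\<forall>t\<in>U. \<alpha> t \<in> diff_maps X X)"
    using Diff_subset_diff_maps by blast
  ultimately show ?thesis unfolding fplot_def by argo
qed

lemma plot_DiffD:
  assumes "diffeological_space X" "plot (Diff_ds X) n U \<alpha>"
  shows "openin (Euclidean_space n) U" "t \<in> U \<Longrightarrow> \<alpha> t \<in> Diff X"
    "h \<in> V \<rightarrow> U \<Longrightarrow> smooth_on m V n h \<Longrightarrow> plot X m V b \<Longrightarrow> plot X m V (\<lambda>s. \<alpha> (h s) (b s))"
proof -
  note p = assms(2) [unfolded plot_Diff [OF assms(1)]]
  show "openin (Euclidean_space n) U" by (rule conjunct1 [OF p])
  show "t \<in> U \<Longrightarrow> \<alpha> t \<in> Diff X" by (rule bspec [OF conjunct1 [OF conjunct2 [OF p]]])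
  show "h \<in> V \<rightarrow> U \<Longrightarrow> smooth_on m V n h \<Longrightarrow> plot X m V b \<Longrightarrow> plot X m V (\<lambda>s. \<alpha> (h s) (b s))"
    by (rule conjunct2 [OF conjunct2 [OF p], rule_format])
qed

lemma DiffD:
  assumes "f \<in> Diff X"
  shows "bij_betw f (points X) (points X)" "f \<in> extensional (points X)"
    "ds_differentiable X X f" "ds_differentiable X X (inv_into (points X) f)"
  using assms by (auto simp: Diff_def Bij_def diffeomorphism_def)

text \<open>A two-sided inverse \<open>g\<close> stands in for \<open>inv_into\<close>, with which
  it agrees on \<open>points X\<close> only.\<close>

lemma DiffI:
  assumes "f \<in> extensional (points X)" "ds_differentiable X X f" "ds_differentiable X X g"
    "\<And>x. x \<in> points X \<Longrightarrow> g (f x) = x" "\<And>x. x \<in> points X \<Longrightarrow> f (g x) = x"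
    and diffeological_X: "diffeological_space X"
  shows "f \<in> Diff X"
proof -
  have fg: "f \<in> points X \<rightarrow> points X" "g \<in> points X \<rightarrow> points X"
    using assms(2,3) by (auto simp: ds_differentiable_def)
  have b: "bij_betw f (points X) (points X)"
    by (rule bij_betw_byWitness [where f' = g]) (use assms fg in auto)
  have inv: "inv_into (points X) f x = g x" if "x \<in> points X" for x
    using b fg(2) that assms(5) by (metis bij_betw_imp_inj_on inv_into_f_f funcset_mem)
  have "ds_differentiable X X (inv_into (points X) f)"
  proof (rule ds_differentiableI)
    show "inv_into (points X) f x \<in> points X" if "x \<in> points X" for x
      using inv [OF that] fg(2) that by auto
    show "plot X n U (\<lambda>x. inv_into (points X) f (\<alpha> x))" if p: "plot X n U \<alpha>" for n U \<alpha>
      by (rule ds_cong [OF diffeological_X ds_differentiableD [OF assms(3) p]]) (use inv ds_points [OF diffeological_X p] in auto)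
  qed
  then show ?thesis using b assms(1,2) by (simp add: Diff_def Bij_def diffeomorphism_def)
qed

lemma inv_into_Diff:
  assumes diffeological_X: "diffeological_space X" and f: "f \<in> Diff X"
  shows "(\<lambda>x\<in>points X. inv_into (points X) f x) \<in> Diff X"
proof (rule DiffI [OF _ _ DiffD(3) [OF f] _ _ diffeological_X])
  note b = DiffD(1) [OF f]
  let ?g = "\<lambda>x\<in>points X. inv_into (points X) f x"
  show "?g \<in> extensional (points X)" by simp
  show "f (?g x) = x" if "x \<in> points X" for x using b that by (simp add: bij_betw_inv_into_right)
  show "?g (f x) = x" if "x \<in> points X" for x
    using b that by (simp add: bij_betw_inv_into_left bij_betw_apply)
  show "ds_differentiable X X ?g"
  proof (rule ds_differentiableI)
    show "?g x \<in> points X" if "x \<in> points X" for x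
      using that b by (simp add: bij_betw_apply [OF bij_betw_inv_into])
    show "plot X n U (\<lambda>x. ?g (\<alpha> x))" if p: "plot X n U \<alpha>" for n U \<alpha>
      by (rule ds_cong [OF diffeological_X ds_differentiableD [OF DiffD(4) [OF f] p]]) (simp add: ds_points [OF diffeological_X p])
  qed
qed

lemma compose_Diff:
  assumes diffeological_X: "diffeological_space X" and f: "f \<in> Diff X" and g: "g \<in> Diff X"
  shows "compose (points X) f g \<in> Diff X"
proof (rule DiffI [OF _ _ _ _ _ diffeological_X])
  let ?h = "\<lambda>x. inv_into (points X) g (inv_into (points X) f x)"
  note bf = DiffD(1) [OF f] and bg = DiffD(1) [OF g]
  show "compose (points X) f g \<in> extensional (points X)" by simp
  show "ds_differentiable X X (compose (points X) f g)"
  proof (rule ds_differentiableI)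
    show "compose (points X) f g x \<in> points X" if "x \<in> points X" for x
      using that bf bg by (simp add: compose_def bij_betw_apply)
    show "plot X n U (\<lambda>x. compose (points X) f g (\<alpha> x))" if p: "plot X n U \<alpha>" for n U \<alpha>
      by (rule ds_cong [OF diffeological_X ds_differentiableD [OF DiffD(3) [OF f] ds_differentiableD [OF DiffD(3) [OF g] p]]])
        (simp add: compose_def ds_points [OF diffeological_X p])
  qed
  show "ds_differentiable X X ?h"
  proof (rule ds_differentiableI)
    show "?h x \<in> points X" if "x \<in> points X" for x
      using that bf bg by (simp add: bij_betw_apply [OF bij_betw_inv_into])
    show "plot X n U (\<lambda>x. ?h (\<alpha> x))" if p: "plot X n U \<alpha>" for n U \<alpha>
      by (rule ds_differentiableD [OF DiffD(4) [OF g] ds_differentiableD [OF DiffD(4) [OF f] p]])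
  qed
  show "?h (compose (points X) f g x) = x" if "x \<in> points X" for x
    using that bf bg by (simp add: compose_def bij_betw_inv_into_left bij_betw_apply)
  show "compose (points X) f g (?h x) = x" if "x \<in> points X" for x
    using that bf bg by (simp add: compose_def bij_betw_inv_into_right bij_betw_apply [OF bij_betw_inv_into])
qed

lemma Diff_subgroup:
  assumes diffeological_X: "diffeological_space X"
  shows "subgroup (Diff X) (BijGroup (points X))"
proof (rule group.subgroupI [OF group_BijGroup])
  show "Diff X \<subseteq> carrier (BijGroup (points X))" by (auto simp: Diff_def BijGroup_def)
  have "(\<lambda>x\<in>points X. x) \<in> Diff X"
  proof (rule DiffI [where g = "\<lambda>x. x", OF _ _ _ _ _ diffeological_X])
    show "ds_differentiable X X (\<lambda>x\<in>points X. x)"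
    proof (rule ds_differentiableI)
      show "plot X n U (\<lambda>x. (\<lambda>x\<in>points X. x) (\<alpha> x))" if p: "plot X n U \<alpha>" for n U \<alpha>
        by (rule ds_cong [OF diffeological_X p]) (simp add: ds_points [OF diffeological_X p])
    qed auto
  qed (auto simp: ds_differentiable_def o_def)
  then show "Diff X \<noteq> {}" by blast
  fix f g assume f: "f \<in> Diff X" and g: "g \<in> Diff X"
  then have fB: "f \<in> Bij (points X)" and gB: "g \<in> Bij (points X)" by (auto simp: Diff_def)
  show "inv\<^bsub>BijGroup (points X)\<^esub> f \<in> Diff X"
    using inv_into_Diff [OF diffeological_X f] by (simp add: inv_BijGroup [OF fB])
  show "f \<otimes>\<^bsub>BijGroup (points X)\<^esub> g \<in> Diff X"
    using compose_Diff [OF diffeological_X f g] fB gB by (simp add: BijGroup_def)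
qed

lemma group_Diff_group: "diffeological_space X \<Longrightarrow> group (Diff_group X)"
  unfolding Diff_group_def using subgroup.subgroup_is_group [OF Diff_subgroup group_BijGroup] by blast

lemma Diff_group_simps:
  assumes "diffeological_space X"
  shows "carrier (Diff_group X) = Diff X" "\<one>\<^bsub>Diff_group X\<^esub> = (\<lambda>x\<in>points X. x)"
    "f \<in> Diff X \<Longrightarrow> g \<in> Diff X \<Longrightarrow> f \<otimes>\<^bsub>Diff_group X\<^esub> g = compose (points X) f g"
    "f \<in> Diff X \<Longrightarrow> inv\<^bsub>Diff_group X\<^esub> f = (\<lambda>x\<in>points X. inv_into (points X) f x)"
proof -
  have sub: "Diff X \<subseteq> Bij (points X)" by (auto simp: Diff_def)
  show "carrier (Diff_group X) = Diff X" "\<one>\<^bsub>Diff_group X\<^esub> = (\<lambda>x\<in>points X. x)"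
    by (simp_all add: Diff_group_def BijGroup_def)
  show "f \<in> Diff X \<Longrightarrow> g \<in> Diff X \<Longrightarrow> f \<otimes>\<^bsub>Diff_group X\<^esub> g = compose (points X) f g"
    using sub by (auto simp: Diff_group_def BijGroup_def)
  show "inv\<^bsub>Diff_group X\<^esub> f = (\<lambda>x\<in>points X. inv_into (points X) f x)" if f: "f \<in> Diff X"
  proof -
    have "inv\<^bsub>Diff_group X\<^esub> f = inv\<^bsub>BijGroup (points X)\<^esub> f"
      unfolding Diff_group_def using group.m_inv_consistent [OF group_BijGroup Diff_subgroup [OF assms] f] .
    then show ?thesis using inv_BijGroup sub f by auto
  qed
qed

section \<open>Lifting plots of diffeomorphisms of the quotient\<close>

lemma pathin_proj:
  assumes "pathin (prod_topology X Y) p"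
  shows "pathin X (\<lambda>t. fst (p t))" "pathin Y (\<lambda>t. snd (p t))"
  using continuous_map_compose [OF assms [unfolded pathin_def] continuous_map_fst]
    continuous_map_compose [OF assms [unfolded pathin_def] continuous_map_snd]
  by (simp_all add: pathin_def o_def)

lemma simply_connected_spaceD:
  assumes "simply_connected_space X" "pathin X p" "p 0 = p 1"
  shows "homotopic_with (\<lambda>q. q 0 = p 0 \<and> q 1 = p 0) (top_of_set {0..1}) X p (\<lambda>_. p 0)"
  using assms unfolding simply_connected_space_def by blast

lemma simply_connected_prod:
  assumes X: "simply_connected_space X" and Y: "simply_connected_space Y"
  shows "simply_connected_space (prod_topology X Y)"
  unfolding simply_connected_space_def
proof (intro conjI allI impI)
  show "path_connected_space (prod_topology X Y)"
    using X Y by (simp add: path_connected_space_prod_topology simply_connected_space_def)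
  fix p assume "pathin (prod_topology X Y) p \<and> p 0 = p 1"
  then have p: "pathin (prod_topology X Y) p" "p 0 = p 1" by auto
  let ?I = "top_of_set {0..1::real}"
  have "homotopic_with (\<lambda>q. q 0 = fst (p 0) \<and> q 1 = fst (p 0)) ?I X (\<lambda>t. fst (p t)) (\<lambda>_. fst (p 0))"
    by (rule simply_connected_spaceD [OF X pathin_proj(1) [OF p(1)]]) (rule arg_cong [OF p(2)])
  then obtain h where h: "continuous_map (prod_topology ?I ?I) X h" "\<forall>x. h (0, x) = fst (p x)" "\<forall>x. h (1, x) = fst (p 0)"
    "\<forall>t\<in>{0..1}. h (t, 0) = fst (p 0) \<and> h (t, 1) = fst (p 0)" unfolding homotopic_with_def by (elim exE conjE)
  have "homotopic_with (\<lambda>q. q 0 = snd (p 0) \<and> q 1 = snd (p 0)) ?I Y (\<lambda>t. snd (p t)) (\<lambda>_. snd (p 0))"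
    by (rule simply_connected_spaceD [OF Y pathin_proj(2) [OF p(1)]]) (rule arg_cong [OF p(2)])
  then obtain k where k: "continuous_map (prod_topology ?I ?I) Y k" "\<forall>x. k (0, x) = snd (p x)" "\<forall>x. k (1, x) = snd (p 0)"
    "\<forall>t\<in>{0..1}. k (t, 0) = snd (p 0) \<and> k (t, 1) = snd (p 0)" unfolding homotopic_with_def by (elim exE conjE)
  show "homotopic_with (\<lambda>q. q 0 = p 0 \<and> q 1 = p 0) ?I (prod_topology X Y) p (\<lambda>_. p 0)"
    unfolding homotopic_with_def
  proof (intro exI [of _ "\<lambda>z. (h z, k z)"] conjI allI ballI)
    show "continuous_map (prod_topology ?I ?I) (prod_topology X Y) (\<lambda>z. (h z, k z))"
      using h(1) k(1) by (rule continuous_map_pairedI)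
  qed (use h k in auto)
qed

lemma convex_ebox:
  assumes "y \<in> ebox n x e" "z \<in> ebox n x e" "s \<in> {0..1}"
  shows "(\<lambda>i. (1 - s) * y i + s * z i) \<in> ebox n x e"
proof -
  have "\<bar>(1 - s) * y i + s * z i - x i\<bar> < e" if "i < n" for i
  proof -
    have "y i \<in> ball (x i) e" "z i \<in> ball (x i) e"
      using assms that by (auto simp: ebox_def dist_real_def abs_minus_commute)
    then have "(1 - s) *\<^sub>R y i + s *\<^sub>R z i \<in> ball (x i) e"
      using assms(3) by (intro convexD [OF convex_ball]) auto
    then show ?thesis by (simp add: dist_real_def abs_minus_commute)
  qed
  then show ?thesis using assms by (auto simp: ebox_def topspace_Euclidean_space)
qed

lemma simply_connected_ebox:
  assumes "x \<in> topspace (Euclidean_space n)"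
  shows "simply_connected_space (subtopology (Euclidean_space n) (ebox n x e))"
  unfolding simply_connected_space_def
proof (intro conjI allI impI)
  let ?B = "subtopology (Euclidean_space n) (ebox n x e)"
  let ?I = "top_of_set {0..1::real}"
  show "path_connected_space ?B" using path_connectedin_ebox [OF assms] by (simp add: path_connectedin_def)
  fix p assume "pathin ?B p \<and> p 0 = p 1"
  then have p: "pathin ?B p" "p 0 = p 1" by auto
  have pin: "p t \<in> ebox n x e" if "t \<in> {0..1}" for t using p(1) that by (auto simp: pathin_subtopology)
  have pc: "continuous_map ?I euclideanreal (\<lambda>t. p t i)" if "i < n" for i
    using p(1) that unfolding pathin_def continuous_map_into_Euclidean by blast
  show "homotopic_with (\<lambda>q. q 0 = p 0 \<and> q 1 = p 0) ?I ?B p (\<lambda>_. p 0)"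
    unfolding homotopic_with_def
  \<comment> \<open>The straight-line contraction to \<open>p 0\<close>. It keeps both ends fixed
    because the loop begins and ends there, and it stays in the box by convexity.\<close>
  proof (intro exI [of _ "\<lambda>z i. (1 - fst z) * p (snd z) i + fst z * p 0 i"] conjI allI ballI)
    show "continuous_map (prod_topology ?I ?I) ?B (\<lambda>z i. (1 - fst z) * p (snd z) i + fst z * p 0 i)"
      unfolding continuous_map_into_Euclidean
    proof (intro conjI allI impI)
      fix i assume i: "i < n"
      have 1: "continuous_map (prod_topology ?I ?I) euclideanreal fst"
        using continuous_map_fst [of ?I ?I] by (simp add: continuous_map_in_subtopology)
      have 2: "continuous_map (prod_topology ?I ?I) euclideanreal (\<lambda>z. p (snd z) i)"
        using continuous_map_compose [OF continuous_map_snd [of ?I ?I] pc [OF i]] by (simp only: o_def)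
      show "continuous_map (prod_topology ?I ?I) euclideanreal (\<lambda>z. (1 - fst z) * p (snd z) i + fst z * p 0 i)"
        by (intro continuous_map_add continuous_map_real_mult continuous_map_diff 1 2 continuous_map_const [THEN iffD2]) auto
    next
      show "(\<lambda>z i. (1 - fst z) * p (snd z) i + fst z * p 0 i) \<in> topspace (prod_topology ?I ?I) \<rightarrow> ebox n x e \<inter> topspace (Euclidean_space n)"
      proof
        fix z assume "z \<in> topspace (prod_topology ?I ?I)"
        then have "fst z \<in> {0..1}" "snd z \<in> {0..1}" by (simp_all add: mem_Times_iff)
        then have "(\<lambda>i. (1 - fst z) * p (snd z) i + fst z * p 0 i) \<in> ebox n x e"
          using pin by (intro convex_ebox) auto
        then show "(\<lambda>i. (1 - fst z) * p (snd z) i + fst z * p 0 i) \<in> ebox n x e \<inter> topspace (Euclidean_space n)"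
          using ebox_sub by auto
      qed
    qed
  qed (use p(2) in \<open>auto simp: algebra_simps\<close>)
qed

lemma locally_path_connected_manifold:
  assumes M: "charted M"
  shows "locally_path_connected_space (mtop M)"
  unfolding locally_path_connected_space
proof (intro allI impI)
  fix Z x assume "openin (mtop M) Z \<and> x \<in> Z"
  then have Z: "openin (mtop M) Z" "x \<in> Z" by auto
  have "x \<in> topspace (mtop M)" using openin_subset [OF Z(1)] Z(2) by blast
  then obtain V \<phi> where V: "(V, \<phi>) \<in> atlas M" "x \<in> V" using chart_at [OF M] by blast
  let ?E = "Euclidean_space (mdim M)"
  have "openin (subtopology (mtop M) V) (V \<inter> Z)" using Z(1) by (rule openin_subtopology_Int2)
  then have "openin (subtopology ?E (\<phi> ` V)) (\<phi> ` (V \<inter> Z))"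
    using homeomorphic_map_openness_eq [OF chart_homeo [OF M V(1)]] by blast
  then have "openin ?E (\<phi> ` (V \<inter> Z))" using openin_trans_full [OF _ chart_image_open [OF M V(1)]] by blast
  then obtain e where e: "e > 0" "ebox (mdim M) (\<phi> x) e \<subseteq> \<phi> ` (V \<inter> Z)"
    using openin_contains_ebox V(2) Z(2) by (metis IntI imageI)
  let ?B = "ebox (mdim M) (\<phi> x) e"
  have "\<phi> x \<in> \<phi> ` V" using V(2) by blast
  then have top: "\<phi> x \<in> topspace ?E" using openin_subset [OF chart_image_open [OF M V(1)]] by blast
  have Bsub: "?B \<subseteq> \<phi> ` V" using e(2) by blast
  define U where "U = V \<inter> \<phi> -` ?B"
  have Ueq: "U = inv_into V \<phi> ` ?B"
  proof
    show "U \<subseteq> inv_into V \<phi> ` ?B"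
    proof
      fix u assume "u \<in> U"
      then show "u \<in> inv_into V \<phi> ` ?B"
        using inv_into_f_f [OF chart_inj [OF M V(1)], of u] by (intro image_eqI [of _ _ "\<phi> u"]) (auto simp: U_def)
    qed
    show "inv_into V \<phi> ` ?B \<subseteq> U"
      using Bsub by (auto simp: U_def inv_into_into f_inv_into_f subset_iff)
  qed
  have "openin (mtop M) U" unfolding U_def
    by (rule openin_subspace_preimage [OF chart_open [OF M V(1)] chart_image_open [OF M V(1)] chart_continuous [OF M V(1)] openin_ebox])
  moreover have "path_connectedin (mtop M) U"
  proof -
    have "path_connectedin (subtopology ?E (\<phi> ` V)) ?B"
      using path_connectedin_ebox [OF top] Bsub by (simp add: path_connectedin_subtopology)
    from path_connectedin_continuous_map_image [OF chart_inv_continuous [OF M V(1)] this]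
    show ?thesis unfolding Ueq by (simp add: path_connectedin_subtopology)
  qed
  moreover have "x \<in> U" using V(2) ebox_self [OF top e(1)] by (simp add: U_def)
  moreover have "U \<subseteq> Z"
  proof
    fix u assume "u \<in> U"
    then have "u \<in> V" "\<phi> u \<in> \<phi> ` (V \<inter> Z)" using e(2) by (auto simp: U_def)
    then show "u \<in> Z" using inj_onD [OF chart_inj [OF M V(1)]] by auto
  qed
  ultimately show "\<exists>U. openin (mtop M) U \<and> path_connectedin (mtop M) U \<and> x \<in> U \<and> U \<subseteq> Z" by blast
qed

section \<open>Plots of the Lie group and of the space of cosets\<close>

locale lie_pair = group G for G (structure) +
  fixes M :: "'a manifold" and \<Gamma> :: "'a set"
  assumes lie: "lie_group G M"
    and conn: "connected_space (mtop M)"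
    and sc: "simply_connected_space (mtop M)"
    and subgrp: "subgroup \<Gamma> G"
    and tdc: "totally_disconnected_space (subtopology (mtop M) \<Gamma>)"
    and dense: "mtop M closure_of \<Gamma> = topspace (mtop M)"
begin

abbreviation "P \<equiv> manifold_ds M"
abbreviation "X \<equiv> coset_ds G M \<Gamma>"

lemma smooth_manifold_M: "smooth_manifold M" and topspace_M: "topspace (mtop M) = carrier G"
  and smooth_mult: "smooth_map (prod_manifold M M) M (\<lambda>(x, y). x \<otimes> y)" and smooth_inv: "smooth_map M M (\<lambda>x. inv x)"
  using lie by (simp_all add: lie_group_def)

lemma charted_M: "charted M" by (rule smooth_manifold_charted [OF smooth_manifold_M])

lemma diffeological_P: "diffeological_space P" by (rule diffeological_manifold [OF charted_M])

lemma diffeological_X: "diffeological_space X" unfolding coset_ds_def by (rule diffeological_quotient [OF diffeological_P])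

lemma points_P: "points P = carrier G" by (simp add: topspace_M)

sublocale disconnected_fibres G "mtop M" \<Gamma>
proof (intro disconnected_fibres.intro disconnected_fibres_axioms.intro)
  show "continuous_map (prod_topology (mtop M) (mtop M)) (mtop M) (\<lambda>(x, y). x \<otimes> y)"
    using smooth_mult by (simp add: smooth_map_def prod_manifold_def)
  show "continuous_map (mtop M) (mtop M) (\<lambda>x. inv x)"
    using smooth_inv by (simp add: smooth_map_def)
qed (rule is_group topspace_M subgrp tdc)+

lemma plot_carrier: "plot P n U a \<Longrightarrow> x \<in> U \<Longrightarrow> a x \<in> carrier G"
  using ds_points [OF diffeological_P, of n U a x] points_P by simp

lemma plot_mult:
  assumes "plot P n U a" "plot P n U b" shows "plot P n U (\<lambda>x. a x \<otimes> b x)"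
  using ds_differentiableD [OF smooth_map_imp_ds [OF charted_prod [OF charted_M charted_M] charted_M smooth_mult] plot_pair [OF charted_M charted_M assms]]
  by simp

lemma plot_inv: "plot P n U a \<Longrightarrow> plot P n U (\<lambda>x. inv (a x))"
  by (rule ds_differentiableD [OF smooth_map_imp_ds [OF charted_M charted_M smooth_inv]])

lemma plot_const: "openin (Euclidean_space n) U \<Longrightarrow> g \<in> carrier G \<Longrightarrow> plot P n U (\<lambda>_. g)"
  using ds_const [OF diffeological_P, of n U g] points_P by simp

lemma points_X: "points X = (\<lambda>x. x <# \<Gamma>) ` carrier G"
  by (simp add: coset_ds_def quotient_ds_def topspace_M)

lemma plot_X_iff:
  "plot X n U \<alpha> \<longleftrightarrow> openin (Euclidean_space n) U \<and>
     (\<forall>x\<in>U. \<exists>V \<beta>. x \<in> V \<and> V \<subseteq> U \<and> plot P n V \<beta> \<and> (\<forall>y\<in>V. \<alpha> y = \<beta> y <# \<Gamma>))"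
  by (simp add: coset_ds_def quotient_ds_def)

lemma plot_X_proj: "plot P n U a \<Longrightarrow> plot X n U (\<lambda>s. a s <# \<Gamma>)"
  unfolding plot_X_iff using ds_open [OF diffeological_P, of n U a] by blast

lemma plot_X_local:
  assumes "plot X n U \<alpha>" "x \<in> U"
  obtains V \<beta> where "x \<in> V" "V \<subseteq> U" "plot P n V \<beta>" "\<And>y. y \<in> V \<Longrightarrow> \<alpha> y = \<beta> y <# \<Gamma>"
proof -
  have "\<exists>V \<beta>. x \<in> V \<and> V \<subseteq> U \<and> plot P n V \<beta> \<and> (\<forall>y\<in>V. \<alpha> y = \<beta> y <# \<Gamma>)"
    using assms unfolding plot_X_iff by blast
  then show thesis using that by blast
qed

text \<open>In a chart of \<open>G\<close> the family becomes a plot of \<open>G/\<Gamma>\<close> in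
  \<open>n + mdim M\<close> variables, the parameter and the chart coordinates together. The
  quotient diffeology lifts such a plot near any given point.\<close>

lemma local_lift:
  assumes p: "plot (Diff_ds X) n U \<alpha>" and t1: "t1 \<in> U" and ch: "(W, \<phi>) \<in> atlas M" and x1: "x1 \<in> W"
  obtains Z \<beta> where "openin (Euclidean_space (n + mdim M)) Z" "ejoin n t1 (\<phi> x1) \<in> Z"
    "Z \<subseteq> eprod n (mdim M) U (\<phi> ` W)" "plot P (n + mdim M) Z \<beta>"
    "\<And>u. u \<in> Z \<Longrightarrow> \<alpha> (efst n u) (inv_into W \<phi> (esnd n u) <# \<Gamma>) = \<beta> u <# \<Gamma>"
proof -
  let ?d = "mdim M"
  let ?O = "eprod n ?d U (\<phi> ` W)"
  have U: "openin (Euclidean_space n) U" by (rule plot_DiffD(1) [OF diffeological_X p])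
  have im: "openin (Euclidean_space ?d) (\<phi> ` W)" by (rule chart_image_open [OF charted_M ch])
  have O: "openin (Euclidean_space (n + ?d)) ?O" by (rule openin_eprod [OF U im])
  have c: "plot P (n + ?d) ?O (\<lambda>u. inv_into W \<phi> (esnd n u))"
    by (rule ds_compose [OF diffeological_P chart_plot [OF smooth_manifold_M ch] O _ smooth_on_esnd]) (auto simp: eprod_def)
  have pX: "plot X (n + ?d) ?O (\<lambda>u. \<alpha> (efst n u) (inv_into W \<phi> (esnd n u) <# \<Gamma>))"
    by (rule plot_DiffD(3) [OF diffeological_X p _ smooth_on_efst plot_X_proj [OF c]]) (auto simp: eprod_def)
  have jO: "ejoin n t1 (\<phi> x1) \<in> ?O"
    by (rule ejoin_in_eprod [OF t1 openin_subset [OF U] _ openin_subset [OF im]]) (use x1 in blast)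
  obtain Z \<beta> where Z: "ejoin n t1 (\<phi> x1) \<in> Z" "Z \<subseteq> ?O" "plot P (n + ?d) Z \<beta>"
    "\<And>y. y \<in> Z \<Longrightarrow> \<alpha> (efst n y) (inv_into W \<phi> (esnd n y) <# \<Gamma>) = \<beta> y <# \<Gamma>"
    by (rule plot_X_local [OF pX jO]) (rule that)
  moreover from Z(3) have "openin (Euclidean_space (n + ?d)) Z" by (rule ds_open [OF diffeological_P])
  ultimately show thesis using that [of Z \<beta>] Z by blast
qed

text \<open>Monodromy over box times group yields one continuous lift. To see that it is smooth
  along a pair \<open>h\<close>, \<open>b\<close>, it is compared near each parameter with the
  smooth local lift: over a connected box they differ by one element of \<open>\<Gamma>\<close>, and
  right multiplication by a constant is smooth.\<close>

lemma lift_family: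
  assumes p: "plot (Diff_ds X) n U \<alpha>" and t0: "t0 \<in> U"
  obtains e A where "e > 0" "ebox n t0 e \<subseteq> U"
    "\<And>t x. t \<in> ebox n t0 e \<Longrightarrow> x \<in> carrier G \<Longrightarrow> A t x \<in> carrier G"
    "\<And>t x. t \<in> ebox n t0 e \<Longrightarrow> x \<in> carrier G \<Longrightarrow> A t x <# \<Gamma> = \<alpha> t (x <# \<Gamma>)"
    "\<And>m V h b. h \<in> V \<rightarrow> ebox n t0 e \<Longrightarrow> smooth_on m V n h \<Longrightarrow> plot P m V b \<Longrightarrow> plot P m V (\<lambda>s. A (h s) (b s))"
proof -
  let ?d = "mdim M"
  have U: "openin (Euclidean_space n) U" by (rule plot_DiffD(1) [OF diffeological_X p])
  obtain e where e: "e > 0" "ebox n t0 e \<subseteq> U" using openin_contains_ebox [OF U t0] by blast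
  define B where "B = ebox n t0 e"
  have t0t: "t0 \<in> topspace (Euclidean_space n)" using openin_subset [OF U] t0 by blast
  have Bo: "openin (Euclidean_space n) B" unfolding B_def by (rule openin_ebox)
  have Bt: "topspace (subtopology (Euclidean_space n) B) = B" by (rule topspace_subtopology_open [OF Bo])
  have BU: "B \<subseteq> U" using e(2) by (simp add: B_def)
  define Y where "Y = prod_topology (subtopology (Euclidean_space n) B) (mtop M)"
  have Yt: "topspace Y = B \<times> carrier G" unfolding Y_def topspace_prod_topology Bt topspace_M ..
  define q where "q = (\<lambda>z. \<alpha> (fst z) (snd z <# \<Gamma>))"
  have scY: "simply_connected_space Y" unfolding Y_def B_def
    by (rule simply_connected_prod [OF simply_connected_ebox [OF t0t] sc])
  have lpcY: "locally_path_connected_space Y" unfolding Y_def locally_path_connected_space_prod_topology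
    using locally_path_connected_space_open_subset [OF locally_path_connected_Euclidean_space Bo]
      locally_path_connected_manifold [OF charted_M] by blast
  have loc: "\<exists>V L. openin Y V \<and> z \<in> V \<and> lift (subtopology Y V) q L" if z: "z \<in> topspace Y" for z
  proof -
    have z1: "fst z \<in> B" "snd z \<in> topspace (mtop M)" using z unfolding Yt topspace_M by auto
    then have zU: "fst z \<in> U" using BU by blast
    obtain W \<phi> where W: "(W, \<phi>) \<in> atlas M" "snd z \<in> W" using chart_at [OF charted_M z1(2)] by blast
    obtain Z \<beta> where Z: "openin (Euclidean_space (n + ?d)) Z" "ejoin n (fst z) (\<phi> (snd z)) \<in> Z"
      "plot P (n + ?d) Z \<beta>" "\<And>u. u \<in> Z \<Longrightarrow> \<alpha> (efst n u) (inv_into W \<phi> (esnd n u) <# \<Gamma>) = \<beta> u <# \<Gamma>"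
      by (rule local_lift [OF p zU W]) (rule that)
    \<comment> \<open>The chart coordinates carry a neighbourhood in \<open>Y\<close> to the domain
      of the local lift; \<open>V\<close> below is the part that lands in \<open>Z\<close>.\<close>
    define f where "f = (\<lambda>z. ejoin n (fst z) (\<phi> (snd z)))"
    have BW: "openin Y (B \<times> W)"
      unfolding Y_def using chart_open [OF charted_M W(1)] Bo openin_subtopology_self
      by (auto simp: openin_prod_Times_iff openin_open_subtopology)
    have YBW: "subtopology Y (B \<times> W) = prod_topology (subtopology (Euclidean_space n) B) (subtopology (mtop M) W)"
      unfolding Y_def by (simp add: subtopology_Times subtopology_subtopology)
    have fc: "continuous_map (subtopology Y (B \<times> W)) (Euclidean_space (n + ?d)) f"
      unfolding f_def YBW
    proof (rule continuous_map_ejoin)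
      show "continuous_map (prod_topology (subtopology (Euclidean_space n) B) (subtopology (mtop M) W)) (Euclidean_space n) fst"
        using continuous_map_fst [of "subtopology (Euclidean_space n) B" "subtopology (mtop M) W"]
        by (simp add: continuous_map_in_subtopology)
      have "continuous_map (subtopology (mtop M) W) (Euclidean_space ?d) \<phi>"
        using chart_continuous [OF charted_M W(1)] by (simp add: continuous_map_in_subtopology)
      from continuous_map_compose [OF continuous_map_snd this]
      show "continuous_map (prod_topology (subtopology (Euclidean_space n) B) (subtopology (mtop M) W)) (Euclidean_space ?d) (\<lambda>z. \<phi> (snd z))"
        by (simp add: o_def)
    qed
    define V where "V = (B \<times> W) \<inter> f -` Z"
    have Vo: "openin Y V" unfolding V_def by (rule openin_preimage [OF BW fc Z(1)])
    have "continuous_map (subtopology Y V) (subtopology (Euclidean_space (n + ?d)) Z) f"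
      using continuous_map_from_subtopology_mono [OF fc, of V] by (auto simp: V_def continuous_map_in_subtopology)
    from continuous_map_compose [OF this plot_manifold_continuous [OF charted_M Z(3)]]
    have "continuous_map (subtopology Y V) (mtop M) (\<lambda>z. \<beta> (f z))" by (simp add: o_def)
    moreover have "\<beta> (f y) <# \<Gamma> = q y" if y: "y \<in> V" for y
    proof -
      have 1: "f y \<in> Z" "fst y \<in> B" "snd y \<in> W" using y by (auto simp: V_def)
      have "fst y \<in> topspace (Euclidean_space n)" using 1(2) openin_subset [OF Bo] by blast
      then have "efst n (f y) = fst y" "esnd n (f y) = \<phi> (snd y)" by (simp_all add: f_def efst_ejoin)
      then show ?thesis using Z(4) [OF 1(1)] inv_into_f_f [OF chart_inj [OF charted_M W(1)] 1(3)] by (simp add: q_def)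
    qed
    ultimately have "lift (subtopology Y V) q (\<lambda>z. \<beta> (f z))" by (simp add: lift_def)
    moreover have "z \<in> V" using z1 W(2) Z(2) by (simp add: V_def f_def mem_Times_iff)
    ultimately show ?thesis using Vo by blast
  qed
  obtain L where L: "lift Y q L" using lift_exists [OF loc scY lpcY] by blast
  define A where "A = (\<lambda>t x. L (t, x))"
  show thesis
  proof (rule that [OF e, of A])
    show "A t x \<in> carrier G" "A t x <# \<Gamma> = \<alpha> t (x <# \<Gamma>)" if "t \<in> ebox n t0 e" "x \<in> carrier G" for t x
      using lift_carrier [OF L, of "(t, x)"] lift_coset [OF L, of "(t, x)"] that by (simp_all add: Yt B_def A_def q_def)
    fix m V h b assume h: "h \<in> V \<rightarrow> ebox n t0 e" "smooth_on m V n h" and b: "plot P m V b"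
    have V: "openin (Euclidean_space m) V" by (rule ds_open [OF diffeological_P b])
    have hB: "h \<in> V \<rightarrow> B" using h(1) by (simp add: B_def)
    note hc = smooth_on_continuous [OF h(2) V Bo hB] and bc = plot_manifold_continuous [OF charted_M b]
    have hbc: "continuous_map (subtopology (Euclidean_space m) V) Y (\<lambda>s. (h s, b s))"
      unfolding Y_def using hc bc by (rule continuous_map_pairedI)
    show "plot P m V (\<lambda>s. A (h s) (b s))"
    proof (rule ds_local [OF diffeological_P V])
      fix s0 assume s0: "s0 \<in> V"
      then have hs0: "h s0 \<in> U" using hB BU by blast
      have "b s0 \<in> topspace (mtop M)" using plot_carrier [OF b s0] topspace_M by simp
      then obtain W \<phi> where W: "(W, \<phi>) \<in> atlas M" "b s0 \<in> W" using chart_at [OF charted_M] by blast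
      obtain Z \<beta> where Z: "openin (Euclidean_space (n + ?d)) Z" "ejoin n (h s0) (\<phi> (b s0)) \<in> Z"
        "plot P (n + ?d) Z \<beta>" "\<And>u. u \<in> Z \<Longrightarrow> \<alpha> (efst n u) (inv_into W \<phi> (esnd n u) <# \<Gamma>) = \<beta> u <# \<Gamma>"
        by (rule local_lift [OF p hs0 W]) (rule that)
      define V1 where "V1 = V \<inter> b -` W"
      have V1: "openin (Euclidean_space m) V1" unfolding V1_def
        by (rule openin_preimage [OF V bc chart_open [OF charted_M W(1)]])
      define j where "j = (\<lambda>s. ejoin n (h s) (\<phi> (b s)))"
      have js: "smooth_on m V1 (n + ?d) j" unfolding j_def
      proof (rule smooth_on_ejoin)
        show "smooth_on m V1 n h" using h(2) by (rule smooth_on_subset) (simp add: V1_def)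
        show "smooth_on m V1 ?d (\<lambda>x. \<phi> (b x))"
          by (rule plot_manifold_chart [OF charted_M ds_subset [OF diffeological_P b V1] W(1)]) (auto simp: V1_def)
      qed
      have jE: "j \<in> V1 \<rightarrow> topspace (Euclidean_space (n + ?d))"
      proof
        fix s assume "s \<in> V1"
        then have "\<phi> (b s) \<in> \<phi> ` W" by (simp add: V1_def)
        then show "j s \<in> topspace (Euclidean_space (n + ?d))"
          unfolding j_def by (intro ejoin_top subsetD [OF openin_subset [OF chart_image_open [OF charted_M W(1)]]])
      qed
      have V2: "openin (Euclidean_space m) (V1 \<inter> j -` Z)"
        by (rule openin_subspace_preimage [OF V1 openin_topspace smooth_on_continuous [OF js V1 openin_topspace jE] Z(1)])
      have "s0 \<in> V1 \<inter> j -` Z" using s0 W(2) Z(2) by (simp add: V1_def j_def)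
      then obtain \<epsilon> where eps: "\<epsilon> > 0" "ebox m s0 \<epsilon> \<subseteq> V1 \<inter> j -` Z" using openin_contains_ebox [OF V2] by blast
      \<comment> \<open>A box is taken for its connectedness, without which the two lifts could
        differ by a varying element of \<open>\<Gamma>\<close>.\<close>
      define V3 where "V3 = ebox m s0 \<epsilon>"
      have V3o: "openin (Euclidean_space m) V3" unfolding V3_def by (rule openin_ebox)
      have V3: "V3 \<subseteq> V" "V3 \<subseteq> V1" "j \<in> V3 \<rightarrow> Z" "s0 \<in> V3"
        using eps ebox_self [of s0 m \<epsilon>] openin_subset [OF V] s0 by (auto simp: V1_def V3_def)
      have s0t: "s0 \<in> topspace (Euclidean_space m)" using openin_subset [OF V] s0 by blast
      have cV3: "connected_space (subtopology (Euclidean_space m) V3)"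
        using path_connectedin_ebox [OF s0t] path_connectedin_imp_connectedin connectedin_def V3_def by metis
      \<comment> \<open>\<open>K1\<close> and \<open>K2\<close> are lifts of the same map over the
        box: the continuous one followed along \<open>h\<close> and \<open>b\<close>, and the smooth
        one.\<close>
      have K1: "lift (subtopology (Euclidean_space m) V3) (\<lambda>s. q (h s, b s)) (\<lambda>s. L (h s, b s))"
      proof (rule lift_compose [OF L])
        show "continuous_map (subtopology (Euclidean_space m) V3) Y (\<lambda>s. (h s, b s))"
          using continuous_map_from_subtopology_mono [OF hbc V3(1)] .
      qed
      have pb: "plot P m V3 (\<lambda>s. \<beta> (j s))"
        by (rule ds_compose [OF diffeological_P Z(3) V3o V3(3) smooth_on_subset [OF js V3(2)]])
      have K2: "lift (subtopology (Euclidean_space m) V3) (\<lambda>s. q (h s, b s)) (\<lambda>s. \<beta> (j s))"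
        unfolding lift_def topspace_subtopology_open [OF V3o]
      proof (intro conjI ballI)
        show "continuous_map (subtopology (Euclidean_space m) V3) (mtop M) (\<lambda>s. \<beta> (j s))"
          by (rule plot_manifold_continuous [OF charted_M pb])
        fix s assume s: "s \<in> V3"
        have 1: "j s \<in> Z" "h s \<in> B" "b s \<in> W" using s V3 hB by (auto simp: V1_def)
        have "h s \<in> topspace (Euclidean_space n)" using 1(2) openin_subset [OF Bo] by blast
        then have "efst n (j s) = h s" "esnd n (j s) = \<phi> (b s)" by (simp_all add: j_def efst_ejoin)
        then show "\<beta> (j s) <# \<Gamma> = q (h s, b s)"
          using Z(4) [OF 1(1)] inv_into_f_f [OF chart_inj [OF charted_M W(1)] 1(3)] by (simp add: q_def)
      qed
      obtain \<gamma> where g: "\<gamma> \<in> \<Gamma>" "\<And>s. s \<in> topspace (subtopology (Euclidean_space m) V3) \<Longrightarrow> L (h s, b s) = \<beta> (j s) \<otimes> \<gamma>"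
        by (rule lift_unique [OF cV3 K2 K1]) blast
      have "plot P m V3 (\<lambda>s. \<beta> (j s) \<otimes> \<gamma>)"
        by (rule plot_mult [OF pb plot_const [OF V3o Gamma_carrier [OF g(1)]]])
      moreover have "\<forall>s\<in>V3. A (h s) (b s) = \<beta> (j s) \<otimes> \<gamma>"
        using g(2) unfolding topspace_subtopology_open [OF V3o] A_def by blast
      ultimately show "\<exists>V' \<beta>. s0 \<in> V' \<and> V' \<subseteq> V \<and> plot P m V' \<beta> \<and> (\<forall>y\<in>V'. A (h y) (b y) = \<beta> y)"
        using V3(1,4) by blast
    qed
  qed
qed

text \<open>A single map is a constant plot on the one-point space of dimension 0, whose point is
  the zero sequence.\<close>

lemma lift_diffeo:
  assumes f: "f \<in> Diff X"
  obtains F where "ds_differentiable P P F" "\<And>x. x \<in> carrier G \<Longrightarrow> F x <# \<Gamma> = f (x <# \<Gamma>)"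
proof -
  let ?U = "topspace (Euclidean_space 0)" and ?t = "\<lambda>_::nat. 0::real"
  have "points (Diff_ds X) = Diff X" by (simp add: Diff_ds_def subset_ds_def)
  then have p: "plot (Diff_ds X) 0 ?U (\<lambda>_. f)"
    using ds_const [OF diffeological_Diff [OF diffeological_X] openin_topspace] f by blast
  have t: "?t \<in> ?U" by (simp add: topspace_Euclidean_space)
  obtain e A where A: "e > 0"
    "\<And>t x. t \<in> ebox 0 ?t e \<Longrightarrow> x \<in> carrier G \<Longrightarrow> A t x \<in> carrier G"
    "\<And>t x. t \<in> ebox 0 ?t e \<Longrightarrow> x \<in> carrier G \<Longrightarrow> A t x <# \<Gamma> = f (x <# \<Gamma>)"
    "\<And>m V h b. h \<in> V \<rightarrow> ebox 0 ?t e \<Longrightarrow> smooth_on m V 0 h \<Longrightarrow> plot P m V b \<Longrightarrow> plot P m V (\<lambda>s. A (h s) (b s))"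
    by (rule lift_family [OF p t]) (rule that)
  have te: "?t \<in> ebox 0 ?t e" by (rule ebox_self [OF t A(1)])
  show thesis
  proof (rule that [of "A ?t"])
    show "ds_differentiable P P (A ?t)"
    proof (rule ds_differentiableI)
      show "A ?t x \<in> points P" if "x \<in> points P" for x using A(2) [OF te] that points_P by simp
      show "plot P n U (\<lambda>x. A ?t (\<alpha> x))" if "plot P n U \<alpha>" for n U \<alpha>
        using A(4) [OF _ smooth_on_const that, of ?t] te by simp
    qed
  qed (rule A(3) [OF te])
qed

section \<open>From lifts to automorphisms of the group\<close>

lemma lift_differ:
  assumes F: "ds_differentiable P P F" and F': "ds_differentiable P P F'"
    and eq: "\<And>x. x \<in> carrier G \<Longrightarrow> F x <# \<Gamma> = F' x <# \<Gamma>"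
  obtains \<gamma> where "\<gamma> \<in> \<Gamma>" "\<And>x. x \<in> carrier G \<Longrightarrow> F' x = F x \<otimes> \<gamma>"
proof -
  have 1: "lift (mtop M) (\<lambda>x. F x <# \<Gamma>) F" using ds_imp_continuous [OF smooth_manifold_M charted_M F] by (simp add: lift_def)
  have 2: "lift (mtop M) (\<lambda>x. F x <# \<Gamma>) F'" using ds_imp_continuous [OF smooth_manifold_M charted_M F'] eq by (simp add: lift_def topspace_M)
  show thesis by (rule lift_unique [OF conn 1 2]) (use that topspace_M in blast)
qed

lemma ds_diff_carrier: "ds_differentiable P P F \<Longrightarrow> x \<in> carrier G \<Longrightarrow> F x \<in> carrier G"
  using points_P by (auto simp: ds_differentiable_def)

lemma ds_diff_P_I:
  assumes "\<And>x. x \<in> carrier G \<Longrightarrow> F x \<in> carrier G" "\<And>n U a. plot P n U a \<Longrightarrow> plot P n U (\<lambda>x. F (a x))"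
  shows "ds_differentiable P P F"
  by (rule ds_differentiableI) (use assms points_P in auto)

lemma ds_diff_cong:
  assumes "ds_differentiable P P F" "\<And>x. x \<in> carrier G \<Longrightarrow> F' x = F x"
  shows "ds_differentiable P P F'"
proof (rule ds_diff_P_I)
  show "F' x \<in> carrier G" if "x \<in> carrier G" for x using assms(2) that ds_diff_carrier [OF assms(1)] by simp
  show "plot P n U (\<lambda>x. F' (a x))" if a: "plot P n U a" for n U a
    by (rule ds_cong [OF diffeological_P ds_differentiableD [OF assms(1) a]]) (use assms(2) plot_carrier [OF a] in simp)
qed

lemma ds_diff_mult_const:
  assumes "ds_differentiable P P F" "g \<in> carrier G"
  shows "ds_differentiable P P (\<lambda>x. g \<otimes> F x)" "ds_differentiable P P (\<lambda>x. F (g \<otimes> x))"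
    "ds_differentiable P P (\<lambda>x. F (x \<otimes> g))" "ds_differentiable P P (\<lambda>x. F x \<otimes> g)"
proof -
  show "ds_differentiable P P (\<lambda>x. g \<otimes> F x)"
    by (rule ds_diff_P_I)
      (use assms(2) ds_diff_carrier [OF assms(1)] plot_mult [OF plot_const [OF ds_open [OF diffeological_P]] ds_differentiableD [OF assms(1)]] in auto)
  show "ds_differentiable P P (\<lambda>x. F x \<otimes> g)"
    by (rule ds_diff_P_I)
      (use assms(2) ds_diff_carrier [OF assms(1)] plot_mult [OF ds_differentiableD [OF assms(1)] plot_const [OF ds_open [OF diffeological_P]]] in auto)
  show "ds_differentiable P P (\<lambda>x. F (g \<otimes> x))"
    by (rule ds_diff_P_I)
      (use assms(2) ds_diff_carrier [OF assms(1)] ds_differentiableD [OF assms(1) plot_mult [OF plot_const [OF ds_open [OF diffeological_P]]]] in auto)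
  show "ds_differentiable P P (\<lambda>x. F (x \<otimes> g))"
    by (rule ds_diff_P_I)
      (use assms(2) ds_diff_carrier [OF assms(1)] ds_differentiableD [OF assms(1) plot_mult [OF _ plot_const [OF ds_open [OF diffeological_P]]]] in auto)
qed

lemma ds_diff_compose:
  "ds_differentiable P P F \<Longrightarrow> ds_differentiable P P F' \<Longrightarrow> ds_differentiable P P (\<lambda>x. F (F' x))"
  by (rule ds_diff_P_I) (auto intro: ds_diff_carrier ds_differentiableD)

lemma ds_diff_ident: "ds_differentiable P P (\<lambda>x. x)"
  by (rule ds_diff_P_I) auto

lemma AutD:
  assumes "\<theta> \<in> Aut_pair G M \<Gamma>"
  shows "\<theta> \<in> hom G G" "bij_betw \<theta> (carrier G) (carrier G)" "\<theta> \<in> extensional (carrier G)"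
    "ds_differentiable P P \<theta>" "ds_differentiable P P (inv_into (carrier G) \<theta>)" "\<theta> ` \<Gamma> = \<Gamma>"
  using assms smooth_map_imp_ds [OF charted_M charted_M] by (auto simp: Aut_pair_def auto_def Bij_def)

lemma AutI:
  assumes "\<And>x y. x \<in> carrier G \<Longrightarrow> y \<in> carrier G \<Longrightarrow> \<theta> (x \<otimes> y) = \<theta> x \<otimes> \<theta> y"
    "\<theta> \<in> extensional (carrier G)" "ds_differentiable P P \<theta>" "ds_differentiable P P \<kappa>"
    "\<And>x. x \<in> carrier G \<Longrightarrow> \<theta> (\<kappa> x) = x" "\<And>x. x \<in> carrier G \<Longrightarrow> \<kappa> (\<theta> x) = x" "\<theta> ` \<Gamma> = \<Gamma>"
  shows "\<theta> \<in> Aut_pair G M \<Gamma>" "\<And>x. x \<in> carrier G \<Longrightarrow> inv_into (carrier G) \<theta> x = \<kappa> x"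
proof -
  have c: "\<theta> x \<in> carrier G" "\<kappa> x \<in> carrier G" if "x \<in> carrier G" for x
    using ds_diff_carrier assms(3,4) that by auto
  have b: "bij_betw \<theta> (carrier G) (carrier G)"
    by (rule bij_betw_byWitness [where f' = \<kappa>]) (use assms c in auto)
  show inv: "inv_into (carrier G) \<theta> x = \<kappa> x" if "x \<in> carrier G" for x
    using inv_into_f_f [OF bij_betw_imp_inj_on [OF b] c(2) [OF that]] assms(5) [OF that] by simp
  have "ds_differentiable P P (inv_into (carrier G) \<theta>)" by (rule ds_diff_cong [OF assms(4) inv])
  then show "\<theta> \<in> Aut_pair G M \<Gamma>"
    using assms b c ds_imp_smooth_map [OF smooth_manifold_M charted_M] by (auto simp: Aut_pair_def auto_def Bij_def hom_def)
qed

text \<open>Division by \<open>F \<one>\<close> makes the lift fix the unit element. That the result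
  is a diffeomorphism of \<open>G\<close> is not inherited from \<open>f\<close> for free: a lift of
  the inverse of \<open>f\<close> inverts \<open>F\<close> only up to right translations, which have
  to be corrected.\<close>

lemma aut_of_lift:
  assumes f: "f \<in> Diff X" and F: "ds_differentiable P P F"
    and Ff: "\<And>x. x \<in> carrier G \<Longrightarrow> F x <# \<Gamma> = f (x <# \<Gamma>)"
  shows "(\<lambda>x\<in>carrier G. inv (F \<one>) \<otimes> F x) \<in> Aut_pair G M \<Gamma>"
proof -
  define g0 where "g0 = F \<one>"
  have Fc: "F x \<in> carrier G" if "x \<in> carrier G" for x using ds_diff_carrier [OF F that] .
  have g0: "g0 \<in> carrier G" using Fc by (simp add: g0_def)
  define \<theta> where "\<theta> = (\<lambda>x\<in>carrier G. inv g0 \<otimes> F x)"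
  have th: "\<theta> x = inv g0 \<otimes> F x" if "x \<in> carrier G" for x using that by (simp add: \<theta>_def)
  have thc: "\<theta> x \<in> carrier G" if "x \<in> carrier G" for x using that Fc g0 by (simp add: th)
  have thd: "ds_differentiable P P \<theta>"
    by (rule ds_diff_cong [OF ds_diff_mult_const(1) [OF F]]) (use g0 th in auto)
  have mulG: "\<theta> (x \<otimes> \<gamma>) = \<theta> x \<otimes> \<theta> \<gamma>" if g: "\<gamma> \<in> \<Gamma>" and x: "x \<in> carrier G" for x \<gamma>
  proof -
    \<comment> \<open>\<open>F\<close> and \<open>F\<close> after right translation by
      \<open>\<gamma>\<close> lift the same map, so they differ by one constant
      \<open>\<delta>\<close>; evaluation at \<open>\<one>\<close> identifies it as
      \<open>\<theta> \<gamma>\<close>.\<close>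
    have "F y <# \<Gamma> = F (y \<otimes> \<gamma>) <# \<Gamma>" if "y \<in> carrier G" for y
      using that Gamma_carrier [OF g] by (simp add: Ff coset_translate [OF _ g])
    from lift_differ [OF F ds_diff_mult_const(3) [OF F Gamma_carrier [OF g]] this]
    obtain \<delta> where d: "\<delta> \<in> \<Gamma>" "\<And>x. x \<in> carrier G \<Longrightarrow> F (x \<otimes> \<gamma>) = F x \<otimes> \<delta>" by blast
    have "F \<gamma> = g0 \<otimes> \<delta>" using d(2) [of \<one>] Gamma_carrier [OF g] by (simp add: g0_def)
    then have "\<theta> \<gamma> = \<delta>" using g0 Gamma_carrier [OF g] Gamma_carrier [OF d(1)] by (simp add: th flip: m_assoc)
    then show ?thesis using d(2) [OF x] x g0 Gamma_carrier [OF g] Gamma_carrier [OF d(1)] Fc [OF x] by (simp add: th m_assoc)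
  qed
  \<comment> \<open>The left factor is already arbitrary in \<open>mulG\<close>. Only the right one
    has to be extended from the dense subgroup, by continuity into a Hausdorff space.\<close>
  have hom: "\<theta> (x \<otimes> y) = \<theta> x \<otimes> \<theta> y" if x: "x \<in> carrier G" and y: "y \<in> carrier G" for x y
  proof (rule forall_in_closure_of_eq [where X = "mtop M" and Y = "mtop M" and S = \<Gamma> and f = "\<lambda>y. \<theta> (x \<otimes> y)" and g = "\<lambda>y. \<theta> x \<otimes> \<theta> y"])
    show "y \<in> mtop M closure_of \<Gamma>" using dense topspace_M y by simp
    show "Hausdorff_space (mtop M)" using smooth_manifold_M by (simp add: smooth_manifold_def)
    show "continuous_map (mtop M) (mtop M) (\<lambda>y. \<theta> (x \<otimes> y))"
      by (rule ds_imp_continuous [OF smooth_manifold_M charted_M ds_diff_mult_const(2) [OF thd x]])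
    show "continuous_map (mtop M) (mtop M) (\<lambda>y. \<theta> x \<otimes> \<theta> y)"
      by (rule ds_imp_continuous [OF smooth_manifold_M charted_M ds_diff_mult_const(1) [OF thd thc [OF x]]])
  qed (rule mulG [OF _ x])
  define f' where "f' = (\<lambda>c\<in>points X. inv_into (points X) f c)"
  have f': "f' \<in> Diff X" unfolding f'_def by (rule inv_into_Diff [OF diffeological_X f])
  note bf = DiffD(1) [OF f]
  have ff': "f (f' c) = c" "f' (f c) = c" if "c \<in> points X" for c
    using that bf by (simp_all add: f'_def bij_betw_inv_into_right bij_betw_inv_into_left bij_betw_apply)
  obtain F' where F': "ds_differentiable P P F'" and F'f: "\<And>x. x \<in> carrier G \<Longrightarrow> F' x <# \<Gamma> = f' (x <# \<Gamma>)"
    by (rule lift_diffeo [OF f']) blast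
  have F'c: "F' x \<in> carrier G" if "x \<in> carrier G" for x using ds_diff_carrier [OF F' that] .
  have coset_in_points: "x <# \<Gamma> \<in> points X" if "x \<in> carrier G" for x using that points_X by blast
  \<comment> \<open>Both composites of \<open>F\<close> and \<open>F'\<close> lift the identity of
    \<open>G/\<Gamma>\<close>, hence are right translations. \<open>\<gamma>0\<close> will make
    \<open>F\<close> onto, \<open>\<gamma>1\<close> makes it injective.\<close>
  have "x <# \<Gamma> = F (F' x) <# \<Gamma>" if "x \<in> carrier G" for x
    using that F'c coset_in_points by (simp add: Ff F'f ff')
  from lift_differ [OF ds_diff_ident ds_diff_compose [OF F F'] this]
  obtain \<gamma>0 where g1: "\<gamma>0 \<in> \<Gamma>" "\<And>x. x \<in> carrier G \<Longrightarrow> F (F' x) = x \<otimes> \<gamma>0" by blast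
  have "x <# \<Gamma> = F' (F x) <# \<Gamma>" if "x \<in> carrier G" for x
    using that Fc coset_in_points by (simp add: Ff F'f ff')
  from lift_differ [OF ds_diff_ident ds_diff_compose [OF F' F] this]
  obtain \<gamma>1 where g2: "\<gamma>1 \<in> \<Gamma>" "\<And>x. x \<in> carrier G \<Longrightarrow> F' (F x) = x \<otimes> \<gamma>1" by blast
  have Finj: "x = y" if "F x = F y" "x \<in> carrier G" "y \<in> carrier G" for x y
  proof -
    have "x \<otimes> \<gamma>1 = F' (F x)" by (rule g2(2) [OF that(2), symmetric])
    also have "\<dots> = y \<otimes> \<gamma>1" unfolding that(1) by (rule g2(2) [OF that(3)])
    finally show ?thesis using right_cancel [OF Gamma_carrier [OF g2(1)] that(2,3)] by blast
  qed
  \<comment> \<open>This solves \<open>inv g0 \<otimes> F x = y\<close>, that is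
    \<open>F x = g0 \<otimes> y\<close>, by means of
    \<open>F (F' (z \<otimes> inv \<gamma>0)) = z\<close>.\<close>
  define \<kappa> where "\<kappa> = (\<lambda>y. F' (g0 \<otimes> y \<otimes> inv \<gamma>0))"
  have kd: "ds_differentiable P P \<kappa>"
    unfolding \<kappa>_def using ds_diff_mult_const(2) [OF ds_diff_mult_const(3) [OF F'] g0] Gamma_carrier [OF g1(1)] by simp
  have kc: "\<kappa> y \<in> carrier G" if "y \<in> carrier G" for y using ds_diff_carrier [OF kd that] .
  have Fk: "F (\<kappa> y) = g0 \<otimes> y" if y: "y \<in> carrier G" for y
    using g1(2) [of "g0 \<otimes> y \<otimes> inv \<gamma>0"] y g0 Gamma_carrier [OF g1(1)] by (simp add: \<kappa>_def m_assoc)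
  have tk: "\<theta> (\<kappa> y) = y" if y: "y \<in> carrier G" for y
    using Fk [OF y] y g0 kc [OF y] by (simp add: th flip: m_assoc)
  have kt: "\<kappa> (\<theta> x) = x" if x: "x \<in> carrier G" for x
  proof (rule Finj)
    show "F (\<kappa> (\<theta> x)) = F x" using Fk [OF thc [OF x]] x g0 Fc [OF x] by (simp add: th flip: m_assoc)
  qed (use kc thc x in auto)
  have one: "g0 <# \<Gamma> = f (\<one> <# \<Gamma>)" using Ff [of \<one>] by (simp add: g0_def)
  have ext: "\<theta> \<in> extensional (carrier G)" by (simp add: \<theta>_def)
  have "\<theta> ` \<Gamma> = \<Gamma>"
  proof
    show "\<theta> ` \<Gamma> \<subseteq> \<Gamma>"
    proof
      fix z assume "z \<in> \<theta> ` \<Gamma>"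
      then obtain \<gamma> where g: "\<gamma> \<in> \<Gamma>" "z = \<theta> \<gamma>" by blast
      have "\<one> <# \<Gamma> = \<gamma> <# \<Gamma>" using coset_eq_iff [of \<one> \<gamma>] Gamma_carrier [OF g(1)] g(1) by simp
      then have "g0 <# \<Gamma> = F \<gamma> <# \<Gamma>" using one Ff [OF Gamma_carrier [OF g(1)]] by simp
      then show "z \<in> \<Gamma>" using coset_eq_iff [OF g0 Fc [OF Gamma_carrier [OF g(1)]]] g th [OF Gamma_carrier [OF g(1)]] by simp
    qed
    show "\<Gamma> \<subseteq> \<theta> ` \<Gamma>"
    proof
      fix \<delta> assume d: "\<delta> \<in> \<Gamma>"
      define x where "x = \<kappa> \<delta>"
      have x: "x \<in> carrier G" "\<theta> x = \<delta>" using kc tk Gamma_carrier [OF d] by (simp_all add: x_def)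
      then have "inv g0 \<otimes> F x \<in> \<Gamma>" using d th by simp
      \<comment> \<open>For this inclusion the injectivity of \<open>f\<close> on cosets is needed;
        the other one only compares lifts of \<open>f\<close> over the coset of
        \<open>\<one>\<close>.\<close>
      then have "f (\<one> <# \<Gamma>) = f (x <# \<Gamma>)" using coset_eq_iff [OF g0 Fc [OF x(1)]] one Ff [OF x(1)] by simp
      then have "\<one> <# \<Gamma> = x <# \<Gamma>" using inj_onD [OF bij_betw_imp_inj_on [OF bf]] coset_in_points x(1) by simp
      then have "x \<in> \<Gamma>" using coset_eq_iff [of \<one> x] x(1) by simp
      then show "\<delta> \<in> \<theta> ` \<Gamma>" using x(2) by blast
    qed
  qed
  then have "\<theta> \<in> Aut_pair G M \<Gamma>"
    by (intro AutI(1) [where \<theta> = \<theta> and \<kappa> = \<kappa>] hom ext thd kd tk kt)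
  then show ?thesis by (simp add: \<theta>_def g0_def)
qed

end

section \<open>Smoothness of the inversion of automorphisms\<close>

context lie_pair
begin

abbreviation "Aut \<equiv> Aut_pair G M \<Gamma>"

lemma Aut_carrier: "\<theta> \<in> Aut \<Longrightarrow> x \<in> carrier G \<Longrightarrow> \<theta> x \<in> carrier G"
  by (rule ds_diff_carrier [OF AutD(4)])

lemma Aut_mult: "\<theta> \<in> Aut \<Longrightarrow> x \<in> carrier G \<Longrightarrow> y \<in> carrier G \<Longrightarrow> \<theta> (x \<otimes> y) = \<theta> x \<otimes> \<theta> y"
  using hom_mult [OF AutD(1)] by blast

lemma Aut_one: "\<theta> \<in> Aut \<Longrightarrow> \<theta> \<one> = \<one>"
  using hom_one [OF AutD(1) is_group is_group] .

lemma Aut_inv_carrier: "\<theta> \<in> Aut \<Longrightarrow> x \<in> carrier G \<Longrightarrow> inv_into (carrier G) \<theta> x \<in> carrier G"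
  by (rule ds_diff_carrier [OF AutD(5)])

lemma Aut_inv_right: "\<theta> \<in> Aut \<Longrightarrow> x \<in> carrier G \<Longrightarrow> \<theta> (inv_into (carrier G) \<theta> x) = x"
  by (rule bij_betw_inv_into_right [OF AutD(2)])

lemma Aut_inv_left: "\<theta> \<in> Aut \<Longrightarrow> x \<in> carrier G \<Longrightarrow> inv_into (carrier G) \<theta> (\<theta> x) = x"
  by (rule bij_betw_inv_into_left [OF AutD(2)])

lemma Aut_subset_Diff: "Aut \<subseteq> Diff P"
proof
  fix \<theta> assume t: "\<theta> \<in> Aut"
  show "\<theta> \<in> Diff P"
    by (rule DiffI [OF _ AutD(4) [OF t] AutD(5) [OF t] _ _ diffeological_P])
      (use AutD(3) [OF t] Aut_inv_left [OF t] Aut_inv_right [OF t] points_P in auto)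
qed

lemma plot_Aut_iff:
  "plot (subset_ds (Diff_ds P) Aut) n U \<theta> \<longleftrightarrow> openin (Euclidean_space n) U \<and> (\<forall>t\<in>U. \<theta> t \<in> Aut) \<and>
     (\<forall>m V h b. h \<in> V \<rightarrow> U \<longrightarrow> smooth_on m V n h \<longrightarrow> plot P m V b \<longrightarrow> plot P m V (\<lambda>s. \<theta> (h s) (b s)))"
proof -
  have "plot (subset_ds (Diff_ds P) Aut) n U \<theta> \<longleftrightarrow> plot (Diff_ds P) n U \<theta> \<and> (\<forall>t\<in>U. \<theta> t \<in> Aut)"
    by (auto simp: subset_ds_def)
  moreover have "(\<forall>t\<in>U. \<theta> t \<in> Aut) \<Longrightarrow> (\<forall>t\<in>U. \<theta> t \<in> Diff P)" using Aut_subset_Diff by blast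
  ultimately show ?thesis unfolding plot_Diff [OF diffeological_P] by argo
qed

lemma plot_AutD:
  assumes "plot (subset_ds (Diff_ds P) Aut) n U \<theta>"
  shows "openin (Euclidean_space n) U" "t \<in> U \<Longrightarrow> \<theta> t \<in> Aut"
    "h \<in> V \<rightarrow> U \<Longrightarrow> smooth_on m V n h \<Longrightarrow> plot P m V b \<Longrightarrow> plot P m V (\<lambda>s. \<theta> (h s) (b s))"
proof -
  note p = assms [unfolded plot_Aut_iff]
  show "openin (Euclidean_space n) U" by (rule conjunct1 [OF p])
  show "t \<in> U \<Longrightarrow> \<theta> t \<in> Aut" by (rule bspec [OF conjunct1 [OF conjunct2 [OF p]]])
  show "h \<in> V \<rightarrow> U \<Longrightarrow> smooth_on m V n h \<Longrightarrow> plot P m V b \<Longrightarrow> plot P m V (\<lambda>s. \<theta> (h s) (b s))"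
    by (rule conjunct2 [OF conjunct2 [OF p], rule_format])
qed

text \<open>The derivative of \<open>(t, x) \<mapsto> (t, \<theta>\<^sub>t(x))\<close>, read in charts as \<open>K\<close>, is injective: if it kills \<open>v\<close>, then \<open>v\<close> has
  no component along \<open>t\<close>, so the line \<open>C\<close> in direction \<open>v\<close> stays over one \<open>t\<close> and is recovered from \<open>K \<circ> C\<close>, whose
  velocity vanishes, by the smooth inverse of \<open>\<theta>\<^sub>t\<close>.\<close>

lemma aut_family_kernel:
  assumes th: "plot (subset_ds (Diff_ds P) Aut) n U \<theta>"
    and W: "(W, \<phi>) \<in> atlas M" and Z: "(Z, \<psi>) \<in> atlas M"
    and k_def: "k = (\<lambda>u. \<theta> (efst n u) (inv_into W \<phi> (esnd n u)))"
    and O_def: "S = eprod n (mdim M) U (\<phi> ` W) \<inter> k -` Z" and So: "openin (Euclidean_space (n + mdim M)) S"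
    and K_def: "K = (\<lambda>u. ejoin n (efst n u) (\<psi> (k u)))"
    and Ks: "\<And>r. r < n + mdim M \<Longrightarrow> Ck_on (n + mdim M) (Suc 0) S (\<lambda>u. K u r)"
    and u0: "u0 \<in> S"
    and ker: "\<And>r. r < n + mdim M \<Longrightarrow> (\<Sum>j<n + mdim M. pd j (\<lambda>u. K u r) u0 * v j) = 0"
    and j: "j < n + mdim M"
  shows "v j = 0"
proof -
  let ?d = "mdim M" and ?N = "n + mdim M"
  define C where "C = (\<lambda>\<tau> j. if j < ?N then u0 j + \<tau> * v j else 0)"
  have u0t: "u0 \<in> topspace (Euclidean_space ?N)" using openin_subset [OF So] u0 by blast
  have C0: "C 0 = u0" using u0t by (auto simp: C_def topspace_Euclidean_space fun_eq_iff)
  have Ct: "C \<tau> \<in> topspace (Euclidean_space ?N)" for \<tau> by (auto simp: C_def topspace_Euclidean_space)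
  have Cd: "((\<lambda>\<tau>. C \<tau> i) has_real_derivative v i) (at 0)" if "i < ?N" for i
    using that by (auto simp: C_def intro!: derivative_eq_intros)
  have KC: "((\<lambda>\<tau>. K (C \<tau>) r) has_real_derivative 0) (at 0)" if r: "r < ?N" for r
  proof -
    have "((\<lambda>\<tau>. K (C \<tau>) r) has_real_derivative (\<Sum>j<?N. pd j (\<lambda>u. K u r) (C 0) * v j)) (at 0)"
      by (rule has_derivative_chain [OF So Ks [OF r] _ Cd]) (simp_all add: C0 u0 Ct)
    then show ?thesis using ker [OF r] by (simp add: C0)
  qed
  have CS: "\<forall>\<^sub>F \<tau> in nhds 0. C \<tau> \<in> S"
  proof -
    obtain e where e: "e > 0" "ebox ?N u0 e \<subseteq> S" using openin_contains_ebox [OF So u0] by blast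
    have lim: "((\<lambda>\<tau>. C \<tau> i) \<longlongrightarrow> u0 i) (nhds 0)" if "i < ?N" for i
    proof -
      have "((\<lambda>\<tau>. C \<tau> i) \<longlongrightarrow> C 0 i) (nhds 0)"
        using DERIV_isCont [OF Cd [OF that]] tendsto_at_iff_tendsto_nhds [of "\<lambda>\<tau>. C \<tau> i" 0] by (simp add: isCont_def)
      then show ?thesis by (simp only: C0)
    qed
    have "\<forall>\<^sub>F \<tau> in nhds 0. C \<tau> \<in> ebox ?N u0 e"
      by (rule eventually_ebox [OF lim _ e(1)]) (simp_all add: Ct)
    then show ?thesis by eventually_elim (use e(2) in blast)
  qed
  \<comment> \<open>The first \<open>n\<close> components of \<open>K\<close> are those of
    \<open>u\<close>, so their derivative along \<open>C\<close> is \<open>v i\<close>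
    itself.\<close>
  have v0: "v i = 0" if i: "i < n" for i
  proof -
    have "((\<lambda>\<tau>. C \<tau> i) has_real_derivative 0) (at 0)"
      using KC [of i] i by (simp add: K_def ejoin_def efst_def)
    then show ?thesis using Cd [of i] DERIV_unique i by fastforce
  qed
  show ?thesis
  proof (cases "j < n")
    case True then show ?thesis by (rule v0)
  next
    case False
    define i where "i = j - n"
    have i: "i < ?d" "j = i + n" using False j by (simp_all add: i_def)
    define t where "t = efst n u0"
    have tU: "t \<in> U" using u0 by (simp add: O_def eprod_def t_def)
    have At: "\<theta> t \<in> Aut" by (rule plot_AutD(2) [OF th tU])
    have Cfst: "efst n (C \<tau>) = t" for \<tau>
      using v0 by (auto simp: efst_def C_def t_def fun_eq_iff)
    \<comment> \<open>The inverse of the one automorphism over which the line runs, read in the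
      chart \<open>Z\<close>. It recovers the chart coordinates from \<open>\<psi> (k u)\<close>, as
      \<open>key\<close> records.\<close>
    define g where "g = (\<lambda>w. inv_into (carrier G) (\<theta> t) (inv_into Z \<psi> w))"
    have pg: "plot P ?d (\<psi> ` Z) g" unfolding g_def
      by (rule ds_differentiableD [OF AutD(5) [OF At] chart_plot [OF smooth_manifold_M Z]])
    define Q where "Q = \<psi> ` Z \<inter> g -` W"
    have Qo: "openin (Euclidean_space ?d) Q" unfolding Q_def
      by (rule openin_preimage [OF chart_image_open [OF charted_M Z] plot_manifold_continuous [OF charted_M pg] chart_open [OF charted_M W]])
    have gs: "smooth_on ?d Q ?d (\<lambda>w. \<phi> (g w))"
      by (rule plot_manifold_chart [OF charted_M ds_subset [OF diffeological_P pg Qo] W]) (auto simp: Q_def)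
    have key: "\<psi> (k u) \<in> Q \<and> \<phi> (g (\<psi> (k u))) = esnd n u" if u: "u \<in> S" "efst n u = t" for u
    proof -
      have kZ: "k u \<in> Z" and es: "esnd n u \<in> \<phi> ` W" using u(1) by (simp_all add: O_def eprod_def)
      have w: "inv_into W \<phi> (esnd n u) \<in> W" by (rule inv_into_into [OF es])
      then have wc: "inv_into W \<phi> (esnd n u) \<in> carrier G"
        using openin_subset [OF chart_open [OF charted_M W]] topspace_M by auto
      have "g (\<psi> (k u)) = inv_into (carrier G) (\<theta> t) (k u)"
        using inv_into_f_f [OF chart_inj [OF charted_M Z] kZ] by (simp add: g_def)
      also have "\<dots> = inv_into W \<phi> (esnd n u)"
        using Aut_inv_left [OF At wc] by (simp add: k_def u(2))
      finally have "g (\<psi> (k u)) = inv_into W \<phi> (esnd n u)" .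
      then show ?thesis using w kZ f_inv_into_f [OF es] by (simp add: Q_def)
    qed
    have Kes: "esnd n (K u) = \<psi> (k u)" for u by (simp add: K_def)
    have C1: "Ck_on ?d (Suc 0) Q (\<lambda>w. \<phi> (g w) i)" by (rule smooth_onD [OF gs i(1)])
    have "((\<lambda>\<tau>. \<phi> (g (esnd n (K (C \<tau>)))) i) has_real_derivative
        (\<Sum>l<?d. pd l (\<lambda>w. \<phi> (g w) i) (esnd n (K (C 0))) * 0)) (at 0)"
    proof (rule has_derivative_chain [OF Qo C1, where c = "\<lambda>\<tau>. esnd n (K (C \<tau>))"])
      show "esnd n (K (C 0)) \<in> Q" using key [OF u0] by (simp add: C0 Kes t_def)
      show "((\<lambda>\<tau>. esnd n (K (C \<tau>)) l) has_real_derivative 0) (at 0)" if "l < ?d" for l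
        using KC [of "l + n"] that by (simp add: esnd_def)
      have "\<forall>\<^sub>F \<tau> in nhds 0. esnd n (K (C \<tau>)) \<in> topspace (Euclidean_space ?d)"
        using CS by eventually_elim (use key Cfst Kes openin_subset [OF Qo] in auto)
      then show "\<forall>\<^sub>F \<tau> in at 0. esnd n (K (C \<tau>)) \<in> topspace (Euclidean_space ?d)"
        by (simp add: eventually_at_filter eventually_mono)
    qed
    then have D0: "((\<lambda>\<tau>. \<phi> (g (esnd n (K (C \<tau>)))) i) has_real_derivative 0) (at 0)" by simp
    have "\<forall>\<^sub>F \<tau> in nhds 0. \<phi> (g (esnd n (K (C \<tau>)))) i = C \<tau> j"
      using CS
    proof eventually_elim
      case (elim \<tau>)
      have "\<phi> (g (esnd n (K (C \<tau>)))) i = esnd n (C \<tau>) i" using key [OF elim Cfst] by (simp add: Kes)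
      then show ?case by (simp add: esnd_def i(2))
    qed
    from DERIV_cong_ev [OF refl this refl] D0 have "((\<lambda>\<tau>. C \<tau> j) has_real_derivative 0) (at 0)" by simp
    then show ?thesis using Cd [OF j] DERIV_unique by blast
  qed
qed

text \<open>With \<open>K\<close> the chart form of
  \<open>(t, x) \<mapsto> (t, \<theta> t x)\<close>, the value sought at \<open>s\<close> consists
  of the last coordinates of the preimage under \<open>K\<close> of the pair formed by
  \<open>h s\<close> and the chart coordinates of \<open>b s\<close>. \<open>smooth_inverse\<close>
  applies to \<open>K\<close>: it is injective because every automorphism is, and
  \<open>aut_family_kernel\<close> gives the condition on its derivative.\<close>

lemma aut_inverse_plot:
  assumes th: "plot (subset_ds (Diff_ds P) Aut) n U \<theta>"
    and h: "h \<in> V \<rightarrow> U" "smooth_on m V n h" and b: "plot P m V b"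
  shows "plot P m V (\<lambda>s. inv_into (carrier G) (\<theta> (h s)) (b s))"
proof (rule ds_local [OF diffeological_P])
  let ?d = "mdim M" and ?N = "n + mdim M"
  show V: "openin (Euclidean_space m) V" by (rule ds_open [OF diffeological_P b])
  have U: "openin (Euclidean_space n) U" by (rule plot_AutD(1) [OF th])
  note hc = smooth_on_continuous [OF h(2) V U h(1)] and bc = plot_manifold_continuous [OF charted_M b]
  fix s0 assume s0: "s0 \<in> V"
  have t1: "h s0 \<in> U" using h(1) s0 by blast
  have A1: "\<theta> (h s0) \<in> Aut" by (rule plot_AutD(2) [OF th t1])
  have x1: "b s0 \<in> carrier G" by (rule plot_carrier [OF b s0])
  \<comment> \<open>The chart \<open>W\<close> is taken around the value of the inverse at
    \<open>s0\<close>, so that the corresponding point lies in \<open>S\<close> and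
    \<open>s0\<close> in \<open>V2\<close>.\<close>
  define y1 where "y1 = inv_into (carrier G) (\<theta> (h s0)) (b s0)"
  have y1: "y1 \<in> carrier G" "\<theta> (h s0) y1 = b s0"
    using Aut_inv_carrier [OF A1 x1] Aut_inv_right [OF A1 x1] by (simp_all add: y1_def)
  obtain W \<phi> where W: "(W, \<phi>) \<in> atlas M" "y1 \<in> W" using chart_at [OF charted_M, of y1] y1(1) topspace_M by auto
  obtain Z \<psi> where Z: "(Z, \<psi>) \<in> atlas M" "b s0 \<in> Z" using chart_at [OF charted_M, of "b s0"] x1 topspace_M by auto
  note Wim = chart_image_open [OF charted_M W(1)] and Zim = chart_image_open [OF charted_M Z(1)]
  define E0 where "E0 = eprod n ?d U (\<phi> ` W)"
  have E0o: "openin (Euclidean_space ?N) E0" unfolding E0_def by (rule openin_eprod [OF U Wim])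
  have pc: "plot P ?N E0 (\<lambda>u. inv_into W \<phi> (esnd n u))"
    by (rule ds_compose [OF diffeological_P chart_plot [OF smooth_manifold_M W(1)] E0o _ smooth_on_esnd]) (auto simp: E0_def eprod_def)
  define k where "k = (\<lambda>u. \<theta> (efst n u) (inv_into W \<phi> (esnd n u)))"
  have pk: "plot P ?N E0 k" unfolding k_def
    by (rule plot_AutD(3) [OF th _ smooth_on_efst pc]) (auto simp: E0_def eprod_def)
  define S where "S = eprod n ?d U (\<phi> ` W) \<inter> k -` Z"
  have SE0: "S \<subseteq> E0" by (auto simp: S_def E0_def)
  have So: "openin (Euclidean_space ?N) S" unfolding S_def
    by (rule openin_preimage [OF E0o [unfolded E0_def] _ chart_open [OF charted_M Z(1)]])
      (rule plot_manifold_continuous [OF charted_M pk [unfolded E0_def]])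
  define K where "K = (\<lambda>u. ejoin n (efst n u) (\<psi> (k u)))"
  have Ksm: "smooth_on ?N S ?N K" unfolding K_def
  proof (rule smooth_on_ejoin [OF smooth_on_efst])
    show "smooth_on ?N S ?d (\<lambda>u. \<psi> (k u))"
      by (rule plot_manifold_chart [OF charted_M ds_subset [OF diffeological_P pk So SE0] Z(1)]) (auto simp: S_def)
  qed
  have ZE: "\<psi> z \<in> topspace (Euclidean_space ?d)" if "z \<in> Z" for z
    using openin_subset [OF Zim] that by blast
  have KE: "K \<in> S \<rightarrow> topspace (Euclidean_space ?N)"
    using ZE by (auto simp: K_def S_def intro!: ejoin_top)
  have Kfst: "efst n (K u) = efst n u" for u by (simp add: K_def efst_ejoin efst_top)
  have Ksnd: "esnd n (K u) = \<psi> (k u)" for u by (simp add: K_def)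
  have memS: "efst n u \<in> U" "esnd n u \<in> \<phi> ` W" "k u \<in> Z" if "u \<in> S" for u
    using that by (simp_all add: S_def eprod_def)
  have cW: "inv_into W \<phi> (esnd n u) \<in> carrier G" if "u \<in> S" for u
    using inv_into_into [OF memS(2) [OF that]] openin_subset [OF chart_open [OF charted_M W(1)]] topspace_M by auto
  have kinv: "inv_into (carrier G) (\<theta> (efst n u)) (k u) = inv_into W \<phi> (esnd n u)" if "u \<in> S" for u
    using Aut_inv_left [OF plot_AutD(2) [OF th memS(1) [OF that]] cW [OF that]] by (simp add: k_def)
  have Kinj: "inj_on K S"
  proof (rule inj_onI)
    fix u u' assume u: "u \<in> S" "u' \<in> S" and eq: "K u = K u'"
    have f: "efst n u = efst n u'" using Kfst [of u] Kfst [of u'] eq by simp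
    have "\<psi> (k u) = \<psi> (k u')" using Ksnd [of u] Ksnd [of u'] eq by simp
    then have "k u = k u'" using inj_onD [OF chart_inj [OF charted_M Z(1)]] memS(3) u by blast
    then have "inv_into W \<phi> (esnd n u) = inv_into W \<phi> (esnd n u')"
      using kinv [OF u(1)] kinv [OF u(2)] f by simp
    then have "esnd n u = esnd n u'" using memS(2) u f_inv_into_f by metis
    then show "u = u'" using f ejoin_efst_esnd by metis
  qed
  have ker: "\<forall>j<?N. v j = 0"
    if "u \<in> S" "\<And>r. r < ?N \<Longrightarrow> (\<Sum>j<?N. pd j (\<lambda>x. K x r) u * v j) = 0" for u v
    using aut_family_kernel [OF th W(1) Z(1) k_def S_def So K_def smooth_onD [OF Ksm] that] by blast
  have KSo: "openin (Euclidean_space ?N) (K ` S)"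
    by (rule smooth_inverse(1) [OF So KE Kinj smooth_onD [OF Ksm] ker])
  have Ism: "smooth_on ?N (K ` S) ?N (inv_into S K)"
    unfolding smooth_on_def
  proof (intro allI impI)
    fix k i assume "i < ?N"
    then show "Ck_on ?N k (K ` S) (\<lambda>y. inv_into S K y i)"
      by (intro smooth_inverse(2) [OF So KE Kinj smooth_onD [OF Ksm] ker])
  qed
  define g where "g = (\<lambda>s. ejoin n (h s) (\<psi> (b s)))"
  define V1 where "V1 = V \<inter> b -` Z"
  have V1: "openin (Euclidean_space m) V1" unfolding V1_def
    by (rule openin_preimage [OF V bc chart_open [OF charted_M Z(1)]])
  have gs: "smooth_on m V1 ?N g" unfolding g_def
  proof (rule smooth_on_ejoin)
    show "smooth_on m V1 n h" using h(2) by (rule smooth_on_subset) (simp add: V1_def)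
    show "smooth_on m V1 ?d (\<lambda>x. \<psi> (b x))"
      by (rule plot_manifold_chart [OF charted_M ds_subset [OF diffeological_P b V1] Z(1)]) (auto simp: V1_def)
  qed
  have gE: "g \<in> V1 \<rightarrow> topspace (Euclidean_space ?N)"
    using ZE by (auto simp: g_def V1_def intro!: ejoin_top)
  \<comment> \<open>The image of \<open>K\<close> is open by invariance of domain; this makes
    \<open>V2\<close> a neighbourhood of \<open>s0\<close> on which the inverse of \<open>K\<close>
    may be used.\<close>
  define V2 where "V2 = V1 \<inter> g -` (K ` S)"
  have V2: "openin (Euclidean_space m) V2" unfolding V2_def
    by (rule openin_subspace_preimage [OF V1 openin_topspace smooth_on_continuous [OF gs V1 openin_topspace gE] KSo])
  have hE: "h s \<in> topspace (Euclidean_space n)" if "s \<in> V" for s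
    using h(1) that openin_subset [OF U] by blast
  have "s0 \<in> V2"
  proof -
    define u1 where "u1 = ejoin n (h s0) (\<phi> y1)"
    have e1: "efst n u1 = h s0" "esnd n u1 = \<phi> y1" using hE [OF s0] by (simp_all add: u1_def efst_ejoin)
    have k1: "k u1 = b s0" using e1 y1(2) inv_into_f_f [OF chart_inj [OF charted_M W(1)] W(2)] by (simp add: k_def)
    have "u1 \<in> eprod n ?d U (\<phi> ` W)"
      unfolding u1_def by (rule ejoin_in_eprod [OF t1 openin_subset [OF U] _ openin_subset [OF Wim]]) (use W(2) in blast)
    then have "u1 \<in> S" using k1 Z(2) by (simp add: S_def)
    moreover have "g s0 = K u1" by (simp add: g_def K_def e1 k1)
    ultimately show ?thesis using s0 Z(2) by (auto simp: V2_def V1_def)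
  qed
  moreover have "V2 \<subseteq> V" by (auto simp: V2_def V1_def)
  moreover have "plot P m V2 (\<lambda>s. inv_into W \<phi> (esnd n (inv_into S K (g s))))"
  proof (rule ds_compose [OF diffeological_P pc V2, of "\<lambda>s. inv_into S K (g s)"])
    show "(\<lambda>s. inv_into S K (g s)) \<in> V2 \<rightarrow> E0"
      using SE0 by (auto simp: V2_def intro!: inv_into_into)
    show "smooth_on m V2 ?N (\<lambda>s. inv_into S K (g s))"
      by (rule smooth_on_compose [OF V2 KSo _ smooth_on_subset [OF gs] Ism]) (auto simp: V2_def)
  qed
  moreover have "inv_into (carrier G) (\<theta> (h s)) (b s) = inv_into W \<phi> (esnd n (inv_into S K (g s)))" if s: "s \<in> V2" for s
  proof -
    have sV: "s \<in> V" "b s \<in> Z" "g s \<in> K ` S" using s by (simp_all add: V2_def V1_def)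
    define u where "u = inv_into S K (g s)"
    have u: "u \<in> S" "K u = g s" using sV(3) by (simp_all add: u_def inv_into_into f_inv_into_f)
    have "efst n u = h s" using Kfst [of u] u(2) hE [OF sV(1)] by (simp add: g_def efst_ejoin)
    moreover have "\<psi> (k u) = \<psi> (b s)" using Ksnd [of u] u(2) by (simp add: g_def)
    then have "k u = b s" using inj_onD [OF chart_inj [OF charted_M Z(1)]] memS(3) [OF u(1)] sV(2) by blast
    ultimately show ?thesis using kinv [OF u(1)] by (simp add: u_def)
  qed
  ultimately show "\<exists>V' \<beta>. s0 \<in> V' \<and> V' \<subseteq> V \<and> plot P m V' \<beta> \<and> (\<forall>y\<in>V'. inv_into (carrier G) (\<theta> (h y)) (b y) = \<beta> y)"
    by blast
qed

end

section \<open>The isomorphism\<close>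

text \<open>Only one side of the isomorphism has to be shown to be a diffeological group.\<close>

lemma dgroup_transport:
  assumes H: "diffeological_group H X" and Q: "group Q" and dY: "diffeological_space Y" and ptY: "points Y = carrier Q"
    and iso: "\<Phi> \<in> iso H Q" and dif: "ds_differentiable X Y \<Phi>" and inv: "ds_differentiable Y X \<Psi>"
    and right: "\<And>y. y \<in> carrier Q \<Longrightarrow> \<Phi> (\<Psi> y) = y"
  shows "diffeological_group Q Y"
proof -
  have gH: "group H" and ptX: "points X = carrier H" and diffeological_X: "diffeological_space X"
    and op: "ds_differentiable (prod_ds X X) X (\<lambda>(x, y). x \<otimes>\<^bsub>H\<^esub> inv\<^bsub>H\<^esub> y)"
    using H by (auto simp: diffeological_group_def)
  interpret gh: group_hom H Q \<Phi>
    using gH Q iso by (simp add: group_hom_def group_hom_axioms_def iso_def)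
  have \<Psi>c: "\<Psi> y \<in> carrier H" if "y \<in> carrier Q" for y
    using inv that ptX ptY by (auto simp: ds_differentiable_def)
  have eq: "x \<otimes>\<^bsub>Q\<^esub> inv\<^bsub>Q\<^esub> y = \<Phi> (\<Psi> x \<otimes>\<^bsub>H\<^esub> inv\<^bsub>H\<^esub> \<Psi> y)" if "x \<in> carrier Q" "y \<in> carrier Q" for x y
    using \<Psi>c [OF that(1)] \<Psi>c [OF that(2)] right that by simp
  have "ds_differentiable (prod_ds Y Y) Y (\<lambda>(x, y). x \<otimes>\<^bsub>Q\<^esub> inv\<^bsub>Q\<^esub> y)"
  proof (rule ds_differentiableI)
    fix z assume "z \<in> points (prod_ds Y Y)"
    then have "fst z \<in> carrier Q" "snd z \<in> carrier Q" by (auto simp: prod_ds_def ptY)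
    then show "(case z of (x, y) \<Rightarrow> x \<otimes>\<^bsub>Q\<^esub> inv\<^bsub>Q\<^esub> y) \<in> points Y"
      by (simp add: case_prod_unfold ptY)
  next
    fix n U \<alpha> assume "plot (prod_ds Y Y) n U \<alpha>"
    then have p: "plot Y n U (\<lambda>x. fst (\<alpha> x))" "plot Y n U (\<lambda>x. snd (\<alpha> x))" by (simp_all add: prod_ds_def o_def)
    have "plot (prod_ds X X) n U (\<lambda>x. (\<Psi> (fst (\<alpha> x)), \<Psi> (snd (\<alpha> x))))"
      using ds_differentiableD [OF inv p(1)] ds_differentiableD [OF inv p(2)] by (simp add: prod_ds_def o_def)
    from ds_differentiableD [OF dif ds_differentiableD [OF op this]]
    have q: "plot Y n U (\<lambda>x. \<Phi> (\<Psi> (fst (\<alpha> x)) \<otimes>\<^bsub>H\<^esub> inv\<^bsub>H\<^esub> \<Psi> (snd (\<alpha> x))))" by simp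
    show "plot Y n U (\<lambda>x. case \<alpha> x of (x, y) \<Rightarrow> x \<otimes>\<^bsub>Q\<^esub> inv\<^bsub>Q\<^esub> y)"
    proof (rule ds_cong [OF dY q])
      fix x assume "x \<in> U"
      then have "fst (\<alpha> x) \<in> carrier Q" "snd (\<alpha> x) \<in> carrier Q"
        using ds_points [OF dY p(1)] ds_points [OF dY p(2)] ptY by auto
      from eq [OF this]
      show "(case \<alpha> x of (x, y) \<Rightarrow> x \<otimes>\<^bsub>Q\<^esub> inv\<^bsub>Q\<^esub> y) = \<Phi> (\<Psi> (fst (\<alpha> x)) \<otimes>\<^bsub>H\<^esub> inv\<^bsub>H\<^esub> \<Psi> (snd (\<alpha> x)))"
        by (simp add: case_prod_unfold)
    qed
  qed
  then show ?thesis using Q dY ptY by (simp add: diffeological_group_def)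
qed

section \<open>The action of the semidirect product on cosets\<close>

context lie_pair
begin

text \<open>The action is defined on the coset as a set, so no representative is chosen. That it
  sends cosets to cosets rests on \<open>\<theta>\<close> mapping \<open>\<Gamma>\<close> onto
  itself, see \<open>Psi_apply\<close>.\<close>

definition \<Psi> :: "('a \<Rightarrow> 'a) \<times> 'a \<Rightarrow> 'a set \<Rightarrow> 'a set" where
  "\<Psi> s = (\<lambda>c\<in>points X. snd s <# (fst s ` c))"

abbreviation "S \<equiv> semidirect G M \<Gamma>"
abbreviation "SD \<equiv> semidirect_ds G M \<Gamma>"

lemma coset_in_points: "x \<in> carrier G \<Longrightarrow> x <# \<Gamma> \<in> points X"
  using points_X by blast

lemma carrier_S: "carrier S = Aut \<times> carrier G"
  by (simp add: semidirect_def)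

lemma mult_S: "(\<theta>, g) \<otimes>\<^bsub>S\<^esub> (\<theta>', g') = (compose (carrier G) \<theta> \<theta>', g \<otimes> \<theta> g')"
  by (simp add: semidirect_def)

lemma one_S: "\<one>\<^bsub>S\<^esub> = (\<lambda>x\<in>carrier G. x, \<one>)"
  by (simp add: semidirect_def)

lemma Psi_apply:
  assumes "\<theta> \<in> Aut" "g \<in> carrier G" "x \<in> carrier G"
  shows "\<Psi> (\<theta>, g) (x <# \<Gamma>) = (g \<otimes> \<theta> x) <# \<Gamma>"
proof -
  have "\<theta> ` (x <# \<Gamma>) = \<theta> x <# (\<theta> ` \<Gamma>)"
  proof -
    have "\<theta> (x \<otimes> \<gamma>) = \<theta> x \<otimes> \<theta> \<gamma>" if "\<gamma> \<in> \<Gamma>" for \<gamma> by (rule Aut_mult [OF assms(1,3) Gamma_carrier [OF that]])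
    then show ?thesis unfolding l_coset_def by (auto simp: image_iff)
  qed
  then have "\<theta> ` (x <# \<Gamma>) = \<theta> x <# \<Gamma>" by (simp add: AutD(6) [OF assms(1)])
  moreover have "g <# (\<theta> x <# \<Gamma>) = (g \<otimes> \<theta> x) <# \<Gamma>"
    by (rule lcos_m_assoc) (use Gamma_carrier assms Aut_carrier in auto)
  ultimately show ?thesis using coset_in_points [OF assms(3)] by (simp add: \<Psi>_def)
qed

lemma Psi_ext: "\<Psi> s \<in> extensional (points X)"
  by (simp add: \<Psi>_def)

lemma Aut_compose: "\<theta> \<in> Aut \<Longrightarrow> \<theta>' \<in> Aut \<Longrightarrow> compose (carrier G) \<theta> \<theta>' \<in> Aut"
proof -
  assume t: "\<theta> \<in> Aut" "\<theta>' \<in> Aut"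
  let ?k = "\<lambda>x. inv_into (carrier G) \<theta>' (inv_into (carrier G) \<theta> x)"
  have c: "compose (carrier G) \<theta> \<theta>' x = \<theta> (\<theta>' x)" if "x \<in> carrier G" for x using that by (simp add: compose_def)
  show ?thesis
  proof (rule AutI(1) [where \<kappa> = ?k])
    show "compose (carrier G) \<theta> \<theta>' (x \<otimes> y) = compose (carrier G) \<theta> \<theta>' x \<otimes> compose (carrier G) \<theta> \<theta>' y"
      if "x \<in> carrier G" "y \<in> carrier G" for x y
      using that t by (simp add: c Aut_mult Aut_carrier)
    show "ds_differentiable P P (compose (carrier G) \<theta> \<theta>')"
      by (rule ds_diff_cong [OF ds_diff_compose [OF AutD(4) [OF t(1)] AutD(4) [OF t(2)]] c])
    show "ds_differentiable P P ?k"
      by (rule ds_diff_compose [OF AutD(5) [OF t(2)] AutD(5) [OF t(1)]])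
    show "compose (carrier G) \<theta> \<theta>' (?k x) = x" if "x \<in> carrier G" for x
      using that t by (simp add: c Aut_inv_carrier Aut_inv_right)
    show "?k (compose (carrier G) \<theta> \<theta>' x) = x" if "x \<in> carrier G" for x
      using that t by (simp add: c Aut_carrier Aut_inv_left)
    have "compose (carrier G) \<theta> \<theta>' ` \<Gamma> = \<theta> ` (\<theta>' ` \<Gamma>)"
      unfolding image_image by (rule image_cong [OF refl]) (simp add: c Gamma_carrier)
    then show "compose (carrier G) \<theta> \<theta>' ` \<Gamma> = \<Gamma>" by (simp add: AutD(6) [OF t(1)] AutD(6) [OF t(2)])
  qed simp
qed

lemma Aut_inverse: "\<theta> \<in> Aut \<Longrightarrow> (\<lambda>x\<in>carrier G. inv_into (carrier G) \<theta> x) \<in> Aut"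
proof -
  assume t: "\<theta> \<in> Aut"
  let ?k = "\<lambda>x\<in>carrier G. inv_into (carrier G) \<theta> x"
  note b = AutD(2) [OF t]
  show ?thesis
  proof (rule AutI(1) [where \<kappa> = \<theta>])
    show "?k (x \<otimes> y) = ?k x \<otimes> ?k y" if xy: "x \<in> carrier G" "y \<in> carrier G" for x y
    proof -
      have "\<theta> (inv_into (carrier G) \<theta> x \<otimes> inv_into (carrier G) \<theta> y) = x \<otimes> y"
        using t xy by (simp add: Aut_mult Aut_inv_carrier Aut_inv_right)
      then have "inv_into (carrier G) \<theta> (x \<otimes> y) = inv_into (carrier G) \<theta> x \<otimes> inv_into (carrier G) \<theta> y"
        using Aut_inv_left [OF t, of "inv_into (carrier G) \<theta> x \<otimes> inv_into (carrier G) \<theta> y"] t xy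
        by (simp add: Aut_inv_carrier)
      then show ?thesis using xy by simp
    qed
    show "ds_differentiable P P ?k" by (rule ds_diff_cong [OF AutD(5) [OF t]]) simp
    show "?k ` \<Gamma> = \<Gamma>"
    proof -
      have "?k ` (\<theta> ` \<Gamma>) = \<Gamma>"
        unfolding image_image using t by (simp add: Gamma_carrier Aut_carrier Aut_inv_left)
      then show ?thesis by (simp add: AutD(6) [OF t])
    qed
  qed (use t in \<open>auto simp: AutD(4) Aut_inv_left Aut_inv_right Aut_carrier\<close>)
qed

lemma Aut_id: "(\<lambda>x\<in>carrier G. x) \<in> Aut"
proof (rule AutI(1) [where \<kappa> = "\<lambda>x. x"])
  show "ds_differentiable P P (\<lambda>x\<in>carrier G. x)" by (rule ds_diff_cong [OF ds_diff_ident]) simp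
  show "(\<lambda>x\<in>carrier G. x) ` \<Gamma> = \<Gamma>" using Gamma_carrier by (auto simp: image_iff)
qed (simp_all add: ds_diff_ident)

lemma group_S: "group S"
proof (rule groupI)
  fix s s' assume "s \<in> carrier S" "s' \<in> carrier S"
  then obtain \<theta> g \<theta>' g' where s: "s = (\<theta>, g)" "s' = (\<theta>', g')" "\<theta> \<in> Aut" "g \<in> carrier G" "\<theta>' \<in> Aut" "g' \<in> carrier G"
    by (auto simp: carrier_S)
  show "s \<otimes>\<^bsub>S\<^esub> s' \<in> carrier S" using s by (simp add: mult_S carrier_S Aut_compose Aut_carrier)
  fix s'' assume "s'' \<in> carrier S"
  then obtain \<theta>'' g'' where s'': "s'' = (\<theta>'', g'')" "\<theta>'' \<in> Aut" "g'' \<in> carrier G" by (auto simp: carrier_S)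
  have "compose (carrier G) (compose (carrier G) \<theta> \<theta>') \<theta>'' = compose (carrier G) \<theta> (compose (carrier G) \<theta>' \<theta>'')"
    using s s'' by (auto simp: compose_def Aut_carrier fun_eq_iff)
  moreover have "g \<otimes> \<theta> g' \<otimes> compose (carrier G) \<theta> \<theta>' g'' = g \<otimes> \<theta> (g' \<otimes> \<theta>' g'')"
    using s s'' by (simp add: compose_def Aut_carrier Aut_mult m_assoc)
  ultimately show "s \<otimes>\<^bsub>S\<^esub> s' \<otimes>\<^bsub>S\<^esub> s'' = s \<otimes>\<^bsub>S\<^esub> (s' \<otimes>\<^bsub>S\<^esub> s'')" by (simp add: s s'' mult_S)
next
  show "\<one>\<^bsub>S\<^esub> \<in> carrier S" by (simp add: one_S carrier_S Aut_id)
  fix s assume "s \<in> carrier S"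
  then obtain \<theta> g where s: "s = (\<theta>, g)" "\<theta> \<in> Aut" "g \<in> carrier G" by (auto simp: carrier_S)
  have "compose (carrier G) (\<lambda>x\<in>carrier G. x) \<theta> = \<theta>"
    using AutD(3) [OF s(2)] Aut_carrier [OF s(2)] by (auto simp: compose_def fun_eq_iff extensional_def)
  then show "\<one>\<^bsub>S\<^esub> \<otimes>\<^bsub>S\<^esub> s = s" using s by (simp add: one_S mult_S)
  let ?k = "\<lambda>x\<in>carrier G. inv_into (carrier G) \<theta> x"
  have "compose (carrier G) ?k \<theta> = (\<lambda>x\<in>carrier G. x)"
    using s(2) by (auto simp: compose_def fun_eq_iff Aut_carrier Aut_inv_left)
  \<comment> \<open>The left inverse of \<open>(\<theta>, g)\<close> has second component the
    inverse automorphism at \<open>inv g\<close>, as the twisted product requires.\<close>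
  moreover have "?k (inv g) \<otimes> ?k g = \<one>"
    using Aut_mult [OF Aut_inverse [OF s(2)], of "inv g" g] Aut_one [OF Aut_inverse [OF s(2)]] s(3) by simp
  ultimately have "(?k, ?k (inv g)) \<otimes>\<^bsub>S\<^esub> s = \<one>\<^bsub>S\<^esub>" by (simp only: s(1) mult_S one_S)
  moreover have "(?k, ?k (inv g)) \<in> carrier S"
    using s Aut_inverse by (simp add: carrier_S Aut_inv_carrier)
  ultimately show "\<exists>t\<in>carrier S. t \<otimes>\<^bsub>S\<^esub> s = \<one>\<^bsub>S\<^esub>" by blast
qed

lemma plot_SD_iff:
  "plot SD n U s \<longleftrightarrow> plot (subset_ds (Diff_ds P) Aut) n U (\<lambda>t. fst (s t)) \<and> plot P n U (\<lambda>t. snd (s t))"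
  by (simp add: semidirect_ds_def prod_ds_def o_def)

lemma diffeological_SD: "diffeological_space SD"
  unfolding semidirect_ds_def
proof (rule diffeological_prod [OF diffeological_subset [OF diffeological_Diff [OF diffeological_P]] diffeological_P])
  show "Aut \<subseteq> points (Diff_ds P)" using Aut_subset_Diff by (simp add: Diff_ds_def subset_ds_def)
qed

lemma points_SD: "points SD = carrier S"
  by (simp add: semidirect_ds_def prod_ds_def subset_ds_def carrier_S topspace_M)

text \<open>A plot of cosets lifts locally to \<open>G\<close>, where the action is evaluation of a
  plot of automorphisms followed by a multiplication; both preserve plots.\<close>

lemma Psi_family:
  assumes s: "plot SD n U s" and h: "h \<in> V \<rightarrow> U" "smooth_on m V n h" and b: "plot X m V b"
  shows "plot X m V (\<lambda>x. \<Psi> (s (h x)) (b x))"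
  unfolding plot_X_iff
proof (intro conjI ballI)
  have s1: "plot (subset_ds (Diff_ds P) Aut) n U (\<lambda>t. fst (s t))" and s2: "plot P n U (\<lambda>t. snd (s t))"
    using s by (simp_all add: plot_SD_iff)
  show "openin (Euclidean_space m) V" by (rule ds_open [OF diffeological_X b])
  fix x assume "x \<in> V"
  then obtain V' \<beta> where V': "x \<in> V'" "V' \<subseteq> V" "plot P m V' \<beta>" "\<And>y. y \<in> V' \<Longrightarrow> b y = \<beta> y <# \<Gamma>"
    by (rule plot_X_local [OF b]) (rule that)
  have h': "h \<in> V' \<rightarrow> U" "smooth_on m V' n h" using h V'(2) smooth_on_subset by blast+
  have o: "openin (Euclidean_space m) V'" by (rule ds_open [OF diffeological_P V'(3)])
  have "plot P m V' (\<lambda>y. snd (s (h y)) \<otimes> fst (s (h y)) (\<beta> y))"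
    by (rule plot_mult [OF ds_compose [OF diffeological_P s2 o h'] plot_AutD(3) [OF s1 h' V'(3)]])
  moreover have "\<Psi> (s (h y)) (b y) = (snd (s (h y)) \<otimes> fst (s (h y)) (\<beta> y)) <# \<Gamma>" if y: "y \<in> V'" for y
  proof -
    have hy: "h y \<in> U" using h'(1) y by blast
    show ?thesis
      using Psi_apply [OF plot_AutD(2) [OF s1 hy] plot_carrier [OF s2 hy] plot_carrier [OF V'(3) y]] V'(4) [OF y]
      by simp
  qed
  ultimately show "\<exists>W \<gamma>. x \<in> W \<and> W \<subseteq> V \<and> plot P m W \<gamma> \<and> (\<forall>y\<in>W. \<Psi> (s (h y)) (b y) = \<gamma> y <# \<Gamma>)"
    using V'(1,2) by blast
qed

lemma Psi_ds_differentiable: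
  assumes s: "s \<in> carrier S" shows "ds_differentiable X X (\<Psi> s)"
proof (rule ds_differentiableI)
  obtain \<theta> g where sg: "s = (\<theta>, g)" "\<theta> \<in> Aut" "g \<in> carrier G" using s by (auto simp: carrier_S)
  fix c assume "c \<in> points X"
  then obtain x where "x \<in> carrier G" "c = x <# \<Gamma>" using points_X by blast
  then show "\<Psi> s c \<in> points X" using Psi_apply sg coset_in_points by (simp add: Aut_carrier)
next
  fix n U \<alpha> assume a: "plot X n U \<alpha>"
  have "plot SD n U (\<lambda>_. s)" using ds_const [OF diffeological_SD ds_open [OF diffeological_X a]] s points_SD by simp
  from Psi_family [OF this _ smooth_on_ident a] show "plot X n U (\<lambda>x. \<Psi> s (\<alpha> x))" by simp
qed

lemma Psi_mult:
  assumes s: "s \<in> carrier S" "s' \<in> carrier S"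
  shows "\<Psi> (s \<otimes>\<^bsub>S\<^esub> s') = compose (points X) (\<Psi> s) (\<Psi> s')"
proof (rule extensionalityI [OF Psi_ext])
  obtain \<theta> g \<theta>' g' where sg: "s = (\<theta>, g)" "s' = (\<theta>', g')" "\<theta> \<in> Aut" "g \<in> carrier G" "\<theta>' \<in> Aut" "g' \<in> carrier G"
    using s by (auto simp: carrier_S)
  fix c assume c: "c \<in> points X"
  then obtain x where x: "x \<in> carrier G" "c = x <# \<Gamma>" using points_X by blast
  have "\<Psi> s (\<Psi> s' c) = (g \<otimes> \<theta> (g' \<otimes> \<theta>' x)) <# \<Gamma>"
    using sg x by (simp add: Psi_apply Aut_carrier)
  also have "g \<otimes> \<theta> (g' \<otimes> \<theta>' x) = (g \<otimes> \<theta> g') \<otimes> compose (carrier G) \<theta> \<theta>' x"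
    using sg x by (simp add: compose_def Aut_carrier Aut_mult m_assoc)
  also have "\<dots> <# \<Gamma> = \<Psi> (s \<otimes>\<^bsub>S\<^esub> s') c"
    using sg x by (simp add: mult_S Psi_apply Aut_compose Aut_carrier)
  finally show "\<Psi> (s \<otimes>\<^bsub>S\<^esub> s') c = compose (points X) (\<Psi> s) (\<Psi> s') c" using c by (simp add: compose_def)
qed simp

lemma Psi_one: "\<Psi> \<one>\<^bsub>S\<^esub> = (\<lambda>c\<in>points X. c)"
proof (rule extensionalityI [OF Psi_ext])
  fix c assume c: "c \<in> points X"
  then obtain x where x: "x \<in> carrier G" "c = x <# \<Gamma>" using points_X by blast
  then show "\<Psi> \<one>\<^bsub>S\<^esub> c = (\<lambda>c\<in>points X. c) c" using c by (simp add: one_S Psi_apply Aut_id)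
qed simp

lemma Psi_inverse:
  assumes s: "s \<in> carrier S" and c: "c \<in> points X"
  shows "\<Psi> (inv\<^bsub>S\<^esub> s) (\<Psi> s c) = c" "\<Psi> s (\<Psi> (inv\<^bsub>S\<^esub> s) c) = c"
proof -
  have i: "inv\<^bsub>S\<^esub> s \<in> carrier S" by (rule group.inv_closed [OF group_S s])
  show "\<Psi> (inv\<^bsub>S\<^esub> s) (\<Psi> s c) = c"
    using fun_cong [OF Psi_mult [OF i s], of c] fun_cong [OF Psi_one, of c] c
    by (simp add: group.l_inv [OF group_S s] compose_def)
  show "\<Psi> s (\<Psi> (inv\<^bsub>S\<^esub> s) c) = c"
    using fun_cong [OF Psi_mult [OF s i], of c] fun_cong [OF Psi_one, of c] c
    by (simp add: group.r_inv [OF group_S s] compose_def)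
qed

lemma Psi_Diff: "s \<in> carrier S \<Longrightarrow> \<Psi> s \<in> Diff X"
  by (rule DiffI [OF Psi_ext Psi_ds_differentiable Psi_ds_differentiable [OF group.inv_closed [OF group_S]]
        Psi_inverse(1) Psi_inverse(2) diffeological_X])

lemma Psi_plot:
  assumes s: "plot SD n U s" shows "plot (Diff_ds X) n U (\<lambda>t. \<Psi> (s t))"
  unfolding plot_Diff [OF diffeological_X]
proof (intro conjI ballI allI impI)
  show "openin (Euclidean_space n) U" by (rule ds_open [OF diffeological_SD s])
  show "\<Psi> (s t) \<in> Diff X" if "t \<in> U" for t
    using Psi_Diff ds_points [OF diffeological_SD s that] points_SD by simp
qed (rule Psi_family [OF s])

text \<open>Together with \<open>Psi_plot\<close> and \<open>Psi_surj\<close> this makes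
  \<open>\<Psi>\<close> a subduction onto \<open>Diff(G/\<Gamma>)\<close>.\<close>

lemma local_section:
  assumes p: "plot (Diff_ds X) n U \<alpha>" and t0: "t0 \<in> U"
  obtains V s where "t0 \<in> V" "V \<subseteq> U" "plot SD n V s" "\<And>t. t \<in> V \<Longrightarrow> \<Psi> (s t) = \<alpha> t"
proof -
  have t0t: "t0 \<in> topspace (Euclidean_space n)" using openin_subset [OF plot_DiffD(1) [OF diffeological_X p]] t0 by blast
  obtain e A where e: "e > 0" "ebox n t0 e \<subseteq> U"
    and Ac: "\<And>t x. t \<in> ebox n t0 e \<Longrightarrow> x \<in> carrier G \<Longrightarrow> A t x \<in> carrier G"
    and Al: "\<And>t x. t \<in> ebox n t0 e \<Longrightarrow> x \<in> carrier G \<Longrightarrow> A t x <# \<Gamma> = \<alpha> t (x <# \<Gamma>)"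
    and Ap: "\<And>m V h b. h \<in> V \<rightarrow> ebox n t0 e \<Longrightarrow> smooth_on m V n h \<Longrightarrow> plot P m V b \<Longrightarrow> plot P m V (\<lambda>s. A (h s) (b s))"
    by (rule lift_family [OF p t0]) (rule that)
  define V where "V = ebox n t0 e"
  have Vo: "openin (Euclidean_space n) V" unfolding V_def by (rule openin_ebox)
  define s where "s = (\<lambda>t. (\<lambda>x\<in>carrier G. inv (A t \<one>) \<otimes> A t x, A t \<one>))"
  have aut: "fst (s t) \<in> Aut" if t: "t \<in> V" for t
  proof -
    \<comment> \<open>For fixed \<open>t\<close> the map is a lift of the single diffeomorphism
      \<open>\<alpha> t\<close>; constant reparametrisations show that it is differentiable.\<close>
    have "ds_differentiable P P (A t)"
    proof (rule ds_diff_P_I)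
      show "A t x \<in> carrier G" if "x \<in> carrier G" for x using Ac t that by (simp add: V_def)
      show "plot P m W (\<lambda>x. A t (b x))" if "plot P m W b" for m W b
        by (rule Ap [OF _ smooth_on_const that]) (use t in \<open>simp add: V_def\<close>)
    qed
    moreover have "\<alpha> t \<in> Diff X" by (rule plot_DiffD(2) [OF diffeological_X p]) (use e(2) t in \<open>auto simp: V_def\<close>)
    ultimately show ?thesis using Al t aut_of_lift by (simp add: s_def V_def)
  qed
  have p1: "plot P n V (\<lambda>t. A t \<one>)"
    using Ap [OF _ smooth_on_ident plot_const [OF Vo one_closed]] by (simp add: V_def)
  have "plot (subset_ds (Diff_ds P) Aut) n V (\<lambda>t. fst (s t))"
    unfolding plot_Aut_iff
  proof (intro conjI ballI allI impI Vo aut)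
    fix m W h b assume h: "h \<in> W \<rightarrow> V" "smooth_on m W n h" and b: "plot P m W b"
    have W: "openin (Euclidean_space m) W" by (rule ds_open [OF diffeological_P b])
    have "plot P m W (\<lambda>y. inv (A (h y) \<one>) \<otimes> A (h y) (b y))"
      by (rule plot_mult [OF plot_inv [OF ds_compose [OF diffeological_P p1 W h]] Ap [OF h(1) [unfolded V_def] h(2) b]])
    then show "plot P m W (\<lambda>y. fst (s (h y)) (b y))"
      by (rule ds_cong [OF diffeological_P]) (simp add: s_def plot_carrier [OF b])
  qed
  then have "plot SD n V s" using p1 by (simp add: plot_SD_iff s_def)
  moreover have "\<Psi> (s t) = \<alpha> t" if t: "t \<in> V" for t
  proof (rule extensionalityI [OF Psi_ext])
    have "\<alpha> t \<in> Diff X" by (rule plot_DiffD(2) [OF diffeological_X p]) (use e(2) t in \<open>auto simp: V_def\<close>)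
    then show "\<alpha> t \<in> extensional (points X)" by (rule DiffD(2))
    fix c assume "c \<in> points X"
    then obtain x where x: "x \<in> carrier G" "c = x <# \<Gamma>" using points_X by blast
    have Ax: "A t x \<in> carrier G" "A t \<one> \<in> carrier G" using Ac t x(1) by (simp_all add: V_def)
    have "\<Psi> (s t) c = (A t \<one> \<otimes> (inv (A t \<one>) \<otimes> A t x)) <# \<Gamma>"
      using Psi_apply [OF aut [OF t] Ax(2) x(1)] x by (simp add: s_def)
    also have "A t \<one> \<otimes> (inv (A t \<one>) \<otimes> A t x) = A t x" using Ax by (simp flip: m_assoc)
    also have "\<dots> <# \<Gamma> = \<alpha> t c" using Al t x by (simp add: V_def)
    finally show "\<Psi> (s t) c = \<alpha> t c" .
  qed
  moreover have "t0 \<in> V" unfolding V_def by (rule ebox_self [OF t0t e(1)])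
  moreover have "V \<subseteq> U" using e(2) by (simp add: V_def)
  ultimately show thesis using that by blast
qed

lemma Psi_surj: "\<Psi> ` carrier S = Diff X"
proof
  show "\<Psi> ` carrier S \<subseteq> Diff X" using Psi_Diff by blast
  show "Diff X \<subseteq> \<Psi> ` carrier S"
  proof
    fix f assume f: "f \<in> Diff X"
  \<comment> \<open>A single diffeomorphism is a plot of dimension 0.\<close>
    let ?U = "topspace (Euclidean_space 0)" and ?t = "\<lambda>_::nat. 0::real"
    have "points (Diff_ds X) = Diff X" by (simp add: Diff_ds_def subset_ds_def)
    then have p: "plot (Diff_ds X) 0 ?U (\<lambda>_. f)"
      using ds_const [OF diffeological_Diff [OF diffeological_X] openin_topspace] f by blast
    have t: "?t \<in> ?U" by (simp add: topspace_Euclidean_space)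
    obtain V s where "?t \<in> V" "plot SD 0 V s" "\<And>t. t \<in> V \<Longrightarrow> \<Psi> (s t) = f"
      by (rule local_section [OF p t]) (rule that)
    then have "s ?t \<in> carrier S" "\<Psi> (s ?t) = f" using ds_points [OF diffeological_SD, of 0 V s ?t] points_SD by auto
    then show "f \<in> \<Psi> ` carrier S" by blast
  qed
qed

text \<open>Through a local section the inverses are computed in \<open>G\<close>: the inverse of
  the action of \<open>(\<theta>, g)\<close> sends the coset of \<open>y\<close> to that of the
  inverse automorphism at \<open>inv g \<otimes> y\<close>, so the question reduces to
  \<open>aut_inverse_plot\<close>.\<close>

lemma inverse_family:
  assumes p: "plot (Diff_ds X) n U \<alpha>" and h: "h \<in> V \<rightarrow> U" "smooth_on m V n h" and b: "plot X m V b"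
  shows "plot X m V (\<lambda>x. inv_into (points X) (\<alpha> (h x)) (b x))"
proof (rule ds_local [OF diffeological_X])
  show V: "openin (Euclidean_space m) V" by (rule ds_open [OF diffeological_X b])
  have U: "openin (Euclidean_space n) U" by (rule plot_DiffD(1) [OF diffeological_X p])
  fix x assume x: "x \<in> V"
  then have hx: "h x \<in> U" using h(1) by blast
  obtain B s where B: "h x \<in> B" "B \<subseteq> U" "plot SD n B s" "\<And>t. t \<in> B \<Longrightarrow> \<Psi> (s t) = \<alpha> t"
    by (rule local_section [OF p hx]) (rule that)
  have Bo: "openin (Euclidean_space n) B" by (rule ds_open [OF diffeological_SD B(3)])
  have s1: "plot (subset_ds (Diff_ds P) Aut) n B (\<lambda>t. fst (s t))" and s2: "plot P n B (\<lambda>t. snd (s t))"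
    using B(3) by (simp_all add: plot_SD_iff)
  obtain V1 \<beta> where V1: "x \<in> V1" "V1 \<subseteq> V" "plot P m V1 \<beta>" "\<And>y. y \<in> V1 \<Longrightarrow> b y = \<beta> y <# \<Gamma>"
    by (rule plot_X_local [OF b x]) (rule that)
  define V2 where "V2 = V1 \<inter> (V \<inter> h -` B)"
  have V2: "openin (Euclidean_space m) V2" unfolding V2_def
    by (rule openin_Int [OF ds_open [OF diffeological_P V1(3)] openin_subspace_preimage [OF V U smooth_on_continuous [OF h(2) V U h(1)] Bo]])
  have h2: "h \<in> V2 \<rightarrow> B" "smooth_on m V2 n h" using smooth_on_subset [OF h(2), of V2] by (auto simp: V2_def)
  have b2: "plot P m V2 \<beta>" by (rule ds_subset [OF diffeological_P V1(3) V2]) (simp add: V2_def)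
  let ?k = "\<lambda>y. inv_into (carrier G) (fst (s (h y))) (inv (snd (s (h y))) \<otimes> \<beta> y)"
  have pk: "plot P m V2 ?k"
    by (rule aut_inverse_plot [OF s1 h2 plot_mult [OF plot_inv [OF ds_compose [OF diffeological_P s2 V2 h2]] b2]])
  have "inv_into (points X) (\<alpha> (h y)) (b y) = ?k y <# \<Gamma>" if y: "y \<in> V2" for y
  proof -
    have hy: "h y \<in> B" "y \<in> V1" "h y \<in> U" using y B(2) by (auto simp: V2_def)
    note A = plot_AutD(2) [OF s1 hy(1)] and g = plot_carrier [OF s2 hy(1)] and c = plot_carrier [OF V1(3) hy(2)]
    have kc: "?k y \<in> carrier G" by (rule plot_carrier [OF pk y])
    have "\<alpha> (h y) (?k y <# \<Gamma>) = (snd (s (h y)) \<otimes> fst (s (h y)) (?k y)) <# \<Gamma>"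
      using Psi_apply [OF A g kc] B(4) [OF hy(1)] by simp
    also have "fst (s (h y)) (?k y) = inv (snd (s (h y))) \<otimes> \<beta> y"
      using Aut_inv_right [OF A] g c by simp
    also have "snd (s (h y)) \<otimes> (inv (snd (s (h y))) \<otimes> \<beta> y) = \<beta> y" using g c by (simp flip: m_assoc)
    finally have "\<alpha> (h y) (?k y <# \<Gamma>) = b y" using V1(4) [OF hy(2)] by simp
    then show ?thesis
      using inv_into_f_f [OF bij_betw_imp_inj_on [OF DiffD(1) [OF plot_DiffD(2) [OF diffeological_X p hy(3)]]] coset_in_points [OF kc]] by simp
  qed
  then show "\<exists>V' \<gamma>. x \<in> V' \<and> V' \<subseteq> V \<and> plot X m V' \<gamma> \<and> (\<forall>y\<in>V'. inv_into (points X) (\<alpha> (h y)) (b y) = \<gamma> y)"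
    using plot_X_proj [OF pk] V1(1,2) B(1) x by (intro exI [of _ V2] exI [of _ "\<lambda>y. ?k y <# \<Gamma>"]) (auto simp: V2_def)
qed

section \<open>The diffeomorphism group as a diffeological group\<close>

abbreviation "H \<equiv> Diff_group X"

lemma diffeological_group_Diff: "diffeological_group H (Diff_ds X)"
  unfolding diffeological_group_def
proof (intro conjI)
  show "group H" by (rule group_Diff_group [OF diffeological_X])
  show "diffeological_space (Diff_ds X)" by (rule diffeological_Diff [OF diffeological_X])
  show ptH: "points (Diff_ds X) = carrier H"
    using Diff_group_simps(1) [OF diffeological_X] by (simp add: Diff_ds_def subset_ds_def)
  note cH = Diff_group_simps(1) [OF diffeological_X]
  have eq: "f \<otimes>\<^bsub>H\<^esub> inv\<^bsub>H\<^esub> g \<in> Diff X" "c \<in> points X \<Longrightarrow> (f \<otimes>\<^bsub>H\<^esub> inv\<^bsub>H\<^esub> g) c = f (inv_into (points X) g c)"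
    if "f \<in> Diff X" "g \<in> Diff X" for f g c
    using compose_Diff [OF diffeological_X that(1) inv_into_Diff [OF diffeological_X that(2)]] that inv_into_Diff [OF diffeological_X that(2)]
    by (simp_all add: Diff_group_simps [OF diffeological_X] compose_def)
  show "ds_differentiable (prod_ds (Diff_ds X) (Diff_ds X)) (Diff_ds X) (\<lambda>(x, y). x \<otimes>\<^bsub>H\<^esub> inv\<^bsub>H\<^esub> y)"
  proof (rule ds_differentiableI)
    fix z assume "z \<in> points (prod_ds (Diff_ds X) (Diff_ds X))"
    then have "fst z \<in> Diff X" "snd z \<in> Diff X" using ptH cH by (auto simp: prod_ds_def)
    then show "(case z of (x, y) \<Rightarrow> x \<otimes>\<^bsub>H\<^esub> inv\<^bsub>H\<^esub> y) \<in> points (Diff_ds X)"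
      using eq(1) ptH cH by (simp add: case_prod_unfold)
  next
    fix n U \<alpha> assume "plot (prod_ds (Diff_ds X) (Diff_ds X)) n U \<alpha>"
    then have p1: "plot (Diff_ds X) n U (\<lambda>x. fst (\<alpha> x))" and p2: "plot (Diff_ds X) n U (\<lambda>x. snd (\<alpha> x))"
      by (simp_all add: prod_ds_def o_def)
    show "plot (Diff_ds X) n U (\<lambda>x. case \<alpha> x of (x, y) \<Rightarrow> x \<otimes>\<^bsub>H\<^esub> inv\<^bsub>H\<^esub> y)"
      unfolding plot_Diff [OF diffeological_X] case_prod_unfold
    proof (intro conjI ballI allI impI)
      show "openin (Euclidean_space n) U" by (rule plot_DiffD(1) [OF diffeological_X p1])
      show "fst (\<alpha> t) \<otimes>\<^bsub>H\<^esub> inv\<^bsub>H\<^esub> snd (\<alpha> t) \<in> Diff X" if "t \<in> U" for t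
        by (rule eq(1) [OF plot_DiffD(2) [OF diffeological_X p1 that] plot_DiffD(2) [OF diffeological_X p2 that]])
      fix m V h b assume h: "h \<in> V \<rightarrow> U" "smooth_on m V n h" and b: "plot X m V b"
      have "plot X m V (\<lambda>y. fst (\<alpha> (h y)) (inv_into (points X) (snd (\<alpha> (h y))) (b y)))"
        by (rule plot_DiffD(3) [OF diffeological_X p1 h inverse_family [OF p2 h b]])
      then show "plot X m V (\<lambda>y. (fst (\<alpha> (h y)) \<otimes>\<^bsub>H\<^esub> inv\<^bsub>H\<^esub> snd (\<alpha> (h y))) (b y))"
      proof (rule ds_cong [OF diffeological_X])
        fix y assume y: "y \<in> V"
        then have hy: "h y \<in> U" using h(1) by blast
        show "(fst (\<alpha> (h y)) \<otimes>\<^bsub>H\<^esub> inv\<^bsub>H\<^esub> snd (\<alpha> (h y))) (b y) = fst (\<alpha> (h y)) (inv_into (points X) (snd (\<alpha> (h y))) (b y))"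
          by (rule eq(2) [OF plot_DiffD(2) [OF diffeological_X p1 hy] plot_DiffD(2) [OF diffeological_X p2 hy] ds_points [OF diffeological_X b y]])
      qed
    qed
  qed
qed

lemma Psi_hom: "group_hom S H \<Psi>"
proof -
  have "\<Psi> \<in> hom S H"
    using Psi_Diff Psi_mult by (simp add: hom_def Diff_group_simps [OF diffeological_X])
  then show ?thesis using group_S group_Diff_group [OF diffeological_X] by (simp add: group_hom_def group_hom_axioms_def)
qed

section \<open>The embedding of \<open>\<Gamma>\<close> and the kernel of the action\<close>

lemma gamma_emb_carrier:
  assumes g: "\<gamma> \<in> \<Gamma>" shows "gamma_emb G \<gamma> \<in> carrier S"
proof -
  note gc = Gamma_carrier [OF g]
  have c: "(\<lambda>x\<in>carrier G. \<gamma> \<otimes> x \<otimes> inv \<gamma>) \<in> Aut"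
  proof (rule AutI(1) [where \<kappa> = "\<lambda>x. inv \<gamma> \<otimes> x \<otimes> \<gamma>"])
    show "ds_differentiable P P (\<lambda>x\<in>carrier G. \<gamma> \<otimes> x \<otimes> inv \<gamma>)"
      by (rule ds_diff_cong [OF ds_diff_mult_const(4) [OF ds_diff_mult_const(1) [OF ds_diff_ident gc] inv_closed [OF gc]]]) simp
    show "ds_differentiable P P (\<lambda>x. inv \<gamma> \<otimes> x \<otimes> \<gamma>)"
      by (rule ds_diff_mult_const(4) [OF ds_diff_mult_const(1) [OF ds_diff_ident inv_closed [OF gc]] gc])
    show i1: "(\<lambda>x\<in>carrier G. \<gamma> \<otimes> x \<otimes> inv \<gamma>) (inv \<gamma> \<otimes> x \<otimes> \<gamma>) = x" if x: "x \<in> carrier G" for x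
    proof -
      have "\<gamma> \<otimes> (inv \<gamma> \<otimes> x \<otimes> \<gamma>) \<otimes> inv \<gamma> = (\<gamma> \<otimes> inv \<gamma>) \<otimes> x \<otimes> (\<gamma> \<otimes> inv \<gamma>)"
        using gc x by (simp only: m_assoc m_closed inv_closed)
      then show ?thesis using gc x by simp
    qed
    show "inv \<gamma> \<otimes> (\<lambda>x\<in>carrier G. \<gamma> \<otimes> x \<otimes> inv \<gamma>) x \<otimes> \<gamma> = x" if x: "x \<in> carrier G" for x
    proof -
      have "inv \<gamma> \<otimes> (\<gamma> \<otimes> x \<otimes> inv \<gamma>) \<otimes> \<gamma> = (inv \<gamma> \<otimes> \<gamma>) \<otimes> x \<otimes> (inv \<gamma> \<otimes> \<gamma>)"
        using gc x by (simp only: m_assoc m_closed inv_closed)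
      then show ?thesis using gc x by simp
    qed
    show "(\<lambda>x\<in>carrier G. \<gamma> \<otimes> x \<otimes> inv \<gamma>) (x \<otimes> y) =
        (\<lambda>x\<in>carrier G. \<gamma> \<otimes> x \<otimes> inv \<gamma>) x \<otimes> (\<lambda>x\<in>carrier G. \<gamma> \<otimes> x \<otimes> inv \<gamma>) y"
      if x: "x \<in> carrier G" "y \<in> carrier G" for x y
    proof -
      have "(\<gamma> \<otimes> x \<otimes> inv \<gamma>) \<otimes> (\<gamma> \<otimes> y \<otimes> inv \<gamma>) = \<gamma> \<otimes> x \<otimes> (inv \<gamma> \<otimes> \<gamma>) \<otimes> y \<otimes> inv \<gamma>"
        using gc x by (simp only: m_assoc m_closed inv_closed)
      then show ?thesis using gc x by (simp add: m_assoc)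
    qed
    show "(\<lambda>x\<in>carrier G. \<gamma> \<otimes> x \<otimes> inv \<gamma>) ` \<Gamma> = \<Gamma>"
    proof
      show "(\<lambda>x\<in>carrier G. \<gamma> \<otimes> x \<otimes> inv \<gamma>) ` \<Gamma> \<subseteq> \<Gamma>"
      proof
        fix z assume "z \<in> (\<lambda>x\<in>carrier G. \<gamma> \<otimes> x \<otimes> inv \<gamma>) ` \<Gamma>"
        then obtain \<delta> where "\<delta> \<in> \<Gamma>" "z = \<gamma> \<otimes> \<delta> \<otimes> inv \<gamma>" using Gamma_carrier by auto
        then show "z \<in> \<Gamma>" using g by (simp add: subgroup.m_closed [OF subgrp] subgroup.m_inv_closed [OF subgrp])
      qed
      show "\<Gamma> \<subseteq> (\<lambda>x\<in>carrier G. \<gamma> \<otimes> x \<otimes> inv \<gamma>) ` \<Gamma>"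
      proof
        fix \<delta> assume d: "\<delta> \<in> \<Gamma>"
        have "inv \<gamma> \<otimes> \<delta> \<otimes> \<gamma> \<in> \<Gamma>"
          using g d by (simp add: subgroup.m_closed [OF subgrp] subgroup.m_inv_closed [OF subgrp])
        then show "\<delta> \<in> (\<lambda>x\<in>carrier G. \<gamma> \<otimes> x \<otimes> inv \<gamma>) ` \<Gamma>" using i1 [OF Gamma_carrier [OF d]] by (metis imageI)
      qed
    qed
  qed simp
  then show ?thesis using gc by (simp add: gamma_emb_def carrier_S)
qed

text \<open>The inverse in the second component fits the twisted product: conjugation by
  \<open>\<gamma>\<close> turns \<open>inv \<delta>\<close> into
  \<open>\<gamma> \<otimes> inv \<delta> \<otimes> inv \<gamma>\<close>, and
  \<open>inv \<gamma>\<close> in front leaves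
  \<open>inv (\<gamma> \<otimes> \<delta>)\<close>.\<close>

lemma gamma_emb_hom: "gamma_emb G \<in> hom (G\<lparr>carrier := \<Gamma>\<rparr>) S"
  unfolding hom_def
proof (intro CollectI conjI ballI)
  show "gamma_emb G \<in> carrier (G\<lparr>carrier := \<Gamma>\<rparr>) \<rightarrow> carrier S" using gamma_emb_carrier by auto
  fix \<gamma> \<delta> assume "\<gamma> \<in> carrier (G\<lparr>carrier := \<Gamma>\<rparr>)" "\<delta> \<in> carrier (G\<lparr>carrier := \<Gamma>\<rparr>)"
  then have gd: "\<gamma> \<in> carrier G" "\<delta> \<in> carrier G" using Gamma_carrier by auto
  have "\<gamma> \<otimes> \<delta> \<otimes> x \<otimes> inv (\<gamma> \<otimes> \<delta>) = \<gamma> \<otimes> (\<delta> \<otimes> x \<otimes> inv \<delta>) \<otimes> inv \<gamma>" if "x \<in> carrier G" for x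
    using gd that by (simp add: inv_mult_group m_assoc)
  then have 1: "(\<lambda>x\<in>carrier G. \<gamma> \<otimes> \<delta> \<otimes> x \<otimes> inv (\<gamma> \<otimes> \<delta>)) =
      compose (carrier G) (\<lambda>x\<in>carrier G. \<gamma> \<otimes> x \<otimes> inv \<gamma>) (\<lambda>x\<in>carrier G. \<delta> \<otimes> x \<otimes> inv \<delta>)"
    using gd by (auto simp: compose_def fun_eq_iff)
  have "inv \<gamma> \<otimes> (\<gamma> \<otimes> inv \<delta> \<otimes> inv \<gamma>) = inv (\<gamma> \<otimes> \<delta>)"
    using gd by (simp add: inv_mult_group flip: m_assoc)
  then show "gamma_emb G (\<gamma> \<otimes>\<^bsub>G\<lparr>carrier := \<Gamma>\<rparr>\<^esub> \<delta>) = gamma_emb G \<gamma> \<otimes>\<^bsub>S\<^esub> gamma_emb G \<delta>"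
    using 1 gd by (simp add: gamma_emb_def mult_S)
qed

lemma gamma_emb_inj: "inj_on (gamma_emb G) \<Gamma>"
proof (rule inj_onI)
  fix x y assume "x \<in> \<Gamma>" "y \<in> \<Gamma>" "gamma_emb G x = gamma_emb G y"
  then show "x = y" using Gamma_carrier inv_inv by (metis gamma_emb_def prod.inject)
qed

text \<open>If \<open>(\<theta>, g)\<close> acts trivially, then
  \<open>x \<mapsto> g \<otimes> \<theta> x\<close> and the identity of \<open>G\<close> lift the
  same map, so the former is a right translation by some \<open>\<gamma>\<close>. At
  \<open>\<one>\<close> this gives \<open>g = \<gamma>\<close>, and \<open>\<theta>\<close> is
  conjugation by \<open>inv \<gamma>\<close>. Conversely \<open>gamma_emb G \<gamma>\<close> induces
  right translation by \<open>inv \<gamma>\<close>, which cosets do not see.\<close>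

lemma kernel_Psi: "kernel S H \<Psi> = gamma_emb G ` \<Gamma>"
proof
  show "gamma_emb G ` \<Gamma> \<subseteq> kernel S H \<Psi>"
  proof
    fix s assume "s \<in> gamma_emb G ` \<Gamma>"
    then obtain \<gamma> where g: "\<gamma> \<in> \<Gamma>" "s = gamma_emb G \<gamma>" by blast
    note gc = Gamma_carrier [OF g(1)]
    have sc: "s \<in> carrier S" using gamma_emb_carrier g by simp
    have "\<Psi> s = (\<lambda>c\<in>points X. c)"
    proof (rule extensionalityI [OF Psi_ext])
      fix c assume c: "c \<in> points X"
      then obtain x where x: "x \<in> carrier G" "c = x <# \<Gamma>" using points_X by blast
      have "\<Psi> s c = (inv \<gamma> \<otimes> (\<gamma> \<otimes> x \<otimes> inv \<gamma>)) <# \<Gamma>"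
        using sc x gc by (simp add: g(2) gamma_emb_def carrier_S Psi_apply)
      also have "inv \<gamma> \<otimes> (\<gamma> \<otimes> x \<otimes> inv \<gamma>) = x \<otimes> inv \<gamma>" using gc x by (simp flip: m_assoc)
      also have "\<dots> <# \<Gamma> = x <# \<Gamma>" by (rule coset_translate [OF x(1) subgroup.m_inv_closed [OF subgrp g(1)]])
      finally show "\<Psi> s c = (\<lambda>c\<in>points X. c) c" using c x by simp
    qed simp
    then show "s \<in> kernel S H \<Psi>" using sc by (simp add: kernel_def Diff_group_simps [OF diffeological_X])
  qed
  show "kernel S H \<Psi> \<subseteq> gamma_emb G ` \<Gamma>"
  proof
    fix s assume "s \<in> kernel S H \<Psi>"
    then obtain \<theta> g where s: "s = (\<theta>, g)" "\<theta> \<in> Aut" "g \<in> carrier G" and id: "\<Psi> s = (\<lambda>c\<in>points X. c)"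
      by (auto simp: kernel_def carrier_S Diff_group_simps [OF diffeological_X])
    have "x <# \<Gamma> = (g \<otimes> \<theta> x) <# \<Gamma>" if "x \<in> carrier G" for x
      using Psi_apply [OF s(2,3) that] id coset_in_points [OF that] s(1) by simp
    from lift_differ [OF ds_diff_ident ds_diff_mult_const(1) [OF AutD(4) [OF s(2)] s(3)] this]
    obtain \<gamma> where g: "\<gamma> \<in> \<Gamma>" "\<And>x. x \<in> carrier G \<Longrightarrow> g \<otimes> \<theta> x = x \<otimes> \<gamma>" by blast
    note gc = Gamma_carrier [OF g(1)]
    have gg: "g = \<gamma>" using g(2) [of \<one>] Aut_one [OF s(2)] s(3) gc by simp
    have "\<theta> x = inv \<gamma> \<otimes> x \<otimes> \<gamma>" if x: "x \<in> carrier G" for x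
    proof -
      have "\<theta> x = inv g \<otimes> (g \<otimes> \<theta> x)" using s(3) Aut_carrier [OF s(2) x] by (simp flip: m_assoc)
      then show ?thesis using g(2) [OF x] gg gc x by (simp add: m_assoc)
    qed
    then have "\<theta> = (\<lambda>x\<in>carrier G. inv \<gamma> \<otimes> x \<otimes> inv (inv \<gamma>))"
      using AutD(3) [OF s(2)] gc by (intro extensionalityI [of \<theta> "carrier G"]) auto
    then have "s = gamma_emb G (inv \<gamma>)" using s(1) gg gc by (simp add: gamma_emb_def)
    then show "s \<in> gamma_emb G ` \<Gamma>" using subgroup.m_inv_closed [OF subgrp g(1)] by blast
  qed
qed

section \<open>Passage to the quotient group\<close>

abbreviation "N \<equiv> gamma_emb G ` \<Gamma>"
abbreviation "Q \<equiv> semidirect_quot G M \<Gamma>"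
abbreviation "QD \<equiv> semidirect_quot_ds G M \<Gamma>"

lemma normal_N: "N \<lhd> S"
  using group_hom.normal_kernel [OF Psi_hom] by (simp add: kernel_Psi)

lemma Q_eq: "Q = S Mod kernel S H \<Psi>"
  by (simp add: semidirect_quot_def kernel_Psi)

lemma group_Q: "group Q"
  unfolding semidirect_quot_def by (rule normal.factorgroup_is_group [OF normal_N])

lemma carrier_Q: "carrier Q = (\<lambda>s. N #>\<^bsub>S\<^esub> s) ` carrier S"
  by (auto simp: semidirect_quot_def FactGroup_def RCOSETS_def)

lemma diffeological_QD: "diffeological_space QD"
  unfolding semidirect_quot_ds_def by (rule diffeological_quotient [OF diffeological_SD])

lemma points_QD: "points QD = carrier Q"
  by (simp add: semidirect_quot_ds_def quotient_ds_def points_SD carrier_Q)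

lemma plot_QD_iff:
  "plot QD n U \<alpha> \<longleftrightarrow> openin (Euclidean_space n) U \<and>
     (\<forall>x\<in>U. \<exists>V \<beta>. x \<in> V \<and> V \<subseteq> U \<and> plot SD n V \<beta> \<and> (\<forall>y\<in>V. \<alpha> y = N #>\<^bsub>S\<^esub> \<beta> y))"
  by (simp add: semidirect_quot_ds_def quotient_ds_def)

text \<open>The map induced by \<open>\<Psi>\<close> on the quotient by its kernel, in the form in
  which \<open>FactGroup_iso_set\<close> states the first isomorphism theorem: the image of a coset
  is a singleton.\<close>

definition \<Theta> :: "(('a \<Rightarrow> 'a) \<times> 'a) set \<Rightarrow> 'a set \<Rightarrow> 'a set" where
  "\<Theta> C = the_elem (\<Psi> ` C)"

lemma Theta_iso: "\<Theta> \<in> iso Q H"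
proof -
  have "\<Psi> ` carrier S = carrier H" using Psi_surj Diff_group_simps(1) [OF diffeological_X] by simp
  from group_hom.FactGroup_iso_set [OF Psi_hom this] show ?thesis
    unfolding Q_eq \<Theta>_def .
qed

lemma Theta_coset:
  assumes s: "s \<in> carrier S" shows "\<Theta> (N #>\<^bsub>S\<^esub> s) = \<Psi> s"
proof -
  interpret gh: group_hom S H \<Psi> by (rule Psi_hom)
  have "\<Psi> ` (N #>\<^bsub>S\<^esub> s) = {\<Psi> s}"
  proof
    show "\<Psi> ` (N #>\<^bsub>S\<^esub> s) \<subseteq> {\<Psi> s}"
      using s unfolding kernel_Psi [symmetric] r_coset_def kernel_def by auto
    have "\<one>\<^bsub>S\<^esub> \<in> N" by (rule subgroup.one_closed [OF normal_imp_subgroup [OF normal_N]])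
    then have "\<one>\<^bsub>S\<^esub> \<otimes>\<^bsub>S\<^esub> s \<in> N #>\<^bsub>S\<^esub> s" unfolding r_coset_def by blast
    then have "s \<in> N #>\<^bsub>S\<^esub> s" using s by simp
    then show "{\<Psi> s} \<subseteq> \<Psi> ` (N #>\<^bsub>S\<^esub> s)" by blast
  qed
  then show ?thesis by (simp add: \<Theta>_def)
qed

text \<open>The theorem asks for an isomorphism out of the diffeomorphism group, the direction
  opposite to the one that the first isomorphism theorem provides.\<close>

definition \<Phi> :: "('a set \<Rightarrow> 'a set) \<Rightarrow> (('a \<Rightarrow> 'a) \<times> 'a) set" where
  "\<Phi> = inv_into (carrier Q) \<Theta>"

lemma Phi_iso: "\<Phi> \<in> iso H Q"
  unfolding \<Phi>_def by (rule group.iso_set_sym [OF group_Q Theta_iso])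

lemma Theta_bij: "bij_betw \<Theta> (carrier Q) (carrier H)"
  using Theta_iso by (simp add: iso_def)

lemma Phi_Psi: "s \<in> carrier S \<Longrightarrow> \<Phi> (\<Psi> s) = N #>\<^bsub>S\<^esub> s"
  using inv_into_f_f [OF bij_betw_imp_inj_on [OF Theta_bij], of "N #>\<^bsub>S\<^esub> s"] Theta_coset [of s] carrier_Q
  by (simp add: \<Phi>_def)

lemma points_Diff_ds: "points (Diff_ds X) = carrier H"
  using Diff_group_simps(1) [OF diffeological_X] by (simp add: Diff_ds_def subset_ds_def)

text \<open>Local sections of \<open>\<Psi>\<close> are the local lifts that a plot of the quotient
  group is required to have.\<close>

lemma Phi_differentiable: "ds_differentiable (Diff_ds X) QD \<Phi>"
proof (rule ds_differentiableI)
  show "\<Phi> f \<in> points QD" if "f \<in> points (Diff_ds X)" for f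
    using Phi_iso that by (auto simp: iso_def hom_def points_QD points_Diff_ds)
  fix n U \<alpha> assume p: "plot (Diff_ds X) n U \<alpha>"
  show "plot QD n U (\<lambda>x. \<Phi> (\<alpha> x))"
    unfolding plot_QD_iff
  proof (intro conjI ballI)
    show "openin (Euclidean_space n) U" by (rule plot_DiffD(1) [OF diffeological_X p])
    fix x assume x: "x \<in> U"
    obtain V s where V: "x \<in> V" "V \<subseteq> U" "plot SD n V s" "\<And>t. t \<in> V \<Longrightarrow> \<Psi> (s t) = \<alpha> t"
      by (rule local_section [OF p x]) (rule that)
    have "\<Phi> (\<alpha> y) = N #>\<^bsub>S\<^esub> s y" if "y \<in> V" for y
      using Phi_Psi [of "s y"] V(4) [OF that] ds_points [OF diffeological_SD V(3) that] points_SD by simp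
    then show "\<exists>V \<beta>. x \<in> V \<and> V \<subseteq> U \<and> plot SD n V \<beta> \<and> (\<forall>y\<in>V. \<Phi> (\<alpha> y) = N #>\<^bsub>S\<^esub> \<beta> y)"
      using V(1,2,3) by blast
  qed
qed

text \<open>A plot of the quotient group lifts locally to the semidirect product, where
  \<open>\<Theta>\<close> becomes \<open>\<Psi>\<close>.\<close>

lemma Theta_differentiable: "ds_differentiable QD (Diff_ds X) \<Theta>"
proof (rule ds_differentiableI)
  show "\<Theta> c \<in> points (Diff_ds X)" if "c \<in> points QD" for c
    using Theta_iso that by (auto simp: iso_def hom_def points_QD points_Diff_ds)
  fix n U \<alpha> assume p: "plot QD n U \<alpha>"
  show "plot (Diff_ds X) n U (\<lambda>x. \<Theta> (\<alpha> x))"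
  proof (rule ds_local [OF diffeological_Diff [OF diffeological_X] ds_open [OF diffeological_QD p]])
    fix x assume "x \<in> U"
    then have "\<exists>V \<beta>. x \<in> V \<and> V \<subseteq> U \<and> plot SD n V \<beta> \<and> (\<forall>y\<in>V. \<alpha> y = N #>\<^bsub>S\<^esub> \<beta> y)"
      using p unfolding plot_QD_iff by blast
    then obtain V \<beta> where V: "x \<in> V" "V \<subseteq> U" "plot SD n V \<beta>" "\<And>y. y \<in> V \<Longrightarrow> \<alpha> y = N #>\<^bsub>S\<^esub> \<beta> y" by blast
    have "\<Theta> (\<alpha> y) = \<Psi> (\<beta> y)" if "y \<in> V" for y
      using Theta_coset [of "\<beta> y"] V(4) [OF that] ds_points [OF diffeological_SD V(3) that] points_SD by simp
    then show "\<exists>V \<beta>. x \<in> V \<and> V \<subseteq> U \<and> plot (Diff_ds X) n V \<beta> \<and> (\<forall>y\<in>V. \<Theta> (\<alpha> y) = \<beta> y)"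
      using V(1,2) Psi_plot [OF V(3)] by blast
  qed
qed

lemma Phi_Theta: "c \<in> carrier Q \<Longrightarrow> \<Phi> (\<Theta> c) = c"
  unfolding \<Phi>_def by (rule bij_betw_inv_into_left [OF Theta_bij])

lemma Phi_dgroup_iso: "\<Phi> \<in> dgroup_iso H (Diff_ds X) Q QD"
proof -
  have bij: "bij_betw \<Phi> (carrier H) (carrier Q)" using Phi_iso by (simp add: iso_def)
  have inv: "inv_into (carrier H) \<Phi> c = \<Theta> c" if "c \<in> carrier Q" for c
    using bij_betw_inv_into_left [OF bij, of "\<Theta> c"] Phi_Theta [OF that] bij_betw_apply [OF Theta_bij that] by simp
  have "ds_differentiable QD (Diff_ds X) (inv_into (carrier H) \<Phi>)"
  proof (rule ds_differentiableI)
    show "inv_into (carrier H) \<Phi> c \<in> points (Diff_ds X)" if "c \<in> points QD" for c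
      using inv that bij_betw_apply [OF Theta_bij] by (simp add: points_QD points_Diff_ds)
    show "plot (Diff_ds X) n U (\<lambda>x. inv_into (carrier H) \<Phi> (\<alpha> x))" if p: "plot QD n U \<alpha>" for n U \<alpha>
      by (rule ds_cong [OF diffeological_Diff [OF diffeological_X] ds_differentiableD [OF Theta_differentiable p]])
        (use inv ds_points [OF diffeological_QD p] points_QD in auto)
  qed
  then have "diffeomorphism (Diff_ds X) QD \<Phi>"
    using bij Phi_differentiable by (simp add: diffeomorphism_def points_Diff_ds points_QD)
  moreover have "diffeological_group Q QD"
    by (rule dgroup_transport [where \<Phi> = \<Phi> and \<Psi> = \<Theta>, OF diffeological_group_Diff group_Q diffeological_QD
          points_QD Phi_iso Phi_differentiable Theta_differentiable Phi_Theta])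
  ultimately show ?thesis using Phi_iso diffeological_group_Diff by (simp add: dgroup_iso_def)
qed

end

theorem theorem4p3:
  fixes G :: "('a, 'b) monoid_scheme" and M :: "'a manifold" and \<Gamma> :: "'a set"
  assumes "lie_group G M"
    and "connected_space (mtop M)"
    and "simply_connected_space (mtop M)"
    and "subgroup \<Gamma> G"
    and "totally_disconnected_space (subtopology (mtop M) \<Gamma>)"
    and "mtop M closure_of \<Gamma> = topspace (mtop M)"
  shows "gamma_emb G \<in> hom (G\<lparr>carrier := \<Gamma>\<rparr>) (semidirect G M \<Gamma>)
     \<and> inj_on (gamma_emb G) \<Gamma>
     \<and> gamma_emb G ` \<Gamma> \<lhd> semidirect G M \<Gamma>
     \<and> (\<exists>\<Phi>. \<Phi> \<in> dgroup_iso (Diff_group (coset_ds G M \<Gamma>)) (Diff_ds (coset_ds G M \<Gamma>))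
                         (semidirect_quot G M \<Gamma>) (semidirect_quot_ds G M \<Gamma>))"
proof -
  have "group G" using assms(1) by (simp add: lie_group_def)
  then interpret lie_pair G M \<Gamma> using assms by (simp add: lie_pair_def lie_pair_axioms_def)
  show ?thesis using gamma_emb_hom gamma_emb_inj normal_N Phi_dgroup_iso by blast
qed

end
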